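(* For a velocity distribution $g\in\mathcal{M}(\mathbb{R})$ suppose $\int_0^\infty|\hat g(\xi)|\,d\xi<\infty$ and let $$K_{ec}=\frac{2}{\int_0^\infty|\hat g(\xi)|\,d\xi}.$$ If the coupling constant $K$ satisfies $K<K_{ec}$, then there exist a finite constant $c>0$ and a bounded increasing weight $\phi\in C^1(\mathbb{R}^+)$ with $\phi(0)=1$ such that for a solution $\rho_\cdot$ to the Kuramoto equation with velocity marginal $g$, with Fourier transform $u$ and order parameter $\eta$, the energy functional $$I(t)=\int_0^\infty\sum_{l\ge1}\frac1l|u(t,l,\xi)|^2\phi(\xi)\,d\xi$$ satisfies $$I(t)+c\int_0^t|\eta(s)|^2\,ds\le I(0)\qquad\text{for all }t\in\mathbb{R}^+.$$ In particular this shows that $I$ is non-increasing and the order parameter $\eta$ satisfies $$\int_0^\infty|\eta(s)|^2\,ds\le c^{-1}I(0)<\infty.$$ If, moreover, the initial distribution $\rho_{in}$ has a density $f_{in}\in L^2(\Gamma)$, then $I(0)\le\|\phi\|_\infty\|f_{in}\|_2^2$.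
   Context: $\mathbb{R}^+=[0,\infty)$, $\mathbb{N}=\{1,2,\dots\}$, $\mathbb{T}=[0,2\pi)$ is the torus, $\Gamma=\mathbb{T}\times\mathbb{R}$, and $\mathcal{M}(X)$ is the set of Borel probability measures on $X$. The coupling constant is $K\ge0$. A solution to the Kuramoto equation with initial data $\rho_{in}\in\mathcal{M}(\Gamma)$ is a family $(\rho_t)_{t\in\mathbb{R}^+}$ in $\mathcal{M}(\Gamma)$ such that $t\mapsto\int h\,d\rho_t$ is continuous for every $h\in C_b(\Gamma)$, and for all compactly supported $h\in C^1(\mathbb{R}^+\times\Gamma)$ $$0=\int_\Gamma h(0,P)\rho_{in}(dP)+\int_{\mathbb{R}^+}\int_\Gamma\big[V(t,P)\partial_\theta h(t,P)+\partial_th(t,P)\big]\rho_t(dP)\,dt,$$ where $V(t,\theta,\omega)=\omega+\frac{K}{2i}\big(\eta(t)e^{-i\theta}-\overline{\eta(t)}e^{i\theta}\big)$ and $\eta(t)=\int_\Gamma e^{i\theta}\rho_t(d\theta,d\omega)$ is the order parameter. The solution has velocity marginal $g$ if $g(A)=\rho_{in}(\mathbb{T}\times A)$ for all Borel $A\subset\mathbb{R}$ (this marginal is constant in time). Fourier transforms: $u(t,l,\xi)=\int_\Gamma e^{il\theta}e^{i\xi\omega}\rho_t(d\theta,d\omega)$ and $\hat g(\xi)=\int_{\mathbb{R}}e^{i\xi\omega}g(d\omega)$; thus $\eta(t)=u(t,1,0)$.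
   Formalization: c^{-1}I(0)<∞ is claimed only when I(0)<∞ (it is infinite for a point mass in phase times g), and the density f_in and its L² norm are taken with respect to dθdω/(2π)², since the bound I(0)≤‖φ‖_∞‖f_in‖_2² without a constant fails for plain dθdω. *)

theory Defs
  imports "HOL-Probability.Probability"
begin

text \<open>
  The phase space is the torus \<open>[0, 2\<pi>)\<close> times the line. Its Borel sets are those of the plane
  traced on the strip; the topology of the torus enters only through the periodicity conditions on
  the test functions below. The Borel probability measures on \<open>X\<close> are
  \<open>space (prob_algebra X)\<close>.
\<close>

definition Gamma :: "(real \<times> real) set" where
  "Gamma = {0..<2*pi} \<times> UNIV"

definition Gamma_borel :: "(real \<times> real) measure" where
  "Gamma_borel = restrict_space borel Gamma"

definition bounded_continuous_Gamma :: "(real \<times> real \<Rightarrow> real) \<Rightarrow> bool" where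
  "bounded_continuous_Gamma h \<longleftrightarrow>
     continuous_on UNIV h \<and> bounded (range h) \<and> (\<forall>\<theta> \<omega>. h (\<theta> + 2*pi, \<omega>) = h (\<theta>, \<omega>))"

text \<open>
  \<open>test_function h ht h\<theta> h\<omega>\<close>: the function \<open>h t \<theta> \<omega>\<close> is \<open>C\<^sup>1\<close> with compact support on
  \<open>[0, \<infinity>) \<times> Gamma\<close>, with partial derivatives \<open>ht\<close>, \<open>h\<theta>\<close>, \<open>h\<omega>\<close> (one-sided in \<open>t\<close> at \<open>t = 0\<close>,
  where \<open>h\<close> need not vanish). As the torus is compact, compact support only restricts \<open>t\<close> and \<open>\<omega>\<close>.
\<close>

definition test_function ::
  "(real \<Rightarrow> real \<Rightarrow> real \<Rightarrow> real) \<Rightarrow> (real \<Rightarrow> real \<Rightarrow> real \<Rightarrow> real) \<Rightarrow>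
   (real \<Rightarrow> real \<Rightarrow> real \<Rightarrow> real) \<Rightarrow> (real \<Rightarrow> real \<Rightarrow> real \<Rightarrow> real) \<Rightarrow> bool" where
  "test_function h ht h\<theta> h\<omega> \<longleftrightarrow>
     (\<forall>t\<ge>0. \<forall>\<theta> \<omega>.
        ((\<lambda>s. h s \<theta> \<omega>) has_real_derivative ht t \<theta> \<omega>) (at t within {0..}) \<and>
        ((\<lambda>x. h t x \<omega>) has_real_derivative h\<theta> t \<theta> \<omega>) (at \<theta>) \<and>
        ((\<lambda>y. h t \<theta> y) has_real_derivative h\<omega> t \<theta> \<omega>) (at \<omega>) \<and>
        h t (\<theta> + 2*pi) \<omega> = h t \<theta> \<omega>) \<and>
     (\<forall>f\<in>{h, ht, h\<theta>, h\<omega>}.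
        continuous_on ({0..} \<times> UNIV \<times> UNIV) (\<lambda>(t, \<theta>, \<omega>). f t \<theta> \<omega>)) \<and>
     (\<exists>R. \<forall>t\<ge>0. \<forall>\<theta> \<omega>. t > R \<or> \<bar>\<omega>\<bar> > R \<longrightarrow> h t \<theta> \<omega> = 0)"

definition fourier_u :: "(real \<Rightarrow> (real \<times> real) measure) \<Rightarrow> real \<Rightarrow> int \<Rightarrow> real \<Rightarrow> complex" where
  "fourier_u \<rho> t l \<xi> = (LINT (\<theta>, \<omega>)|\<rho> t. iexp (of_int l * \<theta>) * iexp (\<xi> * \<omega>))"

definition order_parameter :: "(real \<Rightarrow> (real \<times> real) measure) \<Rightarrow> real \<Rightarrow> complex" where
  "order_parameter \<rho> t = (LINT (\<theta>, \<omega>)|\<rho> t. iexp \<theta>)"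

text \<open>The coupling term is real-valued, being \<open>1/(2\<i>)\<close> times \<open>z - cnj z\<close>; \<open>Re\<close> is only a coercion.\<close>

definition velocity ::
  "real \<Rightarrow> (real \<Rightarrow> (real \<times> real) measure) \<Rightarrow> real \<Rightarrow> real \<Rightarrow> real \<Rightarrow> real" where
  "velocity K \<rho> t \<theta> \<omega> =
     \<omega> + Re (of_real K / (2 * \<i>) *
       (order_parameter \<rho> t * iexp (- \<theta>) - cnj (order_parameter \<rho> t) * iexp \<theta>))"

definition kuramoto_solution ::
  "real \<Rightarrow> (real \<times> real) measure \<Rightarrow> (real \<Rightarrow> (real \<times> real) measure) \<Rightarrow> bool" where
  "kuramoto_solution K \<rho>in \<rho> \<longleftrightarrow>
     \<rho>in \<in> space (prob_algebra Gamma_borel) \<and>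
     (\<forall>t\<ge>0. \<rho> t \<in> space (prob_algebra Gamma_borel)) \<and>
     (\<forall>h. bounded_continuous_Gamma h \<longrightarrow> continuous_on {0..} (\<lambda>t. LINT P|\<rho> t. h P)) \<and>
     (\<forall>h ht h\<theta> h\<omega>. test_function h ht h\<theta> h\<omega> \<longrightarrow>
        0 = (LINT (\<theta>, \<omega>)|\<rho>in. h 0 \<theta> \<omega>) +
            (LINT t:{0..}|lborel.
               (LINT (\<theta>, \<omega>)|\<rho> t. velocity K \<rho> t \<theta> \<omega> * h\<theta> t \<theta> \<omega> + ht t \<theta> \<omega>)))"

definition has_velocity_marginal :: "(real \<times> real) measure \<Rightarrow> real measure \<Rightarrow> bool" where
  "has_velocity_marginal \<rho>in g \<longleftrightarrow>
     (\<forall>A\<in>sets borel. measure g A = measure \<rho>in ({0..<2*pi} \<times> A))"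

definition K_ec :: "real measure \<Rightarrow> real" where
  "K_ec g = 2 / (LINT \<xi>:{0..}|lborel. norm (char g \<xi>))"

text \<open>
  The energy takes values in \<open>[0, \<infinity>]\<close>: for the point mass in the phase times \<open>g\<close>, for instance, it
  is infinite. It is used with weights \<open>\<phi> \<ge> 0\<close> on \<open>[0, \<infinity>)\<close>. The sum runs over \<open>l + 1 \<ge> 1\<close>.
\<close>

definition energy ::
  "(real \<Rightarrow> real) \<Rightarrow> (real \<Rightarrow> (real \<times> real) measure) \<Rightarrow> real \<Rightarrow> ennreal" where
  "energy \<phi> \<rho> t =
     (\<integral>\<^sup>+\<xi>\<in>{0..}. (\<Sum>l. ennreal (1 / real (Suc l) * (norm (fourier_u \<rho> t (int (Suc l)) \<xi>))\<^sup>2 * \<phi> \<xi>))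
        \<partial>lborel)"

definition C1_weight :: "(real \<Rightarrow> real) \<Rightarrow> bool" where
  "C1_weight \<phi> \<longleftrightarrow>
     (\<exists>\<phi>'. (\<forall>x\<ge>0. (\<phi> has_real_derivative \<phi>' x) (at x within {0..})) \<and> continuous_on {0..} \<phi>')"

text \<open>
  The reference measure for densities and for the \<open>L\<^sup>2\<close> norm is \<open>d\<theta>/(2\<pi>) d\<omega>/(2\<pi>)\<close>, for which the
  Fourier transform with kernel \<open>exp (\<i> l \<theta>) exp (\<i> \<xi> \<omega>)\<close> is an isometry into \<open>L\<^sup>2\<close> of counting times
  Lebesgue measure. A density \<open>f0\<close> with respect to \<open>d\<theta> d\<omega>\<close> corresponds to \<open>f = (2\<pi>)\<^sup>2 f0\<close>, and
  the squared norm of \<open>f\<close> is then \<open>(2\<pi>)\<^sup>2\<close> times the Lebesgue integral of \<open>f0\<^sup>2\<close>.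

  The constant-free bound of the energy by the \<open>L\<^sup>2\<close> norm depends on this normalisation. With
  unnormalised \<open>d\<theta> d\<omega>\<close> it fails for every admissible \<open>g\<close> and every weight: \<open>g\<close> has a density, say \<open>G\<close>,
  in \<open>L\<^sup>2\<close>, and \<open>f0 = (1 + cos (\<theta> + a \<omega>)) G(\<omega>) / (2\<pi>)\<close> has squared norm \<open>3/(4\<pi>)\<close> times that of \<open>G\<close>,
  while its energy tends, as \<open>a \<rightarrow> \<infinity>\<close>, to \<open>\<pi>/2\<close> times that of \<open>G\<close> times the supremum of the weight.
\<close>

definition Gamma_measure :: "(real \<times> real) measure" where
  "Gamma_measure = scale_measure (ennreal (1 / (2*pi)\<^sup>2)) (restrict_space lborel Gamma)"

end

theory Submission
  imports Defs
begin

text \<open>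
  On the Fourier side the Kuramoto equation reads
  \<open>\<partial>\<^sub>t u\<^sub>l = l \<partial>\<^sub>\<xi> u\<^sub>l + (K l / 2) (\<eta> u\<^sub>l\<^sub>-\<^sub>1 - cnj \<eta> u\<^sub>l\<^sub>+\<^sub>1)\<close>: the mode \<open>l\<close> is transported towards smaller \<open>\<xi>\<close> with speed
  \<open>l\<close> and exchanges mass with its neighbours. With the weights \<open>1/l\<close> the exchange terms in the derivative
  of \<open>\<Sum>\<^sub>l |u\<^sub>l|\<^sup>2 / l\<close> telescope, and only the flux \<open>K Re (\<eta> u\<^sub>0 cnj u\<^sub>1)\<close> out of the mode \<open>0\<close> is left. This mode
  is constant in time, equal to the Fourier transform \<open>G\<close> of the velocity distribution. Integration against an
  increasing weight \<open>\<phi>\<close> turns the transport into the losses \<open>\<phi>(0) \<Sum>\<^sub>l |u\<^sub>l(t, 0)|\<^sup>2\<close>, which contains \<open>|\<eta>|\<^sup>2\<close>, and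
  \<open>\<integral> \<phi>' \<Sum>\<^sub>l |u\<^sub>l|\<^sup>2 d\<xi>\<close>. By \<open>2 a b \<le> a\<^sup>2 + b\<^sup>2\<close> the flux, weighted by \<open>\<phi>\<close>, is at most
  \<open>\<phi>' |u\<^sub>1|\<^sup>2 + |\<eta>|\<^sup>2 K\<^sup>2 \<phi>\<^sup>2 |G|\<^sup>2 / (4 \<phi>')\<close>, so a multiple of \<open>|\<eta>|\<^sup>2\<close> is really lost as soon as
  \<open>(K\<^sup>2 / 4) \<integral> \<phi>\<^sup>2 |G|\<^sup>2 / \<phi>' d\<xi> < 1\<close>. Writing \<open>\<phi>' = m \<phi>\<^sup>2\<close>, that is \<open>1/\<phi> = 1 - \<integral> m\<close>, a bounded weight needs
  \<open>\<integral> m < 1\<close> and the condition becomes \<open>(K\<^sup>2 / 4) \<integral> |G|\<^sup>2 / m < 1\<close>. With \<open>m\<close> almost equal to \<open>|G| / \<integral> |G|\<close> both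
  hold precisely because \<open>K \<integral> |G| < 2\<close>; this is the lemma \<open>exists_energy_weight\<close>.

  Three points keep this from being a proof. First, solutions are weak and measure-valued and the velocities are
  unbounded, so \<open>u\<^sub>l\<close> need not be differentiable in \<open>\<xi>\<close>. Along the characteristics \<open>\<xi> = \<zeta> - l t\<close>, however, the
  unbounded factor \<open>\<omega>\<close> drops out and \<open>u\<^sub>l\<close> is continuously differentiable in \<open>t\<close> (\<open>mode_equation\<close>). To reach this
  from compactly supported test functions one cuts off large velocities; the cut-off is harmless uniformly in time
  because the mass it removes is conserved (\<open>cutoff_mass_conserved\<close>). The integrated form of the transport term is
  then a matter of Fubini's theorem (\<open>transport_identity\<close>).

  Second, the energy at positive times might be infinite, and a telescoping series leaves a remainder unless its
  terms decay. The weights are therefore damped by \<open>(1 + \<epsilon> (l + \<xi>))\<^sup>-\<^sup>2\<close>. The logarithmic derivative of this factor in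
  \<open>\<xi>\<close> and in \<open>l\<close> is at most of order \<open>min \<epsilon> (1/l)\<close>. The bound \<open>1/l\<close> shows that damping costs only a Gronwall
  factor independent of \<open>\<epsilon>\<close>, so that the energy stays finite (\<open>modal_energy_finite_bound\<close>); once this is known,
  the bound \<open>\<epsilon>\<close> makes the cost vanish as \<open>\<epsilon> \<rightarrow> 0\<close> by dominated convergence (\<open>modal_energy_decay\<close>).

  Third, the bound of the initial energy by the \<open>L\<^sup>2\<close> norm is half of Plancherel's theorem on the product of the
  torus and the line, namely Bessel's inequality (\<open>fourier_L2_bound\<close>). It follows by averaging over the frequencies
  with Fejer weights in \<open>l\<close> and Gaussian weights in \<open>\<xi>\<close>: the kernel obtained is nonnegative and integrable, and
  Schur's test applies.
\<close>

section \<open>Set integrals and slices\<close>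

lemma set_integral_sum:
  fixes f :: "'i \<Rightarrow> 'a \<Rightarrow> real"
  assumes "\<And>i. i \<in> I \<Longrightarrow> set_integrable M A (f i)"
  shows "(LINT x:A|M. \<Sum>i\<in>I. f i x) = (\<Sum>i\<in>I. LINT x:A|M. f i x)"
  using assms unfolding set_lebesgue_integral_def set_integrable_def
  by (simp add: sum_distrib_left)

lemma set_integrable_sum:
  fixes f :: "'i \<Rightarrow> 'a \<Rightarrow> real"
  assumes "\<And>i. i \<in> I \<Longrightarrow> set_integrable M A (f i)"
  shows "set_integrable M A (\<lambda>x. \<Sum>i\<in>I. f i x)"
  using assms unfolding set_integrable_def by (simp add: sum_distrib_left)

lemma set_integrable_mult_bounded:
  fixes f g :: "real \<Rightarrow> real"
  assumes f: "set_integrable lborel {0..} f" and g: "continuous_on {0..} g" and le: "\<And>\<xi>. 0 \<le> \<xi> \<Longrightarrow> \<bar>g \<xi>\<bar> \<le> C"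
  shows "set_integrable lborel {0..} (\<lambda>\<xi>. g \<xi> * f \<xi>)"
proof -
  have [measurable]: "(\<lambda>\<xi>. indicator {0..} \<xi> * f \<xi>) \<in> borel_measurable borel"
    using borel_measurable_integrable[OF f[unfolded set_integrable_def]] by simp
  have [measurable]: "(\<lambda>\<xi>. indicator {0..} \<xi> * g \<xi>) \<in> borel_measurable borel"
    using borel_measurable_continuous_on_indicator[OF _ g] by simp
  have "integrable lborel (\<lambda>\<xi>. (indicator {0..} \<xi> * g \<xi>) * (indicator {0..} \<xi> * f \<xi>))"
  proof (rule Bochner_Integration.integrable_bound)
    show "integrable lborel (\<lambda>\<xi>. C * (indicator {0..} \<xi> * f \<xi>))"
      using f by (auto simp: set_integrable_def)
    show "AE \<xi> in lborel. norm (indicator {0..} \<xi> * g \<xi> * (indicator {0..} \<xi> * f \<xi>)) \<le> norm (C * (indicator {0..} \<xi> * f \<xi>))"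
      using order.trans[OF le abs_ge_self] by (auto simp: abs_mult indicator_def intro!: mult_right_mono)
  qed measurable
  moreover have "(indicator {0..} \<xi> * g \<xi>) * (indicator {0..} \<xi> * f \<xi>) = indicator {0..} \<xi> *\<^sub>R (g \<xi> * f \<xi>)" for \<xi>
    by (simp add: indicator_def)
  ultimately show ?thesis by (simp add: set_integrable_def)
qed

text \<open>
  The integral over \<open>\<xi>\<close> of an integrable weight times a bounded continuous function of \<open>(s, \<xi>)\<close> is, as a function
  of \<open>s\<close>, measurable and bounded: exactly what integration in time needs.
\<close>
lemma slice_integrals:
  fixes w :: "real \<Rightarrow> real" and A :: "real \<Rightarrow> real \<Rightarrow> real" and M :: real
  assumes w: "set_integrable lborel {0..} w"
    and A_cont: "continuous_on UNIV (\<lambda>p. A (fst p) (snd p))"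
    and A_le: "\<And>s \<xi>. \<bar>A s \<xi>\<bar> \<le> M"
  shows "set_integrable lborel {0..} (\<lambda>\<xi>. w \<xi> * A s \<xi>)"
    and "\<bar>LINT \<xi>:{0..}|lborel. w \<xi> * A s \<xi>\<bar> \<le> M * (LINT \<xi>:{0..}|lborel. \<bar>w \<xi>\<bar>)"
    and "set_integrable lborel {a..b} (\<lambda>s. LINT \<xi>:{0..}|lborel. w \<xi> * A s \<xi>)"
proof -
  have wi: "integrable lborel (\<lambda>\<xi>. indicator {0..} \<xi> * w \<xi>)"
    using w by (simp add: set_integrable_def)
  note [measurable] = borel_measurable_integrable[OF wi]
  have [measurable]: "(\<lambda>p. A (fst p) (snd p)) \<in> borel_measurable (borel \<Otimes>\<^sub>M borel)"
    using A_cont by (auto simp: borel_prod intro: borel_measurable_continuous_onI)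
  have M: "0 \<le> M" using A_le[of 0 0] by linarith
  have [measurable]: "(\<lambda>\<xi>. A s \<xi>) \<in> borel_measurable borel" for s
  proof -
    have "(\<lambda>\<xi>. (\<lambda>p. A (fst p) (snd p)) (s, \<xi>)) \<in> borel_measurable borel" by measurable
    then show ?thesis by simp
  qed
  have int: "integrable lborel (\<lambda>\<xi>. (indicator {0..} \<xi> * w \<xi>) * A s \<xi>)" for s
  proof (rule Bochner_Integration.integrable_bound)
    show "integrable lborel (\<lambda>\<xi>. M * (indicator {0..} \<xi> * w \<xi>))"
      using wi by auto
    have "\<bar>A s \<xi>\<bar> * \<bar>w \<xi>\<bar> \<le> \<bar>M\<bar> * \<bar>w \<xi>\<bar>" for \<xi>
      using A_le[of s \<xi>] by (intro mult_right_mono) auto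
    then show "AE \<xi> in lborel. norm (indicator {0..} \<xi> * w \<xi> * A s \<xi>) \<le> norm (M * (indicator {0..} \<xi> * w \<xi>))"
      by (auto simp: abs_mult indicator_def mult.commute)
  qed measurable
  show int': "set_integrable lborel {0..} (\<lambda>\<xi>. w \<xi> * A s \<xi>)" for s
    using int[of s] by (simp add: set_integrable_def mult.assoc)
  have eq: "(LINT \<xi>:{0..}|lborel. w \<xi> * A s \<xi>) = (LINT \<xi>|lborel. (indicator {0..} \<xi> * w \<xi>) * A s \<xi>)" for s
    by (simp add: set_lebesgue_integral_def mult.assoc)
  show le: "\<bar>LINT \<xi>:{0..}|lborel. w \<xi> * A s \<xi>\<bar> \<le> M * (LINT \<xi>:{0..}|lborel. \<bar>w \<xi>\<bar>)" for s
  proof -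
    have "\<bar>LINT \<xi>:{0..}|lborel. w \<xi> * A s \<xi>\<bar> \<le> (LINT \<xi>|lborel. \<bar>(indicator {0..} \<xi> * w \<xi>) * A s \<xi>\<bar>)"
      unfolding eq by (rule integral_abs_bound)
    also have "\<dots> \<le> (LINT \<xi>|lborel. M * \<bar>indicator {0..} \<xi> * w \<xi>\<bar>)"
      using wi int[of s] A_le M
      by (intro integral_mono integrable_abs integrable_mult_right) (auto simp: abs_mult mult.commute intro!: mult_right_mono)
    also have "\<dots> = M * (LINT \<xi>:{0..}|lborel. \<bar>w \<xi>\<bar>)"
      by (simp add: set_lebesgue_integral_def abs_mult)
    finally show ?thesis .
  qed
  show "set_integrable lborel {a..b} (\<lambda>s. LINT \<xi>:{0..}|lborel. w \<xi> * A s \<xi>)"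
  proof (cases "a \<le> b")
    case True
    show ?thesis
      unfolding set_integrable_def
    proof (rule Bochner_Integration.integrable_bound)
      show "integrable lborel (\<lambda>s. indicator {a..b} s * (M * (LINT \<xi>:{0..}|lborel. \<bar>w \<xi>\<bar>)))"
        using True by (intro integrable_mult_left integrable_real_indicator) auto
      have [measurable]: "(\<lambda>p. A (fst p) (snd p)) \<in> borel_measurable (lborel \<Otimes>\<^sub>M lborel)" by measurable
      have "(\<lambda>s. LINT \<xi>|lborel. (indicator {0..} \<xi> * w \<xi>) * (\<lambda>p. A (fst p) (snd p)) (s, \<xi>)) \<in> borel_measurable lborel"
        by measurable
      then have [measurable]: "(\<lambda>s. LINT \<xi>:{0..}|lborel. w \<xi> * A s \<xi>) \<in> borel_measurable lborel"
        unfolding eq by simp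
      show "(\<lambda>s. indicator {a..b} s *\<^sub>R (LINT \<xi>:{0..}|lborel. w \<xi> * A s \<xi>)) \<in> borel_measurable lborel"
        by measurable
      show "AE s in lborel. norm (indicator {a..b} s *\<^sub>R (LINT \<xi>:{0..}|lborel. w \<xi> * A s \<xi>))
          \<le> norm (indicator {a..b} s * (M * (LINT \<xi>:{0..}|lborel. \<bar>w \<xi>\<bar>)))"
        using order.trans[OF le abs_ge_self] by (auto simp: abs_mult intro!: mult_left_mono)
    qed
  next
    case False
    then show ?thesis by simp
  qed
qed

lemma integral_from_0_has_derivative:
  fixes f :: "real \<Rightarrow> real"
  assumes f: "continuous_on {0..} f" and x: "0 \<le> x"
  shows "((\<lambda>x. integral {0..x} f) has_real_derivative f x) (at x within {0..})"
proof -
  have "((\<lambda>x. integral {0..x} f) has_real_derivative f x) (at x within {0..x + 1})"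
    using x by (intro integral_has_real_derivative continuous_on_subset[OF f]) auto
  moreover have "at x within {0..} = at x within {0..x + 1}"
    by (rule at_within_nhd[of x "{..<x + 1}"]) (use x in auto)
  ultimately show ?thesis by simp
qed

section \<open>Transport on a half-line\<close>

text \<open>
  Suppose that \<open>\<partial>\<^sub>t A - l \<partial>\<^sub>\<xi> A = D\<close> holds only along the characteristics \<open>\<xi> = \<zeta> - l s\<close>, without a derivative of \<open>A\<close>
  in \<open>\<xi>\<close>. Then the moment of \<open>A\<close> with weight \<open>W\<close> still evolves as integration by parts suggests: \<open>A\<close> leaves
  the half-line through \<open>\<xi> = 0\<close>, and the weight is differentiated. For each \<open>\<zeta>\<close> the fundamental theorem applied to
  \<open>W A\<close> along the characteristic, up to the time at which it leaves the half-line, gives the identity; integrating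
  over \<open>\<zeta> \<ge> 0\<close> and exchanging the order of integration gives the claim.
\<close>
lemma transport_identity:
  fixes W W' :: "real \<Rightarrow> real" and A D :: "real \<Rightarrow> real \<Rightarrow> real" and l t M :: real
  assumes l: "0 < l" and t: "0 \<le> t"
    and W: "\<And>\<xi>. 0 \<le> \<xi> \<Longrightarrow> (W has_real_derivative W' \<xi>) (at \<xi> within {0..})"
    and W'_cont: "continuous_on {0..} W'"
    and W_int: "set_integrable lborel {0..} W" and W'_int: "set_integrable lborel {0..} W'"
    and A_cont: "continuous_on UNIV (\<lambda>p. A (fst p) (snd p))"
    and D_cont: "continuous_on UNIV (\<lambda>p. D (fst p) (snd p))"
    and A_le: "\<And>s \<xi>. \<bar>A s \<xi>\<bar> \<le> M" and D_le: "\<And>s \<xi>. \<bar>D s \<xi>\<bar> \<le> M"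
    and AD: "\<And>\<zeta> s. 0 \<le> s \<Longrightarrow>
      ((\<lambda>s. A s (\<zeta> - l * s)) has_real_derivative D s (\<zeta> - l * s)) (at s within {0..})"
  shows "set_integrable lborel {0..t} (\<lambda>s. LINT \<xi>:{0..}|lborel. W \<xi> * D s \<xi> - l * W' \<xi> * A s \<xi>)"
    and "(LINT \<xi>:{0..}|lborel. W \<xi> * A t \<xi>) = (LINT \<xi>:{0..}|lborel. W \<xi> * A 0 \<xi>)
      + (LINT s:{0..t}|lborel. (LINT \<xi>:{0..}|lborel. W \<xi> * D s \<xi> - l * W' \<xi> * A s \<xi>) - l * W 0 * A s 0)"
proof -
  let ?R = "\<lambda>s. LINT \<xi>:{0..}|lborel. W \<xi> * D s \<xi> - l * W' \<xi> * A s \<xi>"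
  define Q where "Q s \<xi> = indicator {0..} \<xi> * (W \<xi> * D s \<xi> - l * W' \<xi> * A s \<xi>)" for s \<xi>
  define q where "q \<xi> = M * \<bar>indicator {0..} \<xi> * W \<xi>\<bar> + l * M * \<bar>indicator {0..} \<xi> * W' \<xi>\<bar>" for \<xi>
  define H where "H s \<zeta> = indicator {0..t} s * Q s (\<zeta> - l * s)" for s \<zeta>
  have W_cont: "continuous_on {0..} W"
    using W by (auto simp: continuous_on_eq_continuous_within intro: DERIV_continuous)
  have [measurable]: "(\<lambda>\<xi>. indicator {0..} \<xi> * W \<xi>) \<in> borel_measurable borel"
    "(\<lambda>\<xi>. indicator {0..} \<xi> * W' \<xi>) \<in> borel_measurable borel"
    using borel_measurable_continuous_on_indicator[OF _ W_cont] 
      borel_measurable_continuous_on_indicator[OF _ W'_cont] by auto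
  have [measurable]: "(\<lambda>p. A (fst p) (snd p)) \<in> borel_measurable (borel \<Otimes>\<^sub>M borel)"
     "(\<lambda>p. D (fst p) (snd p)) \<in> borel_measurable (borel \<Otimes>\<^sub>M borel)"
    using A_cont D_cont by (auto simp: borel_prod intro: borel_measurable_continuous_onI)
  have A_meas: "(\<lambda>x. A (f x) (h x)) \<in> borel_measurable N" "(\<lambda>x. D (f x) (h x)) \<in> borel_measurable N"
    if [measurable]: "f \<in> borel_measurable N" "h \<in> borel_measurable N" for f h and N :: "'z measure"
  proof -
    have "(\<lambda>x. (\<lambda>p. A (fst p) (snd p)) (f x, h x)) \<in> borel_measurable N" by measurable
    then show "(\<lambda>x. A (f x) (h x)) \<in> borel_measurable N" by simp
    have "(\<lambda>x. (\<lambda>p. D (fst p) (snd p)) (f x, h x)) \<in> borel_measurable N" by measurable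
    then show "(\<lambda>x. D (f x) (h x)) \<in> borel_measurable N" by simp
  qed
  note [measurable] = A_meas
  have Q_eq: "Q s \<xi> = (indicator {0..} \<xi> * W \<xi>) * D s \<xi> - l * (indicator {0..} \<xi> * W' \<xi>) * A s \<xi>" for s \<xi>
    by (simp add: Q_def algebra_simps)
  have Q_meas: "(\<lambda>x. Q (f x) (h x)) \<in> borel_measurable N"
    if [measurable]: "f \<in> borel_measurable N" "h \<in> borel_measurable N" for f h and N :: "'z measure"
    unfolding Q_eq
  proof -
    have [measurable]: "(\<lambda>x. indicator {0..} (h x) * W (h x)) \<in> borel_measurable N"
      "(\<lambda>x. indicator {0..} (h x) * W' (h x)) \<in> borel_measurable N"
      by (rule measurable_compose[OF that(2)], measurable)+
    show "(\<lambda>x. (indicator {0..} (h x) * W (h x)) * D (f x) (h x) - l * (indicator {0..} (h x) * W' (h x)) * A (f x) (h x)) \<in> borel_measurable N"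
      by measurable
  qed
  note [measurable] = Q_meas
  have q_int: "integrable lborel q"
    using W_int W'_int unfolding q_def set_integrable_def
    by (intro Bochner_Integration.integrable_add integrable_mult_right integrable_abs) auto
  have q_le: "\<bar>Q s \<xi>\<bar> \<le> q \<xi>" for s \<xi>
  proof -
    have "\<bar>Q s \<xi>\<bar> \<le> \<bar>indicator {0..} \<xi> * W \<xi>\<bar> * \<bar>D s \<xi>\<bar> + l * \<bar>indicator {0..} \<xi> * W' \<xi>\<bar> * \<bar>A s \<xi>\<bar>"
      unfolding Q_eq using l by (intro order.trans[OF abs_triangle_ineq4]) (simp add: abs_mult)
    also have "\<dots> \<le> \<bar>indicator {0..} \<xi> * W \<xi>\<bar> * M + l * \<bar>indicator {0..} \<xi> * W' \<xi>\<bar> * M"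
      using l A_le D_le by (intro add_mono mult_left_mono) auto
    finally show ?thesis by (simp add: q_def mult_ac)
  qed
  have Q_int: "integrable lborel (Q s)" for s
    by (rule Bochner_Integration.integrable_bound[OF q_int]) (auto intro!: order.trans[OF q_le abs_ge_self])
  have shift_int: "integrable lborel (\<lambda>\<zeta>. f (\<zeta> - a))" "(LINT \<zeta>|lborel. f (\<zeta> - a)) = (LINT \<xi>|lborel. f \<xi>)"
    if "integrable lborel f" for f :: "real \<Rightarrow> real" and a
    using lborel_integrable_real_affine_iff[of 1 f "-a"] lborel_integral_real_affine[of 1 f "-a"] that
    by (simp_all add: algebra_simps)
  have H_int: "integrable (lborel \<Otimes>\<^sub>M lborel) (case_prod H)"
  proof (rule lborel_pair.Fubini_integrable)
    show "case_prod H \<in> borel_measurable (lborel \<Otimes>\<^sub>M lborel)"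
      unfolding H_def by measurable
    have "integrable lborel (H s)" for s
      unfolding H_def by (intro integrable_mult_right shift_int Q_int)
    then show "AE s in lborel. integrable lborel (\<lambda>\<zeta>. case_prod H (s, \<zeta>))" by simp
    have "(LINT \<zeta>|lborel. norm (case_prod H (s, \<zeta>))) = indicator {0..t} s * (LINT \<xi>|lborel. \<bar>Q s \<xi>\<bar>)" for s
      unfolding H_def using shift_int(2)[of "\<lambda>\<xi>. \<bar>Q s \<xi>\<bar>"] Q_int by (simp add: abs_mult)
    moreover have "integrable lborel (\<lambda>s. indicator {0..t} s * (LINT \<xi>|lborel. \<bar>Q s \<xi>\<bar>))"
    proof (rule Bochner_Integration.integrable_bound)
      show "integrable lborel (\<lambda>s. indicator {0..t} s * (LINT \<xi>|lborel. q \<xi>))"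
        using t by (intro integrable_mult_left integrable_real_indicator) auto
      show "(\<lambda>s. indicator {0..t} s * (LINT \<xi>|lborel. \<bar>Q s \<xi>\<bar>)) \<in> borel_measurable lborel"
        by measurable
      have "\<bar>LINT \<xi>|lborel. \<bar>Q s \<xi>\<bar>\<bar> \<le> \<bar>LINT \<xi>|lborel. q \<xi>\<bar>" for s
      proof -
        have "(LINT \<xi>|lborel. \<bar>Q s \<xi>\<bar>) \<le> (LINT \<xi>|lborel. q \<xi>)"
          by (intro integral_mono q_int integrable_abs Q_int q_le)
        then show ?thesis by (simp add: abs_le_iff integral_nonneg)
      qed
      then show "AE s in lborel. norm (indicator {0..t} s * (LINT \<xi>|lborel. \<bar>Q s \<xi>\<bar>))
          \<le> norm (indicator {0..t} s * (LINT \<xi>|lborel. q \<xi>))"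
        by (auto simp: abs_mult intro!: mult_left_mono)
    qed
    ultimately show "integrable lborel (\<lambda>s. LINT \<zeta>|lborel. norm (case_prod H (s, \<zeta>)))" by simp
  qed
  have Hs: "(LINT \<zeta>|lborel. H s \<zeta>) = indicator {0..t} s *\<^sub>R ?R s" for s
    unfolding H_def using shift_int(2)[OF Q_int]
    by (simp add: set_lebesgue_integral_def Q_def)
  have "integrable lborel (\<lambda>s. LINT \<zeta>|lborel. H s \<zeta>)"
    using lborel_pair.integrable_fst'[OF H_int] by simp
  then show R_int: "set_integrable lborel {0..t} (\<lambda>s. ?R s)"
    unfolding set_integrable_def Hs .
  \<comment> \<open>The characteristic from \<open>\<zeta>\<close> reaches \<open>\<xi> = 0\<close> at time \<open>\<zeta> / l\<close>.\<close>
  define \<tau> where "\<tau> \<zeta> = min t (\<zeta> / l)" for \<zeta>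
  have H\<zeta>: "(LINT s|lborel. H s \<zeta>)
     = indicator {0..} \<zeta> * (W (\<zeta> - l * \<tau> \<zeta>) * A (\<tau> \<zeta>) (\<zeta> - l * \<tau> \<zeta>)) - indicator {0..} \<zeta> * (W \<zeta> * A 0 \<zeta>)" for \<zeta>
  proof (cases "0 \<le> \<zeta>")
    case False
    have "H s \<zeta> = 0" for s
      using False l by (auto simp: H_def Q_def indicator_def not_le) (smt (verit) mult_nonneg_nonneg)
    then show ?thesis using False by simp
  next
    case True
    let ?Q = "\<lambda>s. W (\<zeta> - l * s) * D s (\<zeta> - l * s) - l * W' (\<zeta> - l * s) * A s (\<zeta> - l * s)"
    have \<tau>: "0 \<le> \<tau> \<zeta>" using True l t by (simp add: \<tau>_def)
    have in\<tau>: "\<zeta> - l * s \<ge> 0" if "s \<in> {0..\<tau> \<zeta>}" for s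
      using that l by (auto simp: \<tau>_def field_simps)
    have "H s \<zeta> = indicator {0..\<tau> \<zeta>} s *\<^sub>R ?Q s" for s
      using l by (auto simp: H_def Q_def indicator_def \<tau>_def field_simps)
    moreover have "(LINT s|lborel. indicator {0..\<tau> \<zeta>} s *\<^sub>R ?Q s)
       = W (\<zeta> - l * \<tau> \<zeta>) * A (\<tau> \<zeta>) (\<zeta> - l * \<tau> \<zeta>) - W (\<zeta> - l * 0) * A 0 (\<zeta> - l * 0)"
    proof (rule integral_FTC_atLeastAtMost[OF \<tau>])
      fix s assume s: "0 \<le> s" "s \<le> \<tau> \<zeta>"
      have "((\<lambda>s. W (\<zeta> - l * s)) has_real_derivative W' (\<zeta> - l * s) * (- l)) (at s within {0..\<tau> \<zeta>})"
      proof (rule DERIV_image_chain[of W _ "\<lambda>s. \<zeta> - l * s", unfolded o_def])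
        show "(W has_real_derivative W' (\<zeta> - l * s)) (at (\<zeta> - l * s) within ((\<lambda>s. \<zeta> - l * s) ` {0..\<tau> \<zeta>}))"
          using in\<tau> s by (intro has_field_derivative_subset[OF W]) auto
      qed (auto intro!: derivative_eq_intros)
      moreover have "((\<lambda>s. A s (\<zeta> - l * s)) has_real_derivative D s (\<zeta> - l * s)) (at s within {0..\<tau> \<zeta>})"
        using s by (intro has_field_derivative_subset[OF AD]) auto
      ultimately have "((\<lambda>s. W (\<zeta> - l * s) * A s (\<zeta> - l * s)) has_real_derivative
          ?Q s) (at s within {0..\<tau> \<zeta>})"
        by (auto intro!: derivative_eq_intros)
      then show "((\<lambda>s. W (\<zeta> - l * s) * A s (\<zeta> - l * s)) has_vector_derivative
          ?Q s) (at s within {0..\<tau> \<zeta>})"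
        by (simp add: has_real_derivative_iff_has_vector_derivative)
    next
      have AD': "continuous_on {0..\<tau> \<zeta>} (\<lambda>s. A s (\<zeta> - l * s))" "continuous_on {0..\<tau> \<zeta>} (\<lambda>s. D s (\<zeta> - l * s))"
        by (rule continuous_on_compose2[OF A_cont, of _ "\<lambda>s. (s, \<zeta> - l * s)", simplified]
            continuous_on_compose2[OF D_cont, of _ "\<lambda>s. (s, \<zeta> - l * s)", simplified];
          intro continuous_intros)+
      have "continuous_on {0..\<tau> \<zeta>} (\<lambda>s. W (\<zeta> - l * s))" "continuous_on {0..\<tau> \<zeta>} (\<lambda>s. W' (\<zeta> - l * s))"
        using in\<tau> by (auto intro!: continuous_on_compose2[OF W_cont] continuous_on_compose2[OF W'_cont] continuous_intros)
      with AD' show "continuous_on {0..\<tau> \<zeta>} ?Q"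
        by (auto intro!: continuous_intros)
    qed
    ultimately show ?thesis using True by simp
  qed
  have WA_int: "set_integrable lborel {0..} (\<lambda>\<xi>. W \<xi> * A s \<xi>)" for s
    unfolding set_integrable_def
  proof (rule Bochner_Integration.integrable_bound)
    show "integrable lborel (\<lambda>\<xi>. M * (indicator {0..} \<xi> * W \<xi>))"
      using W_int unfolding set_integrable_def by auto
    have "(\<lambda>\<xi>. (indicator {0..} \<xi> * W \<xi>) * A s \<xi>) \<in> borel_measurable lborel" by measurable
    then show "(\<lambda>\<xi>. indicator {0..} \<xi> *\<^sub>R (W \<xi> * A s \<xi>)) \<in> borel_measurable lborel"
      by (simp add: mult.assoc)
    have "\<bar>A s \<xi>\<bar> * \<bar>W \<xi>\<bar> \<le> \<bar>M\<bar> * \<bar>W \<xi>\<bar>" for \<xi>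
      using A_le[of s \<xi>] by (intro mult_right_mono) auto
    then show "AE \<xi> in lborel. norm (indicator {0..} \<xi> *\<^sub>R (W \<xi> * A s \<xi>)) \<le> norm (M * (indicator {0..} \<xi> * W \<xi>))"
      by (auto simp: abs_mult indicator_def mult.commute)
  qed
  have bdry_int: "set_integrable lborel {0..t} (\<lambda>s. l * W 0 * A s 0)"
    using A_cont unfolding set_integrable_def
    by (intro borel_integrable_compact continuous_intros continuous_on_compose2[OF A_cont, of _ "\<lambda>s. (s, 0)", simplified]) auto
  \<comment> \<open>End points at time \<open>t\<close> inside the half-line, and end points on its boundary.\<close>
  define out where "out \<zeta> = indicator {0..} (\<zeta> - l * t) * (W (\<zeta> - l * t) * A t (\<zeta> - l * t))" for \<zeta>
  define bd where "bd \<zeta> = indicator {0..<l * t} \<zeta> * (W 0 * A (\<zeta> / l) 0)" for \<zeta>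
  have split: "indicator {0..} \<zeta> * (W (\<zeta> - l * \<tau> \<zeta>) * A (\<tau> \<zeta>) (\<zeta> - l * \<tau> \<zeta>)) = out \<zeta> + bd \<zeta>" for \<zeta>
  proof (cases "l * t \<le> \<zeta>")
    case True
    then have "t \<le> \<zeta> / l" using l by (simp add: field_simps)
    then have "\<tau> \<zeta> = t" by (simp add: \<tau>_def)
    moreover have "0 \<le> \<zeta>" using True l t by (meson mult_nonneg_nonneg order.trans less_imp_le)
    ultimately show ?thesis using True by (simp add: out_def bd_def)
  next
    case False
    then have "\<zeta> / l < t" using l by (simp add: field_simps)
    then have "\<tau> \<zeta> = \<zeta> / l" by (simp add: \<tau>_def)
    then show ?thesis using False l by (auto simp: out_def bd_def indicator_def)
  qed
  have out: "integrable lborel out" "(LINT \<zeta>|lborel. out \<zeta>) = (LINT \<xi>:{0..}|lborel. W \<xi> * A t \<xi>)"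
    unfolding out_def using shift_int[of "\<lambda>\<xi>. indicator {0..} \<xi> * (W \<xi> * A t \<xi>)" "l * t"] WA_int[of t]
    by (simp_all add: set_integrable_def set_lebesgue_integral_def)
  have bd_eq: "bd (0 + l * s) = indicator {0..<t} s * (W 0 * A s 0)" for s
    using l by (auto simp: bd_def indicator_def zero_le_mult_iff)
  have Ico: "integrable lborel (\<lambda>s. indicator {0..<t} s * (W 0 * A s 0))"
    and Ico_eq: "l * (LINT s|lborel. indicator {0..<t} s * (W 0 * A s 0)) = (LINT s:{0..t}|lborel. l * W 0 * A s 0)"
  proof -
    have cc: "set_integrable lborel {0..t} (\<lambda>s. W 0 * A s 0)"
      using A_cont unfolding set_integrable_def
      by (intro borel_integrable_compact continuous_intros continuous_on_compose2[OF A_cont, of _ "\<lambda>s. (s, 0)", simplified]) auto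
    have "set_integrable lborel {0..<t} (\<lambda>s. W 0 * A s 0)"
      by (rule set_integrable_subset[OF cc]) auto
    then show "integrable lborel (\<lambda>s. indicator {0..<t} s * (W 0 * A s 0))"
      by (simp add: set_integrable_def)
    have "(LINT s:{0..<t}|lborel. W 0 * A s 0) = (LINT s:{0..t}|lborel. W 0 * A s 0)"
      by (rule set_integral_discrete_difference[of "{t}"]) auto
    then have "l * (LINT s:{0..<t}|lborel. W 0 * A s 0) = (LINT s:{0..t}|lborel. l * (W 0 * A s 0))"
      by (simp only: set_integral_mult_right)
    then show "l * (LINT s|lborel. indicator {0..<t} s * (W 0 * A s 0)) = (LINT s:{0..t}|lborel. l * W 0 * A s 0)"
      by (simp only: set_lebesgue_integral_def mult.assoc real_scaleR_def)
  qed
  have bd: "integrable lborel bd" "(LINT \<zeta>|lborel. bd \<zeta>) = (LINT s:{0..t}|lborel. l * W 0 * A s 0)"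
    using lborel_integrable_real_affine_iff[of l bd 0] lborel_integral_real_affine[of l bd 0] l Ico Ico_eq
    unfolding bd_eq by simp_all
  have "(LINT \<zeta>|lborel. LINT s|lborel. H s \<zeta>) = (LINT s|lborel. LINT \<zeta>|lborel. H s \<zeta>)"
    using lborel_pair.Fubini_integral[of H] H_int by simp
  also have "\<dots> = (LINT s:{0..t}|lborel. ?R s)"
    unfolding Hs set_lebesgue_integral_def ..
  also have "(LINT \<zeta>|lborel. LINT s|lborel. H s \<zeta>) =
      (LINT \<xi>:{0..}|lborel. W \<xi> * A t \<xi>) + (LINT s:{0..t}|lborel. l * W 0 * A s 0) - (LINT \<xi>:{0..}|lborel. W \<xi> * A 0 \<xi>)"
    unfolding H\<zeta> split using out bd WA_int[of 0]
    by (simp add: set_integrable_def set_lebesgue_integral_def)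
  finally have "(LINT \<xi>:{0..}|lborel. W \<xi> * A t \<xi>) = (LINT \<xi>:{0..}|lborel. W \<xi> * A 0 \<xi>)
     + ((LINT s:{0..t}|lborel. ?R s) - (LINT s:{0..t}|lborel. l * W 0 * A s 0))"
    by simp
  then show "(LINT \<xi>:{0..}|lborel. W \<xi> * A t \<xi>) = (LINT \<xi>:{0..}|lborel. W \<xi> * A 0 \<xi>)
      + (LINT s:{0..t}|lborel. ?R s - l * W 0 * A s 0)"
    by (subst set_integral_diff(2)[OF R_int bdry_int]) simp
qed

section \<open>Damped energy of the mode system\<close>

text \<open>
  The index \<open>k\<close> stands for the mode \<open>l = k + 1\<close> here and below. The exponent \<open>2\<close> makes the damping integrable in
  \<open>\<xi>\<close>, with integral tending to \<open>0\<close> as \<open>k\<close> grows, so that the energy may be truncated in \<open>k\<close>.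
\<close>
definition damping :: "real \<Rightarrow> nat \<Rightarrow> real \<Rightarrow> real" where
  "damping \<epsilon> k \<xi> = 1 / (1 + \<epsilon> * (real (Suc k) + \<xi>))\<^sup>2"

lemma damping_base_ge_1: "0 < \<epsilon> \<Longrightarrow> 0 \<le> \<xi> \<Longrightarrow> 1 \<le> 1 + \<epsilon> * (real (Suc k) + \<xi>)"
  by (simp add: add_nonneg_nonneg)

lemma damping_base_pos: "0 < \<epsilon> \<Longrightarrow> 0 \<le> \<xi> \<Longrightarrow> 0 < 1 + \<epsilon> * (1 + real k + \<xi>)"
  by (simp add: add_pos_nonneg)

lemma damping_pos: "0 < \<epsilon> \<Longrightarrow> 0 \<le> \<xi> \<Longrightarrow> 0 < damping \<epsilon> k \<xi>"
  using damping_base_pos[of \<epsilon> \<xi> k] by (simp add: damping_def)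

lemma damping_antimono:
  assumes "0 < \<epsilon>" "0 \<le> \<xi>" "\<xi> \<le> \<xi>'"
  shows "damping \<epsilon> k \<xi>' \<le> damping \<epsilon> k \<xi>"
  unfolding damping_def
  using damping_base_pos[of \<epsilon> \<xi> k] damping_base_pos[of \<epsilon> \<xi>' k] assms
  by (intro divide_left_mono power_mono add_left_mono mult_left_mono mult_pos_pos zero_less_power) auto

lemma damping_deriv:
  assumes "0 < \<epsilon>" "0 \<le> \<xi>"
  shows "(damping \<epsilon> k has_real_derivative - (2 * \<epsilon> / (1 + \<epsilon> * (real (Suc k) + \<xi>)) * damping \<epsilon> k \<xi>)) (at \<xi>)"
proof -
  define y where "y = 1 + \<epsilon> * (real (Suc k) + \<xi>)"
  have y: "y \<noteq> 0" using damping_base_ge_1[OF assms, of k] by (auto simp: y_def)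
  have "((\<lambda>\<xi>. 1 / (1 + \<epsilon> * (real (Suc k) + \<xi>))\<^sup>2) has_real_derivative
      (0 * y\<^sup>2 - 1 * (2 * y * \<epsilon>)) / (y\<^sup>2 * y\<^sup>2)) (at \<xi>)"
    unfolding y_def by (intro derivative_eq_intros refl) (use y in \<open>auto simp: y_def\<close>)
  also have "(0 * y\<^sup>2 - 1 * (2 * y * \<epsilon>)) / (y\<^sup>2 * y\<^sup>2) = - (2 * \<epsilon> / y * (1 / y\<^sup>2))"
    using y by (simp add: field_simps power2_eq_square)
  finally show ?thesis unfolding damping_def[abs_def] y_def .
qed

text \<open>
  The damping in the form \<open>1 / y\<^sup>2\<close> drops by a fraction \<open>2 e / y\<close> of its geometric mean \<open>1 / (y (y + e))\<close>; the geometric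
  mean matches the product of two neighbouring modes in the flux.
\<close>
lemma inverse_square_drop:
  fixes y e :: real
  assumes y: "0 < y" and e: "0 < e"
  shows "1 / y\<^sup>2 - 1 / (y + e)\<^sup>2 \<le> 2 * e / y * (1 / (y * (y + e)))"
proof -
  have "1 / y\<^sup>2 - 1 / (y + e)\<^sup>2 = (1 / y - 1 / (y + e)) * (1 / y + 1 / (y + e))"
    by (simp add: power2_eq_square algebra_simps)
  also have "1 / y - 1 / (y + e) = e / (y * (y + e))" using assms by (simp add: field_simps)
  also have "e / (y * (y + e)) * (1 / y + 1 / (y + e)) \<le> e / (y * (y + e)) * (2 / y)"
  proof (rule mult_left_mono)
    have "1 / (y + e) \<le> 1 / y" using assms by (intro divide_left_mono) auto
    then show "1 / y + 1 / (y + e) \<le> 2 / y" by simp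
  qed (use assms in auto)
  finally show ?thesis by (simp add: mult_ac)
qed

lemma damping_cont: "0 < \<epsilon> \<Longrightarrow> continuous_on {0..} (damping \<epsilon> k)"
  by (intro continuous_at_imp_continuous_on ballI DERIV_isCont[OF damping_deriv]) auto

lemma damping_le_1: "0 < \<epsilon> \<Longrightarrow> 0 \<le> \<xi> \<Longrightarrow> \<bar>damping \<epsilon> k \<xi>\<bar> \<le> 1"
proof -
  assume "0 < \<epsilon>" "0 \<le> \<xi>"
  from damping_base_ge_1[OF this, of k] show ?thesis
    unfolding damping_def by (simp add: divide_le_eq_1 one_le_power)
qed

lemma damping_integral:
  assumes \<epsilon>: "0 < \<epsilon>"
  shows "set_integrable lborel {0..} (damping \<epsilon> k)"
    and "(LINT \<xi>:{0..}|lborel. damping \<epsilon> k \<xi>) = 1 / (\<epsilon> * (1 + \<epsilon> * real (Suc k)))"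
proof -
  let ?F = "\<lambda>\<xi>. - (1 / \<epsilon>) * inverse (1 + \<epsilon> * (real (Suc k) + \<xi>))"
  have "(\<integral>\<^sup>+\<xi>. ennreal (damping \<epsilon> k \<xi>) * indicator {0..} \<xi> \<partial>lborel) = ennreal (0 - ?F 0)"
  proof (rule nn_integral_FTC_atLeast)
    show "damping \<epsilon> k \<in> borel_measurable borel" unfolding damping_def[abs_def] by measurable
    show "(?F has_real_derivative damping \<epsilon> k \<xi>) (at \<xi>)" if "0 \<le> \<xi>" for \<xi>
    proof -
      have "1 + \<epsilon> * (real (Suc k) + \<xi>) \<noteq> 0" using damping_base_ge_1[OF \<epsilon> that, of k] by linarith
      then show ?thesis
        unfolding damping_def using \<epsilon>
        by (intro derivative_eq_intros refl) (auto simp: power2_eq_square inverse_eq_divide)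
    qed
    show "0 \<le> damping \<epsilon> k \<xi>" for \<xi> by (simp add: damping_def)
    have "filterlim (\<lambda>\<xi>. 1 + \<epsilon> * (real (Suc k) + \<xi>)) at_top at_top"
      using \<epsilon> by (intro filterlim_tendsto_pos_mult_at_top[OF tendsto_const] filterlim_tendsto_add_at_top[OF tendsto_const] filterlim_ident) auto
    then show "(?F \<longlongrightarrow> 0) at_top"
      by (intro tendsto_mult_right_zero tendsto_inverse_0_at_top)
  qed
  moreover have "ennreal (damping \<epsilon> k \<xi>) * indicator {0..} \<xi> = ennreal (indicator {0..} \<xi> * damping \<epsilon> k \<xi>)" for \<xi>
    by (simp add: indicator_def)
  ultimately have nn: "(\<integral>\<^sup>+\<xi>. ennreal (indicator {0..} \<xi> * damping \<epsilon> k \<xi>) \<partial>lborel) = ennreal (1 / (\<epsilon> * (1 + \<epsilon> * real (Suc k))))"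
    by (simp add: inverse_eq_divide)
  have meas: "(\<lambda>\<xi>. indicator {0..} \<xi> * damping \<epsilon> k \<xi>) \<in> borel_measurable lborel"
    unfolding damping_def[abs_def] by measurable
  have nonneg: "AE \<xi> in lborel. 0 \<le> indicator {0..} \<xi> * damping \<epsilon> k \<xi>" by (simp add: damping_def)
  show "set_integrable lborel {0..} (damping \<epsilon> k)"
    unfolding set_integrable_def real_scaleR_def
    by (rule integrableI_nonneg[OF meas nonneg]) (use nn in \<open>simp add: ennreal_less_top\<close>)
  show "(LINT \<xi>:{0..}|lborel. damping \<epsilon> k \<xi>) = 1 / (\<epsilon> * (1 + \<epsilon> * real (Suc k)))"
    unfolding set_lebesgue_integral_def real_scaleR_def
    by (subst integral_eq_nn_integral[OF meas nonneg], subst nn, rule enn2real_ennreal) (use \<epsilon> in simp)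
qed

text \<open>
  The exchange between modes has the form \<open>P\<^sub>k - P\<^sub>k\<^sub>+\<^sub>1\<close>. Weights that vary slowly in \<open>k\<close> thus leave the flux at
  \<open>k = 0\<close>, a small error, and a truncation term.
\<close>
lemma sum_by_parts_flux:
  fixes w P :: "nat \<Rightarrow> real"
  shows "(\<Sum>k<N. w k * (P k - P (Suc k))) = w 0 * P 0 - (\<Sum>k<N. (w k - w (Suc k)) * P (Suc k)) - w N * P N"
  by (induction N) (auto simp: algebra_simps)

text \<open>
  The relative error \<open>\<epsilon> / (1 + \<epsilon> (l + \<xi>))\<close> caused by the damping is at most \<open>tail_factor \<epsilon> k / l\<close>. Bounded by \<open>1\<close> it
  gives an estimate uniform in \<open>\<epsilon>\<close>; for fixed \<open>k\<close> it tends to \<open>0\<close> with \<open>\<epsilon>\<close>.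
\<close>
definition tail_factor :: "real \<Rightarrow> nat \<Rightarrow> real" where
  "tail_factor \<epsilon> k = min 1 (\<epsilon> * real (Suc k))"

text \<open>
  The rate of change of the damped energy density at one time and one \<open>\<xi>\<close>, for \<open>N\<close> modes: \<open>v\<^sub>k\<close> is the modulus of
  the mode \<open>k + 1\<close>, \<open>P\<^sub>k\<close> the flux into it, \<open>p\<close> the value of the weight, \<open>x\<close> the modulus of the order parameter.
  The main term is the flux out of the mode \<open>0\<close>, which \<open>absorb\<close> balances against the derivative of the weight at
  the first mode. The terms \<open>3 K + 2\<close> collect the variation of the damping in \<open>k\<close> (factor \<open>3 K\<close>) and in \<open>\<xi>\<close>
  (factor \<open>2\<close>), and the last term comes from the truncation.
\<close>
lemma mode_sum_estimate:
  fixes v P :: "nat \<Rightarrow> real" and K \<epsilon> \<xi> p p' x h :: real and N :: nat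
  assumes K: "0 \<le> K" and \<epsilon>: "0 < \<epsilon>" "\<epsilon> \<le> 1" and \<xi>: "0 \<le> \<xi>" and p: "0 \<le> p" and p': "0 \<le> p'" and h: "0 \<le> h"
    and N: "0 < N"
    and v: "\<And>k. 0 \<le> v k" "\<And>k. v k \<le> 1"
    and P: "\<And>k. \<bar>P (Suc k)\<bar> \<le> v k * v (Suc k)" and P_le: "\<And>k. \<bar>P k\<bar> \<le> 1"
    and absorb: "K * p * P 0 \<le> p' * (v 0)\<^sup>2 + x\<^sup>2 * h"
  defines "m \<equiv> \<lambda>k. damping \<epsilon> k \<xi>"
  defines "m' \<equiv> \<lambda>k. - (2 * \<epsilon> / (1 + \<epsilon> * (real (Suc k) + \<xi>)) * damping \<epsilon> k \<xi>)"
  shows "(\<Sum>k<N. K * (p * m k * (P k - P (Suc k))) - (p' * m k + p * m' k) * (v k)\<^sup>2)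
     \<le> damping \<epsilon> 0 0 * x\<^sup>2 * h + (3 * K + 2) * (\<Sum>k<N. tail_factor \<epsilon> k / real (Suc k) * (p * m k * (v k)\<^sup>2)) + 3 * K * (p * m N)"
proof -
  define y where "y k = 1 + \<epsilon> * (real (Suc k) + \<xi>)" for k
  have y1: "1 \<le> y k" for k unfolding y_def by (rule damping_base_ge_1[OF \<epsilon>(1) \<xi>])
  have y0: "0 < y k" for k using y1[of k] by linarith
  have ySuc: "y (Suc k) = y k + \<epsilon>" for k by (simp add: y_def algebra_simps)
  have m: "m k = 1 / (y k)\<^sup>2" for k by (simp add: m_def damping_def y_def)
  have m0: "0 \<le> m k" for k by (simp add: m)
  define R where "R k = \<epsilon> / y k * (m k * (v k)\<^sup>2)" for k
  have R0: "0 \<le> R k" for k using y0[of k] \<epsilon> m0[of k] by (simp add: R_def)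
  have \<epsilon>y: "\<epsilon> / y k \<le> tail_factor \<epsilon> k / real (Suc k)" for k
  proof -
    have a: "\<epsilon> / y k \<le> \<epsilon>" using y1[of k] \<epsilon> by (simp add: field_simps)
    have "\<epsilon> * real (Suc k) \<le> y k" using \<epsilon> \<xi> by (simp add: y_def algebra_simps)
    then have b: "\<epsilon> / y k \<le> 1 / real (Suc k)" using y0[of k] by (simp add: field_simps)
    have "\<epsilon> = \<epsilon> * real (Suc k) / real (Suc k)" by simp
    then show ?thesis using a b unfolding tail_factor_def min_def by metis
  qed
  \<comment> \<open>The factor \<open>2\<close> pays for replacing \<open>y k\<close> by \<open>y (Suc k)\<close>, as \<open>y (Suc k) \<le> 2 * y k\<close> for \<open>\<epsilon> \<le> 1\<close>.\<close>
  have drop: "\<bar>(m k - m (Suc k)) * P (Suc k)\<bar> \<le> R k + 2 * R (Suc k)" for k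
  proof -
    have d1: "m k - m (Suc k) \<le> 2 * \<epsilon> / y k * (1 / (y k * y (Suc k)))"
      unfolding m ySuc by (rule inverse_square_drop[OF y0 \<epsilon>(1)])
    have d0: "0 \<le> m k - m (Suc k)"
      unfolding m using y0[of k] \<epsilon> by (auto simp: ySuc intro!: divide_left_mono power_mono mult_pos_pos)
    have "\<bar>(m k - m (Suc k)) * P (Suc k)\<bar> \<le> (2 * \<epsilon> / y k * (1 / (y k * y (Suc k)))) * (v k * v (Suc k))"
      unfolding abs_mult using d0 d1 P[of k] by (intro mult_mono) auto
    also have "\<dots> = \<epsilon> / y k * (2 * (v k / y k) * (v (Suc k) / y (Suc k)))" by simp
    also have "\<dots> \<le> \<epsilon> / y k * ((v k / y k)\<^sup>2 + (v (Suc k) / y (Suc k))\<^sup>2)"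
      using y0[of k] \<epsilon> by (intro mult_left_mono sum_squares_bound) auto
    also have "\<dots> = R k + \<epsilon> / y k * (m (Suc k) * (v (Suc k))\<^sup>2)"
      by (simp add: R_def m power_divide distrib_left)
    also have "\<epsilon> / y k \<le> 2 * (\<epsilon> / y (Suc k))"
      using y0[of k] y1[of k] \<epsilon> unfolding ySuc by (simp add: field_simps)
    then have "R k + \<epsilon> / y k * (m (Suc k) * (v (Suc k))\<^sup>2) \<le> R k + 2 * (\<epsilon> / y (Suc k)) * (m (Suc k) * (v (Suc k))\<^sup>2)"
      using m0 by (intro add_left_mono mult_right_mono) auto
    finally show ?thesis by (simp add: R_def mult.assoc)
  qed
  have RN: "R N \<le> m N"
  proof -
    have "\<epsilon> / y N \<le> 1" using y1[of N] \<epsilon> by (simp add: field_simps)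
    moreover have "(v N)\<^sup>2 \<le> 1" using v[of N] by (simp add: power_le_one)
    ultimately have "R N \<le> 1 * (m N * 1)" unfolding R_def
      using m0[of N] y0[of N] \<epsilon> by (intro mult_mono) auto
    then show ?thesis by simp
  qed
  have sumR_Suc: "(\<Sum>k<N. R (Suc k)) \<le> (\<Sum>k<N. R k) + R N"
    using R0[of 0] sum.lessThan_Suc_shift[of R N] by simp
  have "(\<Sum>k<N. m k * (P k - P (Suc k))) = m 0 * P 0 - (\<Sum>k<N. (m k - m (Suc k)) * P (Suc k)) - m N * P N"
    by (rule sum_by_parts_flux)
  also have "\<dots> \<le> m 0 * P 0 + (\<Sum>k<N. R k + 2 * R (Suc k)) + m N"
  proof -
    have "- (\<Sum>k<N. (m k - m (Suc k)) * P (Suc k)) \<le> (\<Sum>k<N. R k + 2 * R (Suc k))"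
      unfolding sum_negf[symmetric] by (intro sum_mono) (use drop in \<open>force simp: abs_le_iff\<close>)
    moreover have "- (m N * P N) \<le> m N"
    proof -
      have "m N * (- P N) \<le> m N * 1" using P_le[of N] m0[of N] by (intro mult_left_mono) auto
      then show ?thesis by simp
    qed
    ultimately show ?thesis by linarith
  qed
  also have "\<dots> \<le> m 0 * P 0 + 3 * (\<Sum>k<N. R k) + 3 * m N"
    using sumR_Suc RN by (simp add: sum.distrib sum_distrib_left[symmetric])
  finally have flux: "(\<Sum>k<N. m k * (P k - P (Suc k))) \<le> m 0 * P 0 + 3 * (\<Sum>k<N. R k) + 3 * m N" .
  have first: "m 0 * (v 0)\<^sup>2 \<le> (\<Sum>k<N. m k * (v k)\<^sup>2)"
    using N m0 by (intro member_le_sum[of 0 "{..<N}" "\<lambda>k. m k * (v k)\<^sup>2"]) auto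
  have "(\<Sum>k<N. K * (p * m k * (P k - P (Suc k))) - (p' * m k + p * m' k) * (v k)\<^sup>2)
      = K * p * (\<Sum>k<N. m k * (P k - P (Suc k))) - p' * (\<Sum>k<N. m k * (v k)\<^sup>2) + 2 * p * (\<Sum>k<N. R k)"
    by (simp add: sum_distrib_left sum_subtractf[symmetric] sum.distrib[symmetric] m'_def m_def R_def y_def algebra_simps)
  also have "\<dots> \<le> K * p * (m 0 * P 0 + 3 * (\<Sum>k<N. R k) + 3 * m N) - p' * (m 0 * (v 0)\<^sup>2) + 2 * p * (\<Sum>k<N. R k)"
    using flux first K p p' by (intro add_mono diff_mono mult_left_mono) auto
  also have "\<dots> = m 0 * (K * p * P 0 - p' * (v 0)\<^sup>2) + (3 * K + 2) * (p * (\<Sum>k<N. R k)) + 3 * K * (p * m N)"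
    by (simp add: algebra_simps)
  also have "\<dots> \<le> damping \<epsilon> 0 0 * x\<^sup>2 * h
     + (3 * K + 2) * (\<Sum>k<N. tail_factor \<epsilon> k / real (Suc k) * (p * m k * (v k)\<^sup>2)) + 3 * K * (p * m N)"
  proof (intro add_mono order.refl mult_left_mono)
    have "m 0 * (K * p * P 0 - p' * (v 0)\<^sup>2) \<le> m 0 * (x\<^sup>2 * h)"
      using absorb m0[of 0] by (intro mult_left_mono) auto
    also have "\<dots> \<le> damping \<epsilon> 0 0 * (x\<^sup>2 * h)"
      unfolding m_def using \<epsilon> \<xi> h by (intro mult_right_mono damping_antimono) auto
    finally show "m 0 * (K * p * P 0 - p' * (v 0)\<^sup>2) \<le> damping \<epsilon> 0 0 * x\<^sup>2 * h" by (simp add: mult.assoc)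
    have "p * R k \<le> tail_factor \<epsilon> k / real (Suc k) * (p * m k * (v k)\<^sup>2)" for k
    proof -
      have "p * R k = \<epsilon> / y k * (p * m k * (v k)\<^sup>2)" by (simp add: R_def)
      also have "\<dots> \<le> tail_factor \<epsilon> k / real (Suc k) * (p * m k * (v k)\<^sup>2)"
        using \<epsilon>y[of k] p m0[of k] by (intro mult_right_mono) auto
      finally show ?thesis .
    qed
    then show "p * (\<Sum>k<N. R k) \<le> (\<Sum>k<N. tail_factor \<epsilon> k / real (Suc k) * (p * m k * (v k)\<^sup>2))"
      unfolding sum_distrib_left by (intro sum_mono)
  qed (use K in auto)
  finally show ?thesis .
qed

text \<open>
  The Fourier side of the equation, in integrated form along characteristics. Time is extended to all reals, where
  only continuity and the bound are required, since functions that are continuous on the whole plane are simpler to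
  handle than functions on a half-plane.
\<close>
locale kuramoto_modes =
  fixes K :: real and u :: "real \<Rightarrow> nat \<Rightarrow> real \<Rightarrow> complex"
  assumes K_nonneg: "0 \<le> K"
    and norm_le: "norm (u t l \<xi>) \<le> 1"
    and u_cont: "continuous_on UNIV (\<lambda>p. u (fst p) l (snd p))"
    and mode_deriv: "0 \<le> t \<Longrightarrow>
      ((\<lambda>s. u s (Suc l) (\<zeta> - real (Suc l) * s)) has_vector_derivative
        of_real (K * real (Suc l) / 2) *
          (u t 1 0 * u t l (\<zeta> - real (Suc l) * t)
            - cnj (u t 1 0) * u t (Suc (Suc l)) (\<zeta> - real (Suc l) * t)))
      (at t within {0..})"
begin

definition flux :: "real \<Rightarrow> nat \<Rightarrow> real \<Rightarrow> real" where
  "flux t l \<xi> = Re (u t 1 0 * u t l \<xi> * cnj (u t (Suc l) \<xi>))"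

definition mode_sq :: "real \<Rightarrow> nat \<Rightarrow> real \<Rightarrow> real" where
  "mode_sq t k \<xi> = (norm (u t (Suc k) \<xi>))\<^sup>2"

lemma mode_sq_le: "\<bar>mode_sq t k \<xi>\<bar> \<le> 1"
  using norm_le by (simp add: mode_sq_def power_le_one)

lemma mode_sq_nonneg: "0 \<le> mode_sq t k \<xi>"
  by (simp add: mode_sq_def)

lemma flux_le: "\<bar>flux t l \<xi>\<bar> \<le> norm (u t 1 0) * (norm (u t l \<xi>) * norm (u t (Suc l) \<xi>))"
  unfolding flux_def using abs_Re_le_cmod[of "u t 1 0 * u t l \<xi> * cnj (u t (Suc l) \<xi>)"]
  by (simp add: norm_mult mult.assoc)

lemma flux_le': "\<bar>flux t l \<xi>\<bar> \<le> norm (u t l \<xi>) * norm (u t (Suc l) \<xi>)"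
proof -
  have "norm (u t 1 0) * (norm (u t l \<xi>) * norm (u t (Suc l) \<xi>)) \<le> 1 * (norm (u t l \<xi>) * norm (u t (Suc l) \<xi>))"
    by (intro mult_right_mono norm_le mult_nonneg_nonneg) auto
  then show ?thesis using flux_le[of t l \<xi>] by simp
qed

lemma flux_le_1: "\<bar>flux t l \<xi>\<bar> \<le> 1"
  using flux_le'[of t l \<xi>] norm_le[of t l \<xi>] norm_le[of t "Suc l" \<xi>]
  by (meson mult_le_one norm_ge_zero order.trans)

lemma u_cont_compose [continuous_intros]:
  assumes "continuous_on S f" "continuous_on S h"
  shows "continuous_on S (\<lambda>x. u (f x) l (h x))"
  using continuous_on_compose2[OF u_cont continuous_on_Pair[OF assms]] by simp

lemma mode_sq_cont: "continuous_on UNIV (\<lambda>p. mode_sq (fst p) k (snd p))"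
  unfolding mode_sq_def by (intro continuous_intros)

lemma flux_cont: "continuous_on UNIV (\<lambda>p. flux (fst p) l (snd p))"
  unfolding flux_def by (intro continuous_intros)

text \<open>
  Multiplying the equation of mode \<open>l\<close> by the conjugate of \<open>u\<^sub>l\<close> turns its two coupling terms into the incoming and
  the outgoing flux, since \<open>cnj \<eta> u\<^sub>l\<^sub>+\<^sub>1 cnj u\<^sub>l\<close> is the conjugate of \<open>\<eta> u\<^sub>l cnj u\<^sub>l\<^sub>+\<^sub>1\<close>.
\<close>
lemma mode_sq_deriv:
  assumes t: "0 \<le> t"
  shows "((\<lambda>s. mode_sq s k (\<zeta> - real (Suc k) * s)) has_real_derivative
    K * real (Suc k) * (flux t k (\<zeta> - real (Suc k) * t) - flux t (Suc k) (\<zeta> - real (Suc k) * t))) (at t within {0..})"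
proof -
  let ?z = "\<lambda>s. u s (Suc k) (\<zeta> - real (Suc k) * s)"
  let ?\<xi> = "\<zeta> - real (Suc k) * t"
  let ?d = "of_real (K * real (Suc k) / 2) * (u t 1 0 * u t k ?\<xi> - cnj (u t 1 0) * u t (Suc (Suc k)) ?\<xi>)"
  have d: "(?z has_vector_derivative ?d) (at t within {0..})" by (rule mode_deriv[OF t])
  have "((\<lambda>s. Re (?z s * cnj (?z s))) has_vector_derivative Re (?z t * cnj ?d + ?d * cnj (?z t))) (at t within {0..})"
    by (rule bounded_linear.has_vector_derivative[OF bounded_linear_Re])
      (intro has_vector_derivative_mult has_vector_derivative_cnj d)
  moreover have "Re (?z s * cnj (?z s)) = mode_sq s k (\<zeta> - real (Suc k) * s)" for s
    by (simp add: mode_sq_def complex_mult_cnj cmod_power2)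
  moreover have "Re (?z t * cnj ?d + ?d * cnj (?z t)) = K * real (Suc k) * (flux t k ?\<xi> - flux t (Suc k) ?\<xi>)"
    by (simp add: flux_def algebra_simps)
  ultimately show ?thesis by (simp add: has_real_derivative_iff_has_vector_derivative)
qed

end

text \<open>
  What the energy estimate asks of the weight \<open>\<phi>\<close>. The last assumption splits the flux out of the mode \<open>0\<close> into a
  part controlled by \<open>\<phi>' |u\<^sub>1|\<^sup>2\<close> and a part \<open>|\<eta>|\<^sup>2 h\<close>; as \<open>\<integral> h \<le> 1 - c\<close>, the latter leaves \<open>c |\<eta>|\<^sup>2\<close> of the loss
  \<open>|\<eta>|\<^sup>2\<close> at \<open>\<xi> = 0\<close>.
\<close>
locale weighted_modes = kuramoto_modes +
  fixes \<phi> \<phi>' h :: "real \<Rightarrow> real" and B c :: real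
  assumes \<phi>_deriv: "0 \<le> \<xi> \<Longrightarrow> (\<phi> has_real_derivative \<phi>' \<xi>) (at \<xi> within {0..})"
    and \<phi>'_cont: "continuous_on {0..} \<phi>'"
    and \<phi>'_int: "set_integrable lborel {0..} \<phi>'"
    and \<phi>'_nonneg: "0 \<le> \<xi> \<Longrightarrow> 0 \<le> \<phi>' \<xi>"
    and \<phi>_0: "\<phi> 0 = 1"
    and \<phi>_nonneg: "0 \<le> \<xi> \<Longrightarrow> 0 \<le> \<phi> \<xi>"
    and \<phi>_le: "0 \<le> \<xi> \<Longrightarrow> \<phi> \<xi> \<le> B"
    and c_nonneg: "0 \<le> c"
    and h_nonneg: "0 \<le> \<xi> \<Longrightarrow> 0 \<le> h \<xi>"
    and h_int: "set_integrable lborel {0..} h"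
    and h_le: "(LINT \<xi>:{0..}|lborel. h \<xi>) \<le> 1 - c"
    and absorb: "0 \<le> t \<Longrightarrow> 0 \<le> \<xi> \<Longrightarrow> 0 \<le> y \<Longrightarrow>
      K * \<phi> \<xi> * (norm (u t 1 0) * (norm (u t 0 \<xi>) * y)) \<le> \<phi>' \<xi> * y\<^sup>2 + (norm (u t 1 0))\<^sup>2 * h \<xi>"
begin

definition damped_energy :: "real \<Rightarrow> nat \<Rightarrow> real \<Rightarrow> real" where
  "damped_energy \<epsilon> k t = 1 / real (Suc k) * (LINT \<xi>:{0..}|lborel. \<phi> \<xi> * damping \<epsilon> k \<xi> * mode_sq t k \<xi>)"

lemma \<phi>_cont: "continuous_on {0..} \<phi>"
  using \<phi>_deriv by (auto simp: continuous_on_eq_continuous_within intro: DERIV_continuous)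

lemma weight_int: "0 < \<epsilon> \<Longrightarrow> set_integrable lborel {0..} (\<lambda>\<xi>. \<phi> \<xi> * damping \<epsilon> k \<xi>)"
  by (rule set_integrable_mult_bounded[OF damping_integral(1) \<phi>_cont, of _ B])
    (use \<phi>_nonneg \<phi>_le in \<open>auto simp: abs_of_nonneg\<close>)

lemma damped_energy_int: "0 < \<epsilon> \<Longrightarrow> set_integrable lborel {0..} (\<lambda>\<xi>. \<phi> \<xi> * damping \<epsilon> k \<xi> * mode_sq t k \<xi>)"
  by (rule slice_integrals(1)[OF weight_int mode_sq_cont mode_sq_le])

lemma damped_energy_time_int: "0 < \<epsilon> \<Longrightarrow> set_integrable lborel {a..b} (damped_energy \<epsilon> k)"
  unfolding damped_energy_def[abs_def]
  by (intro set_integrable_mult_right slice_integrals(3)[OF weight_int mode_sq_cont mode_sq_le])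

lemma damped_energy_nonneg: "0 < \<epsilon> \<Longrightarrow> 0 \<le> damped_energy \<epsilon> k t"
  unfolding damped_energy_def set_lebesgue_integral_def
  by (intro mult_nonneg_nonneg Bochner_Integration.integral_nonneg)
    (auto simp: indicator_def mode_sq_def intro!: mult_nonneg_nonneg \<phi>_nonneg less_imp_le[OF damping_pos])

lemma sum_damped_energy_bounded:
  assumes \<epsilon>: "0 < \<epsilon>"
  obtains M where "\<And>t. (\<Sum>k<N. damped_energy \<epsilon> k t) \<le> M"
proof
  fix t
  show "(\<Sum>k<N. damped_energy \<epsilon> k t) \<le> (\<Sum>k<N. 1 / real (Suc k) * (1 * (LINT \<xi>:{0..}|lborel. \<bar>\<phi> \<xi> * damping \<epsilon> k \<xi>\<bar>)))"
    unfolding damped_energy_def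
    by (intro sum_mono mult_left_mono order.trans[OF abs_ge_self slice_integrals(2)[OF weight_int[OF \<epsilon>] mode_sq_cont mode_sq_le]]) auto
qed

definition weight_mass :: "real \<Rightarrow> nat \<Rightarrow> real" where
  "weight_mass \<epsilon> k = (LINT \<xi>:{0..}|lborel. \<phi> \<xi> * damping \<epsilon> k \<xi>)"

lemma weight_mass_nonneg: "0 < \<epsilon> \<Longrightarrow> 0 \<le> weight_mass \<epsilon> k"
  unfolding weight_mass_def set_lebesgue_integral_def
  by (intro Bochner_Integration.integral_nonneg)
    (auto simp: indicator_def intro!: mult_nonneg_nonneg \<phi>_nonneg less_imp_le[OF damping_pos])

lemma weight_mass_tendsto_0:
  assumes \<epsilon>: "0 < \<epsilon>"
  shows "(\<lambda>N. weight_mass \<epsilon> N) \<longlonglongrightarrow> 0"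
proof (rule tendsto_sandwich[OF _ _ tendsto_const])
  show "\<forall>\<^sub>F N in sequentially. 0 \<le> weight_mass \<epsilon> N" using weight_mass_nonneg[OF \<epsilon>] by simp
  have "weight_mass \<epsilon> N \<le> B * (1 / (\<epsilon> * (1 + \<epsilon> * real (Suc N))))" for N
  proof -
    have "weight_mass \<epsilon> N \<le> (LINT \<xi>:{0..}|lborel. B * damping \<epsilon> N \<xi>)"
      unfolding weight_mass_def
      by (intro set_integral_mono weight_int[OF \<epsilon>] set_integrable_mult_right damping_integral(1)[OF \<epsilon>] mult_right_mono \<phi>_le)
        (auto intro: less_imp_le[OF damping_pos[OF \<epsilon>]])
    then show ?thesis by (simp add: damping_integral(2)[OF \<epsilon>])
  qed
  then show "\<forall>\<^sub>F N in sequentially. weight_mass \<epsilon> N \<le> B * (1 / (\<epsilon> * (1 + \<epsilon> * real (Suc N))))" by simp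
  have "filterlim (\<lambda>N. \<epsilon> * (1 + \<epsilon> * real (Suc N))) at_top sequentially"
    using \<epsilon> by (intro filterlim_tendsto_pos_mult_at_top[OF tendsto_const] filterlim_tendsto_add_at_top[OF tendsto_const]
        filterlim_compose[OF filterlim_real_sequentially] filterlim_Suc) auto
  then have "(\<lambda>N. 1 / (\<epsilon> * (1 + \<epsilon> * real (Suc N)))) \<longlonglongrightarrow> 0"
    by (intro tendsto_divide_0[OF tendsto_const] filterlim_at_top_imp_at_infinity)
  then show "(\<lambda>N. B * (1 / (\<epsilon> * (1 + \<epsilon> * real (Suc N))))) \<longlonglongrightarrow> 0"
    by (rule tendsto_mult_right_zero)
qed

definition order_dissipation :: "real \<Rightarrow> real" where
  "order_dissipation t = (LINT s:{0..t}|lborel. (norm (u s 1 0))\<^sup>2)"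

lemma order_sq_int: "set_integrable lborel {a..b} (\<lambda>s. (norm (u s 1 0))\<^sup>2)"
  unfolding set_integrable_def
  by (intro borel_integrable_compact continuous_intros) auto

text \<open>
  The energy inequality for damped weights and finitely many modes, where every integral is finite. Both errors are
  explicit: the cost of the damping is controlled by the energy itself, and the truncation error vanishes as
  \<open>N \<rightarrow> \<infinity>\<close> for fixed \<open>\<epsilon>\<close>.
\<close>
lemma damped_energy_inequality:
  assumes \<epsilon>: "0 < \<epsilon>" "\<epsilon> \<le> 1" and t: "0 \<le> t" and N: "0 < N"
  shows "(\<Sum>k<N. damped_energy \<epsilon> k t) + c * damping \<epsilon> 0 0 * order_dissipation t
    \<le> (\<Sum>k<N. damped_energy \<epsilon> k 0)
      + (3 * K + 2) * (\<Sum>k<N. tail_factor \<epsilon> k * (LINT s:{0..t}|lborel. damped_energy \<epsilon> k s))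
      + 3 * K * t * weight_mass \<epsilon> N"
proof -
  define W where "W k \<xi> = \<phi> \<xi> * damping \<epsilon> k \<xi>" for k \<xi>
  define d' where "d' k \<xi> = - (2 * \<epsilon> / (1 + \<epsilon> * (real (Suc k) + \<xi>)) * damping \<epsilon> k \<xi>)" for k \<xi>
  define W' where "W' k \<xi> = \<phi>' \<xi> * damping \<epsilon> k \<xi> + \<phi> \<xi> * d' k \<xi>" for k \<xi>
  define D where "D k s \<xi> = K * real (Suc k) * (flux s k \<xi> - flux s (Suc k) \<xi>)" for k s \<xi>
  let ?T = "\<lambda>k s. LINT \<xi>:{0..}|lborel. W k \<xi> * D k s \<xi> - real (Suc k) * W' k \<xi> * mode_sq s k \<xi>"
  let ?r = "\<lambda>k s \<xi>. K * (\<phi> \<xi> * damping \<epsilon> k \<xi> * (flux s k \<xi> - flux s (Suc k) \<xi>))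
      - (\<phi>' \<xi> * damping \<epsilon> k \<xi> + \<phi> \<xi> * d' k \<xi>) * mode_sq s k \<xi>"
  let ?b = "\<lambda>s. - (c * damping \<epsilon> 0 0) * (norm (u s 1 0))\<^sup>2
      + (3 * K + 2) * (\<Sum>k<N. tail_factor \<epsilon> k * damped_energy \<epsilon> k s) + 3 * K * weight_mass \<epsilon> N"
  have W_deriv: "(W k has_real_derivative W' k \<xi>) (at \<xi> within {0..})" if "0 \<le> \<xi>" for k \<xi>
  proof -
    have "(damping \<epsilon> k has_real_derivative d' k \<xi>) (at \<xi> within {0..})"
      unfolding d'_def by (rule has_field_derivative_at_within[OF damping_deriv[OF \<epsilon>(1) that]])
    from DERIV_mult[OF \<phi>_deriv[OF that] this] show ?thesis
      by (simp add: W_def[abs_def] W'_def mult.commute)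
  qed
  have d'_cont: "continuous_on {0..} (d' k)" for k
    unfolding d'_def[abs_def]
    by (intro continuous_intros damping_cont[OF \<epsilon>(1)]) (use damping_base_pos[OF \<epsilon>(1), of _ k] in force)
  have W'_cont: "continuous_on {0..} (W' k)" for k
    unfolding W'_def[abs_def] by (intro continuous_intros \<phi>'_cont \<phi>_cont d'_cont damping_cont \<epsilon>)
  have W_int: "set_integrable lborel {0..} (W k)" for k
    unfolding W_def[abs_def] by (rule weight_int[OF \<epsilon>(1)])
  have W'_int: "set_integrable lborel {0..} (W' k)" for k
    unfolding W'_def[abs_def]
  proof (rule set_integral_add(1))
    have "set_integrable lborel {0..} (\<lambda>\<xi>. damping \<epsilon> k \<xi> * \<phi>' \<xi>)"
      by (rule set_integrable_mult_bounded[OF \<phi>'_int damping_cont[OF \<epsilon>(1)] damping_le_1[OF \<epsilon>(1)]])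
    then show "set_integrable lborel {0..} (\<lambda>\<xi>. \<phi>' \<xi> * damping \<epsilon> k \<xi>)" by (simp add: mult.commute)
    have "set_integrable lborel {0..} (\<lambda>\<xi>. (- (2 * \<epsilon> / (1 + \<epsilon> * (real (Suc k) + \<xi>)))) * (\<phi> \<xi> * damping \<epsilon> k \<xi>))"
    proof (rule set_integrable_mult_bounded[OF weight_int[OF \<epsilon>(1)], of _ "2 * \<epsilon>"])
      show "continuous_on {0..} (\<lambda>\<xi>. - (2 * \<epsilon> / (1 + \<epsilon> * (real (Suc k) + \<xi>))))"
        by (intro continuous_intros) (use damping_base_pos[OF \<epsilon>(1), of _ k] in force)
      fix \<xi> :: real assume "0 \<le> \<xi>"
      define y where "y = 1 + \<epsilon> * (real (Suc k) + \<xi>)"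
      have "1 \<le> y" unfolding y_def by (rule damping_base_ge_1[OF \<epsilon>(1) \<open>0 \<le> \<xi>\<close>])
      then have "\<bar>- (2 * \<epsilon> / y)\<bar> \<le> 2 * \<epsilon>"
        using \<epsilon> by (simp add: divide_le_eq mult_le_cancel_left1)
      then show "\<bar>- (2 * \<epsilon> / (1 + \<epsilon> * (real (Suc k) + \<xi>)))\<bar> \<le> 2 * \<epsilon>"
        unfolding y_def .
    qed
    then show "set_integrable lborel {0..} (\<lambda>\<xi>. \<phi> \<xi> * d' k \<xi>)"
      by (simp add: d'_def mult_ac)
  qed
  have D_cont: "continuous_on UNIV (\<lambda>p. D k (fst p) (snd p))" for k
    unfolding D_def by (intro continuous_intros flux_cont)
  have D_le: "\<bar>D k s \<xi>\<bar> \<le> K * real (Suc k) * 2" for k s \<xi>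
    unfolding D_def abs_mult using K_nonneg flux_le_1[of s k \<xi>] flux_le_1[of s "Suc k" \<xi>]
    by (intro mult_mono) auto
  have T: "set_integrable lborel {0..t} (\<lambda>s. ?T k s)"
     "(LINT \<xi>:{0..}|lborel. W k \<xi> * mode_sq t k \<xi>) = (LINT \<xi>:{0..}|lborel. W k \<xi> * mode_sq 0 k \<xi>)
      + (LINT s:{0..t}|lborel. ?T k s
          - real (Suc k) * W k 0 * mode_sq s k 0)" for k
  proof -
    have D: "((\<lambda>s. mode_sq s k (\<zeta> - real (Suc k) * s)) has_real_derivative D k s (\<zeta> - real (Suc k) * s)) (at s within {0..})"
      if "0 \<le> s" for \<zeta> s
      unfolding D_def by (rule mode_sq_deriv[OF that])
    have m: "\<bar>mode_sq s k \<xi>\<bar> \<le> max 1 (K * real (Suc k) * 2)" "\<bar>D k s \<xi>\<bar> \<le> max 1 (K * real (Suc k) * 2)" for s \<xi>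
      using mode_sq_le[of s k \<xi>] D_le[of k s \<xi>] by linarith+
    note tr = transport_identity[where l = "real (Suc k)" and t = t and W = "W k" and W' = "W' k"
        and A = "\<lambda>s \<xi>. mode_sq s k \<xi>" and D = "D k",
        OF _ t W_deriv W'_cont W_int W'_int mode_sq_cont D_cont m D]
    show "set_integrable lborel {0..t} (\<lambda>s. ?T k s)"
      by (rule tr(1)) auto
    show "(LINT \<xi>:{0..}|lborel. W k \<xi> * mode_sq t k \<xi>) = (LINT \<xi>:{0..}|lborel. W k \<xi> * mode_sq 0 k \<xi>)
      + (LINT s:{0..t}|lborel. ?T k s
          - real (Suc k) * W k 0 * mode_sq s k 0)"
      by (rule tr(2)) auto
  qed
  define F where "F k s = (LINT \<xi>:{0..}|lborel. ?r k s \<xi>)" for k s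
  have F_eq: "F k s = 1 / real (Suc k) * ?T k s" for k s
    unfolding F_def set_integral_mult_right[symmetric]
    by (intro set_lebesgue_integral_cong) (auto simp: W_def W'_def D_def field_simps)
  have F_int: "set_integrable lborel {0..t} (F k)" for k
    unfolding F_eq[abs_def] by (intro set_integrable_mult_right T(1))
  have F_inner_int: "set_integrable lborel {0..} (\<lambda>\<xi>. ?r k s \<xi>)" for k s
  proof (rule set_integral_diff(1))
    have "set_integrable lborel {0..} (\<lambda>\<xi>. 1 / real (Suc k) * (W k \<xi> * D k s \<xi>))"
      by (intro set_integrable_mult_right slice_integrals(1)[OF W_int D_cont D_le])
    then show "set_integrable lborel {0..} (\<lambda>\<xi>. K * (\<phi> \<xi> * damping \<epsilon> k \<xi> * (flux s k \<xi> - flux s (Suc k) \<xi>)))"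
      by (rule set_integrable_cong[THEN iffD1, rotated 3]) (auto simp: W_def D_def field_simps)
    show "set_integrable lborel {0..} (\<lambda>\<xi>. (\<phi>' \<xi> * damping \<epsilon> k \<xi> + \<phi> \<xi> * d' k \<xi>) * mode_sq s k \<xi>)"
      using slice_integrals(1)[OF W'_int mode_sq_cont mode_sq_le] by (simp add: W'_def)
  qed
  have step: "damped_energy \<epsilon> k t = damped_energy \<epsilon> k 0 + (LINT s:{0..t}|lborel. F k s - damping \<epsilon> k 0 * mode_sq s k 0)" for k
  proof -
    have "damped_energy \<epsilon> k t = 1 / real (Suc k) * (LINT \<xi>:{0..}|lborel. W k \<xi> * mode_sq t k \<xi>)"
      by (simp add: damped_energy_def W_def)
    also have "\<dots> = damped_energy \<epsilon> k 0 + (LINT s:{0..t}|lborel. 1 / real (Suc k) *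
        (?T k s - real (Suc k) * W k 0 * mode_sq s k 0))"
      unfolding T(2) set_integral_mult_right by (simp add: damped_energy_def W_def distrib_left)
    also have "\<dots> = damped_energy \<epsilon> k 0 + (LINT s:{0..t}|lborel. F k s - damping \<epsilon> k 0 * mode_sq s k 0)"
      unfolding F_eq by (intro arg_cong2[where f="(+)"] refl set_lebesgue_integral_cong)
        (auto simp: W_def \<phi>_0 right_diff_distrib)
    finally show ?thesis .
  qed
  have bd_int: "set_integrable lborel {0..t} (\<lambda>s. damping \<epsilon> k 0 * mode_sq s k 0)" for k
    unfolding set_integrable_def mode_sq_def
    by (intro borel_integrable_compact continuous_intros) auto
  have total: "(\<Sum>k<N. damped_energy \<epsilon> k t) = (\<Sum>k<N. damped_energy \<epsilon> k 0)
      + (LINT s:{0..t}|lborel. \<Sum>k<N. F k s - damping \<epsilon> k 0 * mode_sq s k 0)"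
    unfolding step sum.distrib by (subst set_integral_sum) (auto intro!: set_integral_diff(1) F_int bd_int)
  have rate: "(LINT s:{0..t}|lborel. \<Sum>k<N. F k s - damping \<epsilon> k 0 * mode_sq s k 0)
     \<le> (LINT s:{0..t}|lborel. ?b s)"
  proof (rule set_integral_mono)
    show "set_integrable lborel {0..t} (\<lambda>s. \<Sum>k<N. F k s - damping \<epsilon> k 0 * mode_sq s k 0)"
      by (intro set_integrable_sum set_integral_diff(1) F_int bd_int)
    show "set_integrable lborel {0..t} (\<lambda>s. ?b s)"
      by (intro set_integral_add(1) set_integrable_mult_right set_integrable_sum order_sq_int damped_energy_time_int[OF \<epsilon>(1)])
        (unfold set_integrable_def, intro borel_integrable_compact continuous_on_const compact_Icc)
    fix s assume "s \<in> {0..t}"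
    then have s: "0 \<le> s" by simp
    let ?x = "norm (u s 1 0)"
    let ?m = "\<lambda>\<xi>. damping \<epsilon> 0 0 * ?x\<^sup>2 * h \<xi>
        + (3 * K + 2) * (\<Sum>k<N. tail_factor \<epsilon> k / real (Suc k) * (\<phi> \<xi> * damping \<epsilon> k \<xi> * mode_sq s k \<xi>))
        + 3 * K * (\<phi> \<xi> * damping \<epsilon> N \<xi>)"
    have "(\<Sum>k<N. F k s) = (LINT \<xi>:{0..}|lborel. \<Sum>k<N. ?r k s \<xi>)"
      unfolding F_def by (rule set_integral_sum[symmetric]) (rule F_inner_int)
    also have "\<dots> \<le> (LINT \<xi>:{0..}|lborel. ?m \<xi>)"
    proof (rule set_integral_mono)
      show "set_integrable lborel {0..} (\<lambda>\<xi>. \<Sum>k<N. ?r k s \<xi>)"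
        by (intro set_integrable_sum F_inner_int)
      show "set_integrable lborel {0..} (\<lambda>\<xi>. ?m \<xi>)"
        by (intro set_integral_add(1) set_integrable_mult_right set_integrable_sum h_int weight_int damped_energy_int \<epsilon>)
      fix \<xi> :: real assume "\<xi> \<in> {0..}"
      then have \<xi>: "0 \<le> \<xi>" by simp
      have ab: "K * \<phi> \<xi> * flux s 0 \<xi> \<le> \<phi>' \<xi> * (norm (u s (Suc 0) \<xi>))\<^sup>2 + ?x\<^sup>2 * h \<xi>"
      proof -
        have "K * \<phi> \<xi> * flux s 0 \<xi> \<le> K * \<phi> \<xi> * (?x * (norm (u s 0 \<xi>) * norm (u s (Suc 0) \<xi>)))"
          using flux_le[of s 0 \<xi>] K_nonneg \<phi>_nonneg[OF \<xi>] by (intro mult_left_mono) auto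
        also have "\<dots> \<le> \<phi>' \<xi> * (norm (u s (Suc 0) \<xi>))\<^sup>2 + ?x\<^sup>2 * h \<xi>"
          by (rule absorb[OF s \<xi>]) simp
        finally show ?thesis .
      qed
      show "(\<Sum>k<N. ?r k s \<xi>)
        \<le> ?m \<xi>"
        unfolding mode_sq_def d'_def
        by (rule mode_sum_estimate[where v = "\<lambda>k. norm (u s (Suc k) \<xi>)" and P = "\<lambda>k. flux s k \<xi>",
              OF K_nonneg \<epsilon> \<xi> \<phi>_nonneg[OF \<xi>] \<phi>'_nonneg[OF \<xi>] h_nonneg[OF \<xi>] N norm_ge_zero norm_le flux_le' flux_le_1 ab])
    qed
    also have "\<dots> = damping \<epsilon> 0 0 * ?x\<^sup>2 * (LINT \<xi>:{0..}|lborel. h \<xi>)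
        + (3 * K + 2) * (\<Sum>k<N. tail_factor \<epsilon> k * damped_energy \<epsilon> k s) + 3 * K * weight_mass \<epsilon> N"
    proof -
      have i1: "set_integrable lborel {0..} (\<lambda>\<xi>. damping \<epsilon> 0 0 * ?x\<^sup>2 * h \<xi>)"
        by (intro set_integrable_mult_right h_int)
      have i0: "set_integrable lborel {0..} (\<lambda>\<xi>. tail_factor \<epsilon> k / real (Suc k) * (\<phi> \<xi> * damping \<epsilon> k \<xi> * mode_sq s k \<xi>))" for k
        by (intro set_integrable_mult_right damped_energy_int \<epsilon>)
      have i2: "set_integrable lborel {0..} (\<lambda>\<xi>. (3 * K + 2) * (\<Sum>k<N. tail_factor \<epsilon> k / real (Suc k) * (\<phi> \<xi> * damping \<epsilon> k \<xi> * mode_sq s k \<xi>)))"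
        by (intro set_integrable_mult_right set_integrable_sum i0)
      have i3: "set_integrable lborel {0..} (\<lambda>\<xi>. 3 * K * (\<phi> \<xi> * damping \<epsilon> N \<xi>))"
        by (intro set_integrable_mult_right weight_int \<epsilon>)
      show ?thesis
        unfolding set_integral_add(2)[OF set_integral_add(1)[OF i1 i2] i3] set_integral_add(2)[OF i1 i2]
          set_integral_mult_right set_integral_sum[OF i0]
        by (simp add: damped_energy_def weight_mass_def)
    qed
    also have "\<dots> \<le> damping \<epsilon> 0 0 * ?x\<^sup>2 * (1 - c)
        + (3 * K + 2) * (\<Sum>k<N. tail_factor \<epsilon> k * damped_energy \<epsilon> k s) + 3 * K * weight_mass \<epsilon> N"
      using mult_left_mono[OF h_le, of "damping \<epsilon> 0 0 * ?x\<^sup>2"] damping_pos[OF \<epsilon>(1), of 0 0] by simp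
    finally have F_le: "(\<Sum>k<N. F k s) \<le> damping \<epsilon> 0 0 * ?x\<^sup>2 * (1 - c)
        + (3 * K + 2) * (\<Sum>k<N. tail_factor \<epsilon> k * damped_energy \<epsilon> k s) + 3 * K * weight_mass \<epsilon> N" .
    have "damping \<epsilon> 0 0 * mode_sq s 0 0 \<le> (\<Sum>k<N. damping \<epsilon> k 0 * mode_sq s k 0)"
      using N by (intro member_le_sum[of 0 "{..<N}" "\<lambda>k. damping \<epsilon> k 0 * mode_sq s k 0"])
        (auto intro!: mult_nonneg_nonneg mode_sq_nonneg less_imp_le[OF damping_pos[OF \<epsilon>(1)]])
    then have bd_le: "damping \<epsilon> 0 0 * ?x\<^sup>2 \<le> (\<Sum>k<N. damping \<epsilon> k 0 * mode_sq s k 0)"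
      by (simp add: mode_sq_def)
    have "damping \<epsilon> 0 0 * ?x\<^sup>2 * (1 - c) = damping \<epsilon> 0 0 * ?x\<^sup>2 + - (c * damping \<epsilon> 0 0) * ?x\<^sup>2"
      by (simp add: algebra_simps)
    with F_le bd_le show "(\<Sum>k<N. F k s - damping \<epsilon> k 0 * mode_sq s k 0)
      \<le> ?b s"
      unfolding sum_subtractf by linarith
  qed
  have rate_eq: "(LINT s:{0..t}|lborel. ?b s)
      = - (c * damping \<epsilon> 0 0) * order_dissipation t
      + (3 * K + 2) * (\<Sum>k<N. tail_factor \<epsilon> k * (LINT s:{0..t}|lborel. damped_energy \<epsilon> k s)) + 3 * K * t * weight_mass \<epsilon> N"
  proof -
    have i1: "set_integrable lborel {0..t} (\<lambda>s. - (c * damping \<epsilon> 0 0) * (norm (u s 1 0))\<^sup>2)"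
      by (intro set_integrable_mult_right order_sq_int)
    have i0: "set_integrable lborel {0..t} (\<lambda>s. tail_factor \<epsilon> k * damped_energy \<epsilon> k s)" for k
      by (intro set_integrable_mult_right damped_energy_time_int \<epsilon>)
    have i2: "set_integrable lborel {0..t} (\<lambda>s. (3 * K + 2) * (\<Sum>k<N. tail_factor \<epsilon> k * damped_energy \<epsilon> k s))"
      by (intro set_integrable_mult_right set_integrable_sum i0)
    have i3: "set_integrable lborel {0..t} (\<lambda>s. 3 * K * weight_mass \<epsilon> N)"
      unfolding set_integrable_def by (intro borel_integrable_compact continuous_on_const compact_Icc)
    have c3: "(LINT s:{0..t}|lborel. weight_mass \<epsilon> N) = t * weight_mass \<epsilon> N"
      unfolding set_lebesgue_integral_def real_scaleR_def integral_mult_left_zero using t by simp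
    show ?thesis
      unfolding set_integral_add(2)[OF set_integral_add(1)[OF i1 i2] i3] set_integral_add(2)[OF i1 i2]
        set_integral_mult_right set_integral_sum[OF i0] c3
      by (simp add: order_dissipation_def)
  qed
  note rate = order.trans[OF rate eq_refl[OF rate_eq]]
  show ?thesis unfolding total using rate[unfolded mult_minus_left] by linarith
qed

end

section \<open>Decay of the energy\<close>

text \<open>
  Gronwall's inequality for a bounded measurable function. Inserting the inequality \<open>n\<close> times into itself leaves the
  remainder \<open>M (C t)\<^sup>n / n!\<close>.
\<close>
lemma gronwall:
  fixes f :: "real \<Rightarrow> real"
  assumes C: "0 \<le> C" and a: "0 \<le> a" and t: "0 \<le> t"
    and f_int: "\<And>s. 0 \<le> s \<Longrightarrow> set_integrable lborel {0..s} f"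
    and f_le: "\<And>s. 0 \<le> s \<Longrightarrow> s \<le> t \<Longrightarrow> f s \<le> a + C * (LINT r:{0..s}|lborel. f r)"
    and bound: "\<And>s. f s \<le> M"
  shows "f t \<le> a * exp (C * t)"
proof -
  define M' where "M' = max M 0"
  have iter: "f s \<le> a * exp (C * s) + M' * ((C * s) ^ n / fact n)" if "0 \<le> s" "s \<le> t" for s n
    using that
  proof (induction n arbitrary: s)
    case 0
    have "f s \<le> M'" using bound[of s] by (simp add: M'_def)
    moreover have "0 \<le> a * exp (C * s)" using a by simp
    ultimately show ?case by simp
  next
    case (Suc n)
    let ?g = "\<lambda>r. C * (a * exp (C * r) + M' * ((C * r) ^ n / fact n))"
    let ?G = "\<lambda>r. a * exp (C * r) + M' * ((C * r) ^ Suc n / fact (Suc n))"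
    have g_cont: "continuous_on {0..s} ?g" by (intro continuous_intros) auto
    have "(LINT r:{0..s}|lborel. ?g r) = ?G s - ?G 0"
      unfolding set_lebesgue_integral_def
    proof (rule integral_FTC_atLeastAtMost[OF Suc.prems(1) _ g_cont])
      fix r
      have "((\<lambda>r. C * r) has_real_derivative C) (at r within {0..s})"
        by (auto intro!: derivative_eq_intros)
      from DERIV_cdivide[OF DERIV_power_Suc[OF this]]
      have "((\<lambda>r. (C * r) ^ Suc n / fact (Suc n)) has_real_derivative
          ((1 + of_nat n) * (C * (C * r) ^ n)) / fact (Suc n)) (at r within {0..s})" .
      also have "((1 + of_nat n) * (C * (C * r) ^ n)) / fact (Suc n) = C * ((C * r) ^ n / fact n)"
        by (simp add: fact_Suc)
      finally have pow: "((\<lambda>r. M' * ((C * r) ^ Suc n / fact (Suc n))) has_real_derivative M' * (C * ((C * r) ^ n / fact n)))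
          (at r within {0..s})"
        by (rule DERIV_cmult)
      have "((\<lambda>r. a * exp (C * r)) has_real_derivative a * (exp (C * r) * C)) (at r within {0..s})"
        by (auto intro!: derivative_eq_intros)
      from DERIV_add[OF this pow] have "(?G has_real_derivative ?g r) (at r within {0..s})"
        by (simp add: algebra_simps del: power_Suc fact_Suc)
      then show "(?G has_vector_derivative ?g r) (at r within {0..s})"
        by (simp add: has_real_derivative_iff_has_vector_derivative)
    qed
    moreover have "C * (LINT r:{0..s}|lborel. f r) \<le> (LINT r:{0..s}|lborel. ?g r)"
      unfolding set_integral_mult_right[symmetric]
    proof (rule set_integral_mono)
      show "set_integrable lborel {0..s} (\<lambda>r. C * f r)"
        by (intro set_integrable_mult_right f_int Suc.prems)
      show "set_integrable lborel {0..s} ?g"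
        unfolding set_integrable_def by (rule borel_integrable_compact[OF compact_Icc g_cont])
    qed (use Suc C in \<open>auto intro!: mult_left_mono\<close>)
    ultimately show ?case using f_le[OF Suc.prems] by simp
  qed
  have "(\<lambda>n. inverse (fact n) * (C * t) ^ n) \<longlonglongrightarrow> 0"
    by (rule summable_LIMSEQ_zero[OF summable_exp])
  then have "(\<lambda>n. a * exp (C * t) + M' * ((C * t) ^ n / fact n)) \<longlonglongrightarrow> a * exp (C * t) + M' * 0"
    by (intro tendsto_intros) (simp add: divide_inverse mult.commute)
  then show ?thesis
    by (rule LIMSEQ_le_const[THEN order.trans]) (use iter[OF t order.refl] in auto)
qed

lemma ennreal_suminf_le:
  fixes f :: "nat \<Rightarrow> ennreal"
  assumes "\<And>N. (\<Sum>k<N. f k) \<le> x"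
  shows "(\<Sum>k. f k) \<le> x"
  unfolding suminf_eq_SUP by (rule SUP_least) (rule assms)

lemma sum_le_ennreal_suminf:
  fixes f :: "nat \<Rightarrow> ennreal"
  shows "(\<Sum>k<N. f k) \<le> (\<Sum>k. f k)"
  unfolding suminf_eq_SUP by (rule SUP_upper) simp

context weighted_modes
begin

definition mode_energy :: "nat \<Rightarrow> real \<Rightarrow> ennreal" where
  "mode_energy k t = (\<integral>\<^sup>+\<xi>\<in>{0..}. ennreal (1 / real (Suc k) * mode_sq t k \<xi> * \<phi> \<xi>) \<partial>lborel)"

definition modal_energy :: "real \<Rightarrow> ennreal" where
  "modal_energy t = (\<integral>\<^sup>+\<xi>\<in>{0..}. (\<Sum>k. ennreal (1 / real (Suc k) * mode_sq t k \<xi> * \<phi> \<xi>)) \<partial>lborel)"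

lemma mode_integrand_measurable [measurable]:
  "(\<lambda>\<xi>. ennreal (1 / real (Suc k) * mode_sq t k \<xi> * \<phi> \<xi>) * indicator {0..} \<xi>) \<in> borel_measurable lborel"
proof -
  have "continuous_on {0..} (\<lambda>\<xi>. 1 / real (Suc k) * mode_sq t k \<xi> * \<phi> \<xi>)"
    unfolding mode_sq_def by (intro continuous_intros \<phi>_cont)
  from borel_measurable_continuous_on_indicator[OF _ this]
  have "(\<lambda>\<xi>. ennreal (indicator {0..} \<xi> *\<^sub>R (1 / real (Suc k) * mode_sq t k \<xi> * \<phi> \<xi>))) \<in> borel_measurable lborel"
    by simp
  moreover have "ennreal (indicator {0..} \<xi> *\<^sub>R (1 / real (Suc k) * mode_sq t k \<xi> * \<phi> \<xi>))
      = ennreal (1 / real (Suc k) * mode_sq t k \<xi> * \<phi> \<xi>) * indicator {0..} \<xi>" for \<xi>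
    by (simp add: indicator_def)
  ultimately show ?thesis by simp
qed

lemma modal_energy_eq: "modal_energy t = (\<Sum>k. mode_energy k t)"
proof -
  have "modal_energy t = (\<integral>\<^sup>+\<xi>. (\<Sum>k. ennreal (1 / real (Suc k) * mode_sq t k \<xi> * \<phi> \<xi>) * indicator {0..} \<xi>) \<partial>lborel)"
    unfolding modal_energy_def by (simp only: ennreal_suminf_multc)
  then show ?thesis
    unfolding mode_energy_def by (simp only: nn_integral_suminf[OF mode_integrand_measurable])
qed

lemma ennreal_damped_energy:
  assumes \<epsilon>: "0 < \<epsilon>"
  shows "ennreal (damped_energy \<epsilon> k t)
    = (\<integral>\<^sup>+\<xi>. ennreal (damping \<epsilon> k \<xi>) * (ennreal (1 / real (Suc k) * mode_sq t k \<xi> * \<phi> \<xi>) * indicator {0..} \<xi>) \<partial>lborel)"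
proof -
  let ?w = "\<lambda>\<xi>. indicator {0..} \<xi> *\<^sub>R (1 / real (Suc k) * (\<phi> \<xi> * damping \<epsilon> k \<xi> * mode_sq t k \<xi>))"
  let ?f = "\<lambda>\<xi>. ennreal (1 / real (Suc k) * mode_sq t k \<xi> * \<phi> \<xi>) * indicator {0..} \<xi>"
  have "damped_energy \<epsilon> k t = (LINT \<xi>|lborel. ?w \<xi>)"
    by (simp only: damped_energy_def set_lebesgue_integral_def[symmetric] set_integral_mult_right)
  moreover have "integrable lborel (\<lambda>\<xi>. ?w \<xi>)"
    unfolding set_integrable_def[symmetric] by (intro set_integrable_mult_right damped_energy_int \<epsilon>)
  moreover have nn: "0 \<le> ?w \<xi>" for \<xi>
    using \<phi>_nonneg[of \<xi>] damping_pos[OF \<epsilon>, of \<xi> k] mode_sq_nonneg[of t k \<xi>]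
    by (auto simp: indicator_def intro!: divide_nonneg_nonneg mult_nonneg_nonneg)
  ultimately have "ennreal (damped_energy \<epsilon> k t)
     = (\<integral>\<^sup>+\<xi>. ennreal (?w \<xi>) \<partial>lborel)"
    by (simp only: nn_integral_eq_integral AE_I2)
  also have "\<dots> = (\<integral>\<^sup>+\<xi>. ennreal (damping \<epsilon> k \<xi>) * ?f \<xi> \<partial>lborel)"
  proof (rule nn_integral_cong)
    fix \<xi> :: real
    show "ennreal (?w \<xi>)
      = ennreal (damping \<epsilon> k \<xi>) * ?f \<xi>"
    proof (cases "0 \<le> \<xi>")
      case True
      have "ennreal (damping \<epsilon> k \<xi>) * ennreal (1 / real (Suc k) * mode_sq t k \<xi> * \<phi> \<xi>)
          = ennreal (damping \<epsilon> k \<xi> * (1 / real (Suc k) * mode_sq t k \<xi> * \<phi> \<xi>))"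
        using damping_pos[OF \<epsilon> True, of k] by (intro ennreal_mult'[symmetric]) auto
      with True show ?thesis by (simp add: mult_ac)
    qed simp
  qed
  finally show ?thesis .
qed

lemma damping_antimono_rate:
  assumes "0 < \<delta>" "\<delta> \<le> \<epsilon>" "0 \<le> \<xi>"
  shows "damping \<epsilon> k \<xi> \<le> damping \<delta> k \<xi>"
  unfolding damping_def
  using assms damping_base_pos[of \<delta> \<xi> k] damping_base_pos[of \<epsilon> \<xi> k]
  by (intro divide_left_mono power_mono add_left_mono mult_right_mono mult_pos_pos zero_less_power) auto

lemma damped_energy_mono:
  assumes "0 < \<delta>" "\<delta> \<le> \<epsilon>"
  shows "damped_energy \<epsilon> k t \<le> damped_energy \<delta> k t"
proof -
  have "ennreal (damped_energy \<epsilon> k t) \<le> ennreal (damped_energy \<delta> k t)"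
    unfolding ennreal_damped_energy[OF assms(1)] ennreal_damped_energy[OF less_le_trans[OF assms]]
  proof (rule nn_integral_mono)
    fix \<xi> :: real
    show "ennreal (damping \<epsilon> k \<xi>) * (ennreal (1 / real (Suc k) * mode_sq t k \<xi> * \<phi> \<xi>) * indicator {0..} \<xi>)
       \<le> ennreal (damping \<delta> k \<xi>) * (ennreal (1 / real (Suc k) * mode_sq t k \<xi> * \<phi> \<xi>) * indicator {0..} \<xi>)"
      by (cases "0 \<le> \<xi>") (simp_all add: mult_right_mono ennreal_leI damping_antimono_rate[OF assms])
  qed
  then show ?thesis using damped_energy_nonneg[of \<delta> k t] assms by (simp add: ennreal_le_iff)
qed

lemma damped_energy_le_mode_energy:
  assumes \<epsilon>: "0 < \<epsilon>"
  shows "ennreal (damped_energy \<epsilon> k t) \<le> mode_energy k t"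
  unfolding ennreal_damped_energy[OF \<epsilon>] mode_energy_def
proof (rule nn_integral_mono)
  fix \<xi> :: real
  show "ennreal (damping \<epsilon> k \<xi>) * (ennreal (1 / real (Suc k) * mode_sq t k \<xi> * \<phi> \<xi>) * indicator {0..} \<xi>)
    \<le> ennreal (1 / real (Suc k) * mode_sq t k \<xi> * \<phi> \<xi>) * indicator {0..} \<xi>"
  proof (cases "0 \<le> \<xi>")
    case True
    have "ennreal (damping \<epsilon> k \<xi>) \<le> 1" using damping_le_1[OF \<epsilon> True, of k] by (simp add: ennreal_le_1 abs_le_iff)
    then show ?thesis using mult_right_mono[of "ennreal (damping \<epsilon> k \<xi>)" 1] by simp
  qed simp
qed

definition eps :: "nat \<Rightarrow> real" where
  "eps n = 1 / real (Suc n)"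

lemma eps: "0 < eps n" "eps n \<le> 1" "eps \<longlonglongrightarrow> 0" "m \<le> n \<Longrightarrow> eps n \<le> eps m"
  unfolding eps_def[abs_def] using LIMSEQ_inverse_real_of_nat
  by (auto simp: inverse_eq_divide field_simps)

lemma damping_tendsto_1: "(\<lambda>n. damping (eps n) k \<xi>) \<longlonglongrightarrow> 1"
proof -
  have "(\<lambda>n. 1 / (1 + eps n * (real (Suc k) + \<xi>))\<^sup>2) \<longlonglongrightarrow> 1 / (1 + 0 * (real (Suc k) + \<xi>))\<^sup>2"
    by (intro tendsto_intros eps(3)) auto
  then show ?thesis by (simp add: damping_def)
qed

lemma damped_energy_tendsto: "(\<lambda>n. ennreal (damped_energy (eps n) k t)) \<longlonglongrightarrow> mode_energy k t"
  unfolding ennreal_damped_energy[OF eps(1)] mode_energy_def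
proof (rule nn_integral_LIMSEQ)
  let ?f = "\<lambda>\<xi>. ennreal (1 / real (Suc k) * mode_sq t k \<xi> * \<phi> \<xi>) * indicator {0..} \<xi>"
  show "incseq (\<lambda>n \<xi>. ennreal (damping (eps n) k \<xi>) * ?f \<xi>)"
  proof (intro monoI le_funI)
    fix m n :: nat and \<xi> :: real assume mn: "m \<le> n"
    have "damping (eps m) k \<xi> \<le> damping (eps n) k \<xi>" if "0 \<le> \<xi>"
      using eps(1) eps(4)[OF mn] that by (rule damping_antimono_rate)
    then show "ennreal (damping (eps m) k \<xi>) * ?f \<xi> \<le> ennreal (damping (eps n) k \<xi>) * ?f \<xi>"
      by (auto simp: indicator_def intro!: mult_right_mono ennreal_leI)
  qed
  show "(\<lambda>\<xi>. ennreal (damping (eps n) k \<xi>) * ?f \<xi>) \<in> borel_measurable lborel" for n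
    unfolding damping_def by (intro borel_measurable_times_ennreal mode_integrand_measurable) simp
  fix \<xi> :: real
  have "(\<lambda>n. ennreal (damping (eps n) k \<xi>) * ?f \<xi>) \<longlonglongrightarrow> ennreal 1 * ?f \<xi>"
  proof (rule tendsto_mult_ennreal)
    show "(\<lambda>n. ennreal (damping (eps n) k \<xi>)) \<longlonglongrightarrow> ennreal 1" by (rule tendsto_ennrealI[OF damping_tendsto_1])
  qed simp_all
  then show "(\<lambda>n. ennreal (damping (eps n) k \<xi>) * ?f \<xi>) \<longlonglongrightarrow> ?f \<xi>" by simp
qed

text \<open>
  The a priori bound: with \<open>tail_factor \<le> 1\<close> the cost of the damping is at most \<open>3 K + 2\<close> times the energy, and
  Gronwall's inequality gives a bound that depends neither on \<open>\<epsilon>\<close> nor on the number of modes.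
\<close>
lemma modal_energy_finite_bound:
  assumes fin: "modal_energy 0 < \<infinity>" and \<epsilon>: "0 < \<epsilon>" "\<epsilon> \<le> 1" and t: "0 \<le> t"
  shows "(\<Sum>k<N. damped_energy \<epsilon> k t) \<le> enn2real (modal_energy 0) * exp ((3 * K + 2) * t)"
proof -
  let ?I = "enn2real (modal_energy 0)" and ?C = "3 * K + 2"
  have init: "(\<Sum>k<n. damped_energy \<epsilon> k 0) \<le> ?I" for n
  proof -
    have "ennreal (\<Sum>k<n. damped_energy \<epsilon> k 0) = (\<Sum>k<n. ennreal (damped_energy \<epsilon> k 0))"
      by (rule sum_ennreal[symmetric]) (rule damped_energy_nonneg[OF \<epsilon>(1)])
    also have "\<dots> \<le> (\<Sum>k<n. mode_energy k 0)"
      by (intro sum_mono damped_energy_le_mode_energy \<epsilon>)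
    also have "\<dots> \<le> modal_energy 0" unfolding modal_energy_eq by (rule sum_le_ennreal_suminf)
    finally have "ennreal (\<Sum>k<n. damped_energy \<epsilon> k 0) \<le> ennreal ?I" using fin by (simp add: ennreal_enn2real)
    then show ?thesis by (simp add: ennreal_le_iff)
  qed
  have est: "(\<Sum>k<n. damped_energy \<epsilon> k t) \<le> (?I + 3 * K * t * weight_mass \<epsilon> n) * exp (?C * t)" if n: "0 < n" for n
  proof -
    obtain M where M: "\<And>s. (\<Sum>k<n. damped_energy \<epsilon> k s) \<le> M" using sum_damped_energy_bounded[OF \<epsilon>(1)] by blast
    show ?thesis
    proof (rule gronwall[where f = "\<lambda>s. \<Sum>k<n. damped_energy \<epsilon> k s", OF _ _ t _ _ M])
      show "0 \<le> ?I + 3 * K * t * weight_mass \<epsilon> n" using K_nonneg t weight_mass_nonneg[OF \<epsilon>(1), of n] by simp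
      show "set_integrable lborel {0..s} (\<lambda>s. \<Sum>k<n. damped_energy \<epsilon> k s)" for s
        by (intro set_integrable_sum damped_energy_time_int \<epsilon>)
      fix s assume s: "0 \<le> s" "s \<le> t"
      have X: "0 \<le> (LINT r:{0..s}|lborel. damped_energy \<epsilon> k r)" for k
        unfolding set_lebesgue_integral_def
        by (intro Bochner_Integration.integral_nonneg) (simp add: damped_energy_nonneg[OF \<epsilon>(1)])
      have "(\<Sum>k<n. tail_factor \<epsilon> k * (LINT r:{0..s}|lborel. damped_energy \<epsilon> k r)) \<le> (\<Sum>k<n. 1 * (LINT r:{0..s}|lborel. damped_energy \<epsilon> k r))"
        by (intro sum_mono mult_right_mono X) (simp add: tail_factor_def)
      also have "\<dots> = (LINT r:{0..s}|lborel. \<Sum>k<n. damped_energy \<epsilon> k r)"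
        by (subst set_integral_sum) (auto intro: damped_energy_time_int \<epsilon>)
      finally have 1: "?C * (\<Sum>k<n. tail_factor \<epsilon> k * (LINT r:{0..s}|lborel. damped_energy \<epsilon> k r)) \<le> ?C * (LINT r:{0..s}|lborel. \<Sum>k<n. damped_energy \<epsilon> k r)"
        using K_nonneg by (intro mult_left_mono) auto
      have 2: "3 * K * s * weight_mass \<epsilon> n \<le> 3 * K * t * weight_mass \<epsilon> n"
        using s K_nonneg weight_mass_nonneg[OF \<epsilon>(1), of n] by (intro mult_right_mono mult_left_mono) auto
      have 3: "0 \<le> c * damping \<epsilon> 0 0 * order_dissipation s"
        unfolding order_dissipation_def set_lebesgue_integral_def using c_nonneg damping_pos[OF \<epsilon>(1), of 0 0]
        by (intro mult_nonneg_nonneg Bochner_Integration.integral_nonneg) auto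
      show "(\<Sum>k<n. damped_energy \<epsilon> k s) \<le> ?I + 3 * K * t * weight_mass \<epsilon> n + ?C * (LINT r:{0..s}|lborel. \<Sum>k<n. damped_energy \<epsilon> k r)"
        using damped_energy_inequality[OF \<epsilon> s(1) n] 1 2 3 init[of n] by linarith
    qed (use K_nonneg in auto)
  qed
  have "(\<lambda>n. (?I + 3 * K * t * weight_mass \<epsilon> n) * exp (?C * t)) \<longlonglongrightarrow> (?I + 3 * K * t * 0) * exp (?C * t)"
    by (intro tendsto_intros weight_mass_tendsto_0 \<epsilon>)
  moreover have "\<exists>n0. \<forall>n\<ge>n0. (\<Sum>k<N. damped_energy \<epsilon> k t) \<le> (?I + 3 * K * t * weight_mass \<epsilon> n) * exp (?C * t)"
  proof (intro exI[of _ "Suc N"] allI impI)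
    fix n assume n: "Suc N \<le> n"
    have "(\<Sum>k<N. damped_energy \<epsilon> k t) \<le> (\<Sum>k<n. damped_energy \<epsilon> k t)"
      using n by (intro sum_mono2) (auto intro: damped_energy_nonneg[OF \<epsilon>(1)])
    with est[of n] n show "(\<Sum>k<N. damped_energy \<epsilon> k t) \<le> (?I + 3 * K * t * weight_mass \<epsilon> n) * exp (?C * t)" by simp
  qed
  ultimately have "(\<Sum>k<N. damped_energy \<epsilon> k t) \<le> (?I + 3 * K * t * 0) * exp (?C * t)"
    by (rule LIMSEQ_le_const)
  then show ?thesis by simp
qed

text \<open>
  The limit of the damped inequality. By the a priori bound the time integrals of the mode energies form a summable
  sequence, so their sum against \<open>tail_factor\<close> tends to \<open>0\<close> with \<open>\<epsilon>\<close> by Tannery's theorem, while the damped energies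
  increase to the energy.
\<close>
theorem modal_energy_decay:
  assumes t: "0 \<le> t"
  shows "modal_energy t + ennreal c * (\<integral>\<^sup>+s\<in>{0..t}. ennreal ((norm (u s 1 0))\<^sup>2) \<partial>lborel) \<le> modal_energy 0"
proof (cases "modal_energy 0 < \<infinity>")
  case False
  then show ?thesis by (simp add: not_less top_unique)
next
  case fin: True
  let ?I = "enn2real (modal_energy 0)" and ?C = "3 * K + 2"
    and ?l = "\<lambda>n. c * damping (eps n) 0 0 * order_dissipation t"
  define X where "X n k = (LINT s:{0..t}|lborel. damped_energy (eps n) k s)" for n k
  have X0: "0 \<le> X n k" for n k
    unfolding X_def set_lebesgue_integral_def
    by (intro Bochner_Integration.integral_nonneg) (simp add: damped_energy_nonneg[OF eps(1)])
  have X_mono: "X m k \<le> X n k" if "m \<le> n" for m n k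
    unfolding X_def by (intro set_integral_mono damped_energy_time_int damped_energy_mono eps that)
  have X_sum: "(\<Sum>k<N. X n k) \<le> t * (?I * exp (?C * t))" for n N
  proof -
    have "(\<Sum>k<N. X n k) = (LINT s:{0..t}|lborel. \<Sum>k<N. damped_energy (eps n) k s)"
      unfolding X_def by (subst set_integral_sum) (auto intro: damped_energy_time_int eps)
    also have "\<dots> \<le> (LINT s:{0..t}|lborel. ?I * exp (?C * t))"
    proof (rule set_integral_mono)
      show "set_integrable lborel {0..t} (\<lambda>s. ?I * exp (?C * t))"
        unfolding set_integrable_def by (intro borel_integrable_compact continuous_on_const compact_Icc)
      fix s assume s: "s \<in> {0..t}"
      have "(\<Sum>k<N. damped_energy (eps n) k s) \<le> ?I * exp (?C * s)"
        using s by (intro modal_energy_finite_bound fin eps) auto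
      also have "\<dots> \<le> ?I * exp (?C * t)" using s K_nonneg by (intro mult_left_mono) (auto intro!: mult_left_mono)
      finally show "(\<Sum>k<N. damped_energy (eps n) k s) \<le> ?I * exp (?C * t)" .
    qed (intro set_integrable_sum damped_energy_time_int eps)
    also have "\<dots> = t * (?I * exp (?C * t))" using t by (simp add: set_lebesgue_integral_def)
    finally show ?thesis .
  qed
  \<comment> \<open>A dominating sequence independent of \<open>\<epsilon>\<close>, the time integral of the undamped mode energy.\<close>
  define \<beta> where "\<beta> k = (SUP n. X n k)" for k
  have X_bdd: "bdd_above (range (\<lambda>n. X n k))" for k
  proof (rule bdd_aboveI2)
    fix n
    have "X n k \<le> (\<Sum>j<Suc k. X n j)" by (rule member_le_sum) (auto intro: X0)
    also have "\<dots> \<le> t * (?I * exp (?C * t))" by (rule X_sum)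
    finally show "X n k \<le> t * (?I * exp (?C * t))" .
  qed
  have X_le: "X n k \<le> \<beta> k" for n k unfolding \<beta>_def by (rule cSUP_upper[OF UNIV_I X_bdd])
  have \<beta>0: "0 \<le> \<beta> k" for k using X0[of 0 k] X_le[of 0 k] by linarith
  have X_lim: "(\<lambda>n. X n k) \<longlonglongrightarrow> \<beta> k" for k
    unfolding \<beta>_def by (rule LIMSEQ_incseq_SUP[OF X_bdd]) (auto intro!: monoI X_mono)
  have \<beta>_summable: "summable \<beta>"
  proof (rule summableI_nonneg_bounded[OF \<beta>0])
    fix N
    have "(\<lambda>n. \<Sum>k<N. X n k) \<longlonglongrightarrow> (\<Sum>k<N. \<beta> k)" by (intro tendsto_sum X_lim)
    then show "(\<Sum>k<N. \<beta> k) \<le> t * (?I * exp (?C * t))" by (rule LIMSEQ_le_const2) (auto intro: X_sum)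
  qed
  have tail: "0 \<le> tail_factor (eps n) k" "tail_factor (eps n) k \<le> 1" for n k
    using eps(1)[of n] by (auto simp: tail_factor_def)
  have tail_lim: "(\<lambda>n. tail_factor (eps n) k) \<longlonglongrightarrow> 0" for k
  proof -
    have "(\<lambda>n. min 1 (eps n * real (Suc k))) \<longlonglongrightarrow> min 1 (0 * real (Suc k))"
      by (intro tendsto_intros eps(3))
    then show ?thesis by (simp add: tail_factor_def)
  qed
  define S where "S n = (\<Sum>k. tail_factor (eps n) k * \<beta> k)" for n
  have S_summable: "summable (\<lambda>k. tail_factor (eps n) k * \<beta> k)" for n
  proof (rule summable_comparison_test'[OF \<beta>_summable])
    show "norm (tail_factor (eps n) k * \<beta> k) \<le> \<beta> k" for k
      using tail[of n k] \<beta>0[of k] by (simp add: abs_mult mult_left_le_one_le)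
  qed
  have S_lim: "S \<longlonglongrightarrow> 0"
  proof -
    have "(\<lambda>n. \<Sum>k. tail_factor (eps n) k * \<beta> k) \<longlonglongrightarrow> (\<Sum>k. 0 :: real)"
    proof (rule tannerys_theorem[THEN conjunct2, THEN conjunct2])
      show "(\<lambda>n. tail_factor (eps n) k * \<beta> k) \<longlonglongrightarrow> 0" for k
        by (rule tendsto_mult_left_zero[OF tail_lim])
      have "norm (tail_factor (eps n) k * \<beta> k) \<le> \<beta> k" for n k
        using tail[of n k] \<beta>0[of k] by (simp add: abs_mult mult_left_le_one_le)
      then show "\<forall>\<^sub>F (k, n) in sequentially \<times>\<^sub>F sequentially. norm (tail_factor (eps n) k * \<beta> k) \<le> \<beta> k"
        by (simp add: case_prod_unfold)
    qed (use \<beta>_summable in auto)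
    then show ?thesis by (simp add: S_def[abs_def])
  qed
  have H0: "0 \<le> order_dissipation t"
    unfolding order_dissipation_def set_lebesgue_integral_def by (intro Bochner_Integration.integral_nonneg) auto
  have key: "(\<Sum>k<M. damped_energy (eps n) k t) + ?l n \<le> ?I + ?C * S n" for M n
  proof -
    have "(\<lambda>N. ?I + ?C * S n + 3 * K * t * weight_mass (eps n) N) \<longlonglongrightarrow> ?I + ?C * S n + 3 * K * t * 0"
      by (intro tendsto_intros weight_mass_tendsto_0 eps)
    moreover have "\<exists>N0. \<forall>N\<ge>N0. (\<Sum>k<M. damped_energy (eps n) k t) + ?l n
        \<le> ?I + ?C * S n + 3 * K * t * weight_mass (eps n) N"
    proof (intro exI[of _ "Suc M"] allI impI)
      fix N assume N: "Suc M \<le> N"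
      have "(\<Sum>k<N. damped_energy (eps n) k 0) \<le> ?I"
        using modal_energy_finite_bound[OF fin eps(1,2)[of n] order.refl, of N] by simp
      moreover have "(\<Sum>k<N. tail_factor (eps n) k * X n k) \<le> S n"
      proof -
        have "(\<Sum>k<N. tail_factor (eps n) k * X n k) \<le> (\<Sum>k<N. tail_factor (eps n) k * \<beta> k)"
          by (intro sum_mono mult_left_mono X_le tail)
        also have "\<dots> \<le> S n" unfolding S_def
          by (rule sum_le_suminf[OF S_summable]) (auto intro: mult_nonneg_nonneg tail \<beta>0)
        finally show ?thesis .
      qed
      then have "?C * (\<Sum>k<N. tail_factor (eps n) k * X n k) \<le> ?C * S n"
        using K_nonneg by (intro mult_left_mono) auto
      moreover have "(\<Sum>k<M. damped_energy (eps n) k t) \<le> (\<Sum>k<N. damped_energy (eps n) k t)"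
        using N by (intro sum_mono2) (auto intro: damped_energy_nonneg[OF eps(1)])
      ultimately show "(\<Sum>k<M. damped_energy (eps n) k t) + ?l n
          \<le> ?I + ?C * S n + 3 * K * t * weight_mass (eps n) N"
        using damped_energy_inequality[OF eps(1,2)[of n] t, of N, folded X_def] N by linarith
    qed
    ultimately show ?thesis using LIMSEQ_le_const by fastforce
  qed
  have finite_modes: "(\<Sum>k<M. mode_energy k t) + ennreal (c * order_dissipation t) \<le> modal_energy 0" for M
  proof -
    have lhs: "(\<lambda>n. (\<Sum>k<M. ennreal (damped_energy (eps n) k t)) + ennreal (?l n))
      \<longlonglongrightarrow> (\<Sum>k<M. mode_energy k t) + ennreal (c * 1 * order_dissipation t)"
      by (intro tendsto_add tendsto_sum damped_energy_tendsto tendsto_ennrealI tendsto_mult tendsto_const damping_tendsto_1)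
    have rhs: "(\<lambda>n. ennreal (?I + ?C * S n)) \<longlonglongrightarrow> ennreal (?I + ?C * 0)"
      by (intro tendsto_ennrealI tendsto_intros S_lim)
    have "(\<Sum>k<M. ennreal (damped_energy (eps n) k t)) + ennreal (?l n) \<le> ennreal (?I + ?C * S n)" for n
    proof -
      have c0: "0 \<le> ?l n"
        using c_nonneg damping_pos[OF eps(1), of 0 n 0] H0 by (intro mult_nonneg_nonneg) auto
      have "(\<Sum>k<M. ennreal (damped_energy (eps n) k t)) + ennreal (?l n)
        = ennreal ((\<Sum>k<M. damped_energy (eps n) k t) + ?l n)"
        using damped_energy_nonneg[OF eps(1)] c0 by (simp add: sum_ennreal sum_nonneg ennreal_plus)
      then show ?thesis using ennreal_leI[OF key] by simp
    qed
    then have "(\<Sum>k<M. mode_energy k t) + ennreal (c * 1 * order_dissipation t) \<le> ennreal (?I + ?C * 0)"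
      by (intro LIMSEQ_le[OF lhs rhs]) auto
    then show ?thesis using fin by (simp add: ennreal_enn2real)
  qed
  let ?\<eta> = "\<integral>\<^sup>+s\<in>{0..t}. ennreal ((norm (u s 1 0))\<^sup>2) \<partial>lborel"
  have diss: "ennreal c * ?\<eta> = ennreal (c * order_dissipation t)"
  proof -
    have "?\<eta> = (\<integral>\<^sup>+s. ennreal (indicator {0..t} s *\<^sub>R (norm (u s 1 0))\<^sup>2) \<partial>lborel)"
      by (intro nn_integral_cong) (simp add: indicator_def)
    also have "\<dots> = ennreal (order_dissipation t)"
      unfolding order_dissipation_def set_lebesgue_integral_def
      using order_sq_int[of 0 t] unfolding set_integrable_def by (intro nn_integral_eq_integral) auto
    finally show ?thesis using c_nonneg by (simp add: ennreal_mult')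
  qed
  have "(\<Sum>k<M. mode_energy k t) \<le> modal_energy 0 - ennreal (c * order_dissipation t)" for M
    using finite_modes[of M] fin by (subst ennreal_le_minus_iff) (auto simp: add.commute)
  then have "modal_energy t \<le> modal_energy 0 - ennreal (c * order_dissipation t)"
    unfolding modal_energy_eq[of t] by (rule ennreal_suminf_le)
  moreover have "ennreal (c * order_dissipation t) \<le> modal_energy 0"
    using finite_modes[of 0] by simp
  ultimately show ?thesis unfolding diss
    using add_right_mono[of "modal_energy t" "modal_energy 0 - ennreal (c * order_dissipation t)" "ennreal (c * order_dissipation t)"]
    by (simp add: diff_add_cancel_ennreal)
qed

end

section \<open>The energy weight\<close>

text \<open>
  The only place where the size of \<open>K\<close> matters. The weight is \<open>\<phi> = 1 / (1 - \<integral> m)\<close> with \<open>m = \<alpha> G + \<delta> exp (- \<xi>)\<close>, so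
  that \<open>\<phi>' = m \<phi>\<^sup>2\<close>, and \<open>h = K\<^sup>2 G / (4 \<alpha>)\<close>. With \<open>J = \<integral> G\<close> one needs \<open>\<alpha> J < 1\<close> for \<open>\<phi>\<close> to be bounded and
  \<open>K\<^sup>2 J / 4 < \<alpha>\<close> for \<open>\<integral> h < 1\<close>; both can be had since \<open>K J < 2\<close>. The term with \<open>\<delta>\<close> makes \<open>\<phi>\<close> strictly increasing where \<open>G\<close>
  vanishes.
\<close>
lemma exists_energy_weight:
  fixes G :: "real \<Rightarrow> real" and K :: real
  assumes G_cont: "continuous_on {0..} G" and G_nonneg: "\<And>\<xi>. 0 \<le> G \<xi>"
    and G_int: "set_integrable lborel {0..} G" and J_pos: "0 < (LINT \<xi>:{0..}|lborel. G \<xi>)"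
    and K: "0 \<le> K" "K < 2 / (LINT \<xi>:{0..}|lborel. G \<xi>)"
  obtains c B \<phi> \<phi>' h where "0 < c"
    and "\<And>\<xi>. 0 \<le> \<xi> \<Longrightarrow> (\<phi> has_real_derivative \<phi>' \<xi>) (at \<xi> within {0..})"
    and "continuous_on {0..} \<phi>'" and "set_integrable lborel {0..} \<phi>'"
    and "\<And>\<xi>. 0 \<le> \<xi> \<Longrightarrow> 0 < \<phi>' \<xi>" and "\<phi> 0 = 1"
    and "\<And>\<xi>. 0 \<le> \<xi> \<Longrightarrow> 1 \<le> \<phi> \<xi>" and "\<And>\<xi>. 0 \<le> \<xi> \<Longrightarrow> \<phi> \<xi> \<le> B"
    and "\<And>\<xi>. 0 \<le> \<xi> \<Longrightarrow> 0 \<le> h \<xi>" and "set_integrable lborel {0..} h"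
    and "(LINT \<xi>:{0..}|lborel. h \<xi>) \<le> 1 - c"
    and "\<And>\<xi> x y. 0 \<le> \<xi> \<Longrightarrow> K * \<phi> \<xi> * (x * (G \<xi> * y)) \<le> \<phi>' \<xi> * y\<^sup>2 + x\<^sup>2 * h \<xi>"
proof -
  define J where "J = (LINT \<xi>:{0..}|lborel. G \<xi>)"
  have J: "0 < J" using J_pos by (simp add: J_def)
  have KJ: "K * J < 2" using K(2) J by (simp add: J_def[symmetric] field_simps)
  define \<alpha> where "\<alpha> = (K\<^sup>2 * J / 4 + 1 / J) / 2"
  have "K\<^sup>2 * J\<^sup>2 < 2\<^sup>2"
    using KJ K J power_strict_mono[of "K * J" 2 2] by (simp add: power_mult_distrib)
  then have gap: "K\<^sup>2 * J / 4 < 1 / J" using J by (simp add: field_simps power2_eq_square)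
  have midpoint: "a < (a + b) / 2 \<and> (a + b) / 2 < b" if "a < b" for a b :: real using that by simp
  have "0 \<le> K\<^sup>2 * J / 4" using J by simp
  then have \<alpha>_pos: "0 < \<alpha>" using J unfolding \<alpha>_def by (simp add: add_nonneg_pos)
  have \<alpha>_lower: "K\<^sup>2 * J / 4 < \<alpha>" unfolding \<alpha>_def by (rule midpoint[OF gap, THEN conjunct1])
  have "\<alpha> < 1 / J" unfolding \<alpha>_def by (rule midpoint[OF gap, THEN conjunct2])
  then have \<alpha>J: "\<alpha> * J < 1" using J by (simp add: field_simps)
  define \<delta> where "\<delta> = (1 - \<alpha> * J) / 2"
  have \<delta>: "0 < \<delta>" using \<alpha>J by (simp add: \<delta>_def)
  define m where "m \<xi> = \<alpha> * G \<xi> + \<delta> * exp (- \<xi>)" for \<xi>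
  have m_pos: "0 < m \<xi>" for \<xi>
    using \<alpha>_pos \<delta> G_nonneg[of \<xi>] by (simp add: m_def add_nonneg_pos)
  have m_cont: "continuous_on {0..} m"
    unfolding m_def[abs_def] by (intro continuous_intros G_cont)
  have exp: "set_integrable lborel {0..} (\<lambda>\<xi>::real. exp (- \<xi>))" "(LINT \<xi>:{0..}|lborel. exp (- \<xi>)) = (1::real)"
    using has_bochner_integral_I0i_power_exp_m'[of 0]
    by (auto simp: set_integrable_def set_lebesgue_integral_def has_bochner_integral_iff mult.commute)
  have m_int: "set_integrable lborel {0..} m"
    unfolding m_def[abs_def] by (intro set_integral_add(1) set_integrable_mult_right G_int exp)
  have "(LINT \<xi>:{0..}|lborel. m \<xi>) = (LINT \<xi>:{0..}|lborel. \<alpha> * G \<xi>) + (LINT \<xi>:{0..}|lborel. \<delta> * exp (- \<xi>))"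
    unfolding m_def by (intro set_integral_add(2) set_integrable_mult_right G_int exp)
  also have "\<dots> = \<alpha> * J + \<delta>" unfolding set_integral_mult_right exp(2) J_def by simp
  finally have m_total: "(LINT \<xi>:{0..}|lborel. m \<xi>) = \<alpha> * J + \<delta>" .
  define q where "q = 1 - (\<alpha> * J + \<delta>)"
  have q: "0 < q" using \<alpha>J by (simp add: q_def \<delta>_def field_simps)
  define \<psi> where "\<psi> \<xi> = 1 - integral {0..\<xi>} m" for \<xi>
  have \<psi>_ge: "q \<le> \<psi> \<xi>" and \<psi>_le: "\<psi> \<xi> \<le> 1" for \<xi>
  proof -
    have i: "set_integrable lborel {0..\<xi>} m" by (rule set_integrable_subset[OF m_int]) auto
    have eq: "(LINT x:{0..\<xi>}|lborel. m x) = integral {0..\<xi>} m" by (rule set_borel_integral_eq_integral(2)[OF i])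
    have "(LINT x:{0..\<xi>}|lborel. m x) \<le> (LINT x:{0..}|lborel. m x)"
      using i m_int m_pos unfolding set_lebesgue_integral_def set_integrable_def
      by (intro integral_mono) (auto simp: indicator_def less_imp_le)
    then show "q \<le> \<psi> \<xi>" unfolding eq m_total by (simp add: \<psi>_def q_def)
    have "0 \<le> (LINT x:{0..\<xi>}|lborel. m x)"
      unfolding set_lebesgue_integral_def by (intro Bochner_Integration.integral_nonneg) (simp add: less_imp_le[OF m_pos])
    then show "\<psi> \<xi> \<le> 1" unfolding eq by (simp add: \<psi>_def)
  qed
  have \<psi>_pos: "0 < \<psi> \<xi>" for \<xi> using \<psi>_ge[of \<xi>] q by linarith
  define \<phi> where "\<phi> \<xi> = 1 / \<psi> \<xi>" for \<xi>
  define \<phi>' where "\<phi>' \<xi> = (\<phi> \<xi>)\<^sup>2 * m \<xi>" for \<xi>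
  have \<phi>_deriv: "(\<phi> has_real_derivative \<phi>' \<xi>) (at \<xi> within {0..})" if "0 \<le> \<xi>" for \<xi>
  proof -
    have "(\<psi> has_real_derivative - m \<xi>) (at \<xi> within {0..})"
      unfolding \<psi>_def[abs_def]
      using integral_from_0_has_derivative[OF m_cont that] by (auto intro!: derivative_eq_intros)
    then show ?thesis
      unfolding \<phi>_def[abs_def] \<phi>'_def using \<psi>_pos[of \<xi>]
      by (auto intro!: derivative_eq_intros simp: power2_eq_square \<phi>_def)
  qed
  have \<phi>_cont: "continuous_on {0..} \<phi>"
    using \<phi>_deriv by (auto simp: continuous_on_eq_continuous_within intro: DERIV_continuous)
  have \<phi>_ge: "1 \<le> \<phi> \<xi>" and \<phi>_le: "\<phi> \<xi> \<le> 1 / q" for \<xi>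
    using \<psi>_pos[of \<xi>] \<psi>_le[of \<xi>] \<psi>_ge[of \<xi>] q by (auto simp: \<phi>_def intro!: divide_left_mono)
  define h where "h \<xi> = K\<^sup>2 / (4 * \<alpha>) * G \<xi>" for \<xi>
  define c where "c = 1 - K\<^sup>2 / (4 * \<alpha>) * J"
  show thesis
  proof (rule that[of c \<phi> \<phi>' "1 / q" h])
    show "0 < c" using \<alpha>_lower \<alpha>_pos by (simp add: c_def field_simps)
    show "(\<phi> has_real_derivative \<phi>' \<xi>) (at \<xi> within {0..})" if "0 \<le> \<xi>" for \<xi> by (rule \<phi>_deriv[OF that])
    show "continuous_on {0..} \<phi>'" unfolding \<phi>'_def[abs_def] by (intro continuous_intros \<phi>_cont m_cont)
    show "set_integrable lborel {0..} \<phi>'"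
      unfolding \<phi>'_def[abs_def]
    proof (rule set_integrable_mult_bounded[OF m_int])
      show "\<bar>(\<phi> \<xi>)\<^sup>2\<bar> \<le> (1 / q)\<^sup>2" for \<xi>
        using \<phi>_ge[of \<xi>] \<phi>_le[of \<xi>] by (simp only: abs_power2) (intro power_mono; linarith)
    qed (intro continuous_intros \<phi>_cont)
    show "0 < \<phi>' \<xi>" for \<xi>
      using \<phi>_ge[of \<xi>] m_pos[of \<xi>] by (auto simp: \<phi>'_def intro!: mult_pos_pos zero_less_power)
    show "\<phi> 0 = 1" by (simp add: \<phi>_def \<psi>_def)
    show "1 \<le> \<phi> \<xi>" "\<phi> \<xi> \<le> 1 / q" for \<xi> by (rule \<phi>_ge \<phi>_le)+
    show "0 \<le> h \<xi>" for \<xi> using \<alpha>_pos G_nonneg by (simp add: h_def)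
    show "set_integrable lborel {0..} h" unfolding h_def[abs_def] by (intro set_integrable_mult_right G_int)
    show "(LINT \<xi>:{0..}|lborel. h \<xi>) \<le> 1 - c"
      unfolding h_def set_integral_mult_right by (simp add: c_def J_def)
    fix \<xi> x y :: real
    \<comment> \<open>The square completed for \<open>\<alpha> G\<close> in place of \<open>m\<close>, so that no division by \<open>m\<close> is needed.\<close>
    have "0 \<le> G \<xi> / \<alpha> * (\<alpha> * \<phi> \<xi> * y - x * K / 2)\<^sup>2"
      using \<alpha>_pos G_nonneg[of \<xi>] by simp
    also have "\<dots> = \<alpha> * G \<xi> * (\<phi> \<xi>)\<^sup>2 * y\<^sup>2 - K * \<phi> \<xi> * (x * (G \<xi> * y)) + x\<^sup>2 * h \<xi>"
      using \<alpha>_pos by (simp add: h_def field_simps power2_eq_square)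
    also have "\<alpha> * G \<xi> * (\<phi> \<xi>)\<^sup>2 * y\<^sup>2 \<le> \<phi>' \<xi> * y\<^sup>2"
    proof -
      have "\<alpha> * G \<xi> \<le> m \<xi>" using \<delta> by (simp add: m_def)
      then have "\<alpha> * G \<xi> * ((\<phi> \<xi>)\<^sup>2 * y\<^sup>2) \<le> m \<xi> * ((\<phi> \<xi>)\<^sup>2 * y\<^sup>2)" by (intro mult_right_mono) auto
      then show ?thesis by (simp add: \<phi>'_def mult_ac)
    qed
    finally show "K * \<phi> \<xi> * (x * (G \<xi> * y)) \<le> \<phi>' \<xi> * y\<^sup>2 + x\<^sup>2 * h \<xi>" by simp
  qed
qed

section \<open>Cut-off Fourier modes and test functions\<close>

text \<open>
  A \<open>C\<^sup>1\<close> function supported in \<open>[-R, R]\<close> that increases to \<open>1\<close> with \<open>R\<close>.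
\<close>
definition cutoff :: "real \<Rightarrow> real \<Rightarrow> real" where
  "cutoff R \<omega> = (max 0 (1 - (\<omega> / R)\<^sup>2))\<^sup>2"

lemma cutoff_bounds: "0 \<le> cutoff R \<omega>" "cutoff R \<omega> \<le> 1"
  by (auto simp: cutoff_def intro!: power_le_one)

lemma cutoff_eq_0:
  assumes "0 < R" "R < \<bar>\<omega>\<bar>"
  shows "cutoff R \<omega> = 0"
proof -
  have "1 \<le> \<bar>\<omega> / R\<bar>" using assms by (simp add: field_simps)
  then have "1 \<le> (\<omega> / R)\<^sup>2" using one_le_power[of "\<bar>\<omega> / R\<bar>" 2] by (simp only: power2_abs)
  then show ?thesis by (simp add: cutoff_def)
qed

lemma cutoff_cont: "continuous_on S (cutoff R)"
  unfolding cutoff_def[abs_def] divide_inverse by (intro continuous_intros)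

lemma square_positive_part_deriv:
  "((\<lambda>x::real. (max 0 x)\<^sup>2) has_real_derivative 2 * max 0 x) (at x)"
proof -
  consider "x < 0" | "x = 0" | "0 < x" by linarith
  then show ?thesis
  proof cases
    case 1
    have "((\<lambda>_. 0 :: real) has_real_derivative 0) (at x)" by simp
    then have "((\<lambda>x::real. (max 0 x)\<^sup>2) has_real_derivative 0) (at x)"
      by (rule has_field_derivative_transform_within_open[of _ _ _ "{..<0}"]) (use 1 in auto)
    then show ?thesis using 1 by simp
  next
    case 2
    have "\<forall>z. (max 0 z)\<^sup>2 - (max 0 (0::real))\<^sup>2 = max 0 z * (z - 0)"
      by (auto simp: max_def power2_eq_square)
    moreover have "isCont (\<lambda>z::real. max 0 z) 0" by (intro continuous_intros)
    ultimately show ?thesis unfolding 2 CARAT_DERIV by (intro exI[of _ "\<lambda>z. max 0 z"]) simp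
  next
    case 3
    have "((\<lambda>x. x\<^sup>2) has_real_derivative 2 * x) (at x)" by (auto intro!: derivative_eq_intros)
    then have "((\<lambda>x::real. (max 0 x)\<^sup>2) has_real_derivative 2 * x) (at x)"
      by (rule has_field_derivative_transform_within_open[of _ _ _ "{0<..}"]) (use 3 in auto)
    then show ?thesis using 3 by simp
  qed
qed

definition cutoff' :: "real \<Rightarrow> real \<Rightarrow> real" where
  "cutoff' R \<omega> = 2 * max 0 (1 - (\<omega> / R)\<^sup>2) * (- 2 * (\<omega> / R) * (1 / R))"

lemma cutoff_deriv: "0 < R \<Longrightarrow> (cutoff R has_real_derivative cutoff' R \<omega>) (at \<omega>)"
  unfolding cutoff_def[abs_def] cutoff'_def
  by (rule DERIV_chain2[OF square_positive_part_deriv]) (auto intro!: derivative_eq_intros)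

lemma cutoff'_cont: "continuous_on S (cutoff' R)"
  unfolding cutoff'_def[abs_def] divide_inverse by (intro continuous_intros)

lemma cutoff_tendsto_1: "(\<lambda>n. cutoff (real (Suc n)) \<omega>) \<longlonglongrightarrow> 1"
proof -
  have "(\<lambda>n. \<omega> * inverse (real (Suc n))) \<longlonglongrightarrow> 0"
    by (rule tendsto_mult_right_zero[OF LIMSEQ_inverse_real_of_nat])
  then have "(\<lambda>n. (max 0 (1 - (\<omega> * inverse (real (Suc n)))\<^sup>2))\<^sup>2) \<longlonglongrightarrow> (max 0 (1 - 0\<^sup>2))\<^sup>2"
    by (intro tendsto_intros)
  then show ?thesis by (simp add: cutoff_def divide_inverse)
qed

text \<open>
  A function that satisfies \<open>w' = F\<close> with initial value \<open>w0\<close> against all test functions of time satisfies it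
  classically. With \<open>W\<close> the classical solution, the test function whose derivative is
  \<open>- (w - W) max 0 (T - s)\<close> and which vanishes from \<open>T\<close> on makes the integral of \<open>(w - W)\<^sup>2 max 0 (T - s)\<close> vanish.
\<close>
lemma du_Bois_Reymond_evolution:
  fixes w F :: "real \<Rightarrow> real" and w0 :: real
  assumes w: "continuous_on {0..} w" and F: "continuous_on {0..} F"
    and weak: "\<And>\<sigma> \<sigma>' T. (\<And>s. 0 \<le> s \<Longrightarrow> (\<sigma> has_real_derivative \<sigma>' s) (at s within {0..})) \<Longrightarrow>
      continuous_on {0..} \<sigma>' \<Longrightarrow> (\<And>s. T < s \<Longrightarrow> \<sigma> s = 0) \<Longrightarrow>
      0 = \<sigma> 0 * w0 + (LINT s:{0..}|lborel. \<sigma>' s * w s + \<sigma> s * F s)"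
    and t: "0 \<le> t"
  shows "w t = w0 + integral {0..t} F"
proof -
  define W where "W s = w0 + integral {0..s} F" for s
  \<comment> \<open>Any time after \<open>t\<close> serves.\<close>
  define T where "T = t + 1"
  define k where "k s = (w s - W s) * max 0 (T - s)" for s
  have W_deriv: "(W has_real_derivative F s) (at s within {0..})" if "0 \<le> s" for s
    unfolding W_def[abs_def] using integral_from_0_has_derivative[OF F that] by (auto intro!: derivative_eq_intros)
  then have W_cont: "continuous_on {0..} W"
    by (auto simp: continuous_on_eq_continuous_within intro: DERIV_continuous)
  have k_cont: "continuous_on {0..} k"
    unfolding k_def[abs_def] by (intro continuous_intros w W_cont)
  define \<sigma> where "\<sigma> s = integral {0..T} k - integral {0..s} k" for s
  have \<sigma>_deriv: "(\<sigma> has_real_derivative - k s) (at s within {0..})" if "0 \<le> s" for s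
    unfolding \<sigma>_def[abs_def] using integral_from_0_has_derivative[OF k_cont that] by (auto intro!: derivative_eq_intros)
  then have \<sigma>_cont: "continuous_on {0..} \<sigma>"
    by (auto simp: continuous_on_eq_continuous_within intro: DERIV_continuous)
  have T: "0 < T" using t by (simp add: T_def)
  have \<sigma>_0: "\<sigma> s = 0" if "T \<le> s" for s
  proof -
    have "integral {0..T} k + integral {T..s} k = integral {0..s} k"
      using T that by (intro Henstock_Kurzweil_Integration.integral_combine integrable_continuous_real continuous_on_subset[OF k_cont]) auto
    moreover have "integral {T..s} k = integral {T..s} (\<lambda>_. 0)"
      by (rule integral_cong) (simp add: k_def)
    ultimately show ?thesis by (simp add: \<sigma>_def)
  qed
  have c: "continuous_on {0..T} (\<lambda>s. - k s * w s + \<sigma> s * F s)"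
    by (intro continuous_intros continuous_on_subset[OF k_cont] continuous_on_subset[OF w]
        continuous_on_subset[OF \<sigma>_cont] continuous_on_subset[OF F]) auto
  have "0 = \<sigma> 0 * w0 + (LINT s:{0..}|lborel. - k s * w s + \<sigma> s * F s)"
    by (rule weak[OF \<sigma>_deriv, of T]) (auto intro!: continuous_intros k_cont \<sigma>_0)
  also have "(LINT s:{0..}|lborel. - k s * w s + \<sigma> s * F s) = (LINT s:{0..T}|lborel. - k s * w s + \<sigma> s * F s)"
    unfolding set_lebesgue_integral_def using \<sigma>_0
    by (intro Bochner_Integration.integral_cong) (auto simp: indicator_def k_def)
  also have "\<dots> = integral {0..T} (\<lambda>s. - k s * w s + \<sigma> s * F s)"
    by (rule set_borel_integral_eq_integral(2)) (unfold set_integrable_def, rule borel_integrable_compact[OF compact_Icc c])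
  finally have 1: "integral {0..T} (\<lambda>s. - k s * w s + \<sigma> s * F s) = - (\<sigma> 0 * w0)" by simp
  have "((\<lambda>s. - k s * W s + \<sigma> s * F s) has_integral \<sigma> T * W T - \<sigma> 0 * W 0) {0..T}"
  proof (rule fundamental_theorem_of_calculus)
    fix s assume s: "s \<in> {0..T}"
    have "((\<lambda>s. \<sigma> s * W s) has_real_derivative - k s * W s + \<sigma> s * F s) (at s within {0..T})"
      using DERIV_mult[OF \<sigma>_deriv W_deriv, of s] s
      by (auto simp: mult.commute elim!: has_field_derivative_subset)
    then show "((\<lambda>s. \<sigma> s * W s) has_vector_derivative - k s * W s + \<sigma> s * F s) (at s within {0..T})"
      by (simp add: has_real_derivative_iff_has_vector_derivative)
  qed (use T in simp)
  then have 2: "integral {0..T} (\<lambda>s. - k s * W s + \<sigma> s * F s) = - (\<sigma> 0 * w0)"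
    using \<sigma>_0[of T] by (simp add: integral_unique W_def)
  have sq_cont: "continuous_on {0..T} (\<lambda>s. (w s - W s)\<^sup>2 * max 0 (T - s))"
    by (intro continuous_intros continuous_on_subset[OF w] continuous_on_subset[OF W_cont]) auto
  have c2: "continuous_on {0..T} (\<lambda>s. - k s * W s + \<sigma> s * F s)"
    by (intro continuous_intros continuous_on_subset[OF k_cont] continuous_on_subset[OF W_cont]
        continuous_on_subset[OF \<sigma>_cont] continuous_on_subset[OF F]) auto
  have "integral {0..T} (\<lambda>s. (w s - W s)\<^sup>2 * max 0 (T - s))
      = integral {0..T} (\<lambda>s. (- k s * W s + \<sigma> s * F s) - (- k s * w s + \<sigma> s * F s))"
    by (rule integral_cong) (simp add: k_def power2_eq_square algebra_simps)
  also have "\<dots> = 0"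
    unfolding Henstock_Kurzweil_Integration.integral_diff[OF integrable_continuous_real[OF c2] integrable_continuous_real[OF c]]
      1 2 by simp
  finally have zero: "integral {0..T} (\<lambda>s. (w s - W s)\<^sup>2 * max 0 (T - s)) = 0" .
  have "(w t - W t)\<^sup>2 * max 0 (T - t) = 0"
    using iffD1[OF integral_eq_0_iff[OF sq_cont T] zero] t by (auto simp: T_def)
  then show ?thesis by (simp add: T_def W_def)
qed

lemma space_prob_algebra_GammaD:
  assumes "M \<in> space (prob_algebra Gamma_borel)"
  shows "prob_space M" "sets M = sets Gamma_borel" "space M = Gamma"
proof -
  show 1: "prob_space M" "sets M = sets Gamma_borel" using assms by (auto simp: space_prob_algebra)
  show "space M = Gamma" using sets_eq_imp_space_eq[OF 1(2)] by (simp add: Gamma_borel_def space_restrict_space)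
qed

lemma continuous_measurable_Gamma:
  fixes f :: "real \<times> real \<Rightarrow> 'b::{second_countable_topology,real_normed_vector}"
  assumes M: "sets M = sets Gamma_borel" and f: "continuous_on UNIV f"
  shows "f \<in> borel_measurable M"
  unfolding measurable_cong_sets[OF M refl] Gamma_borel_def
  by (intro measurable_restrict_space1 borel_measurable_continuous_onI f)

lemma bounded_continuous_integrable_Gamma:
  fixes f :: "real \<times> real \<Rightarrow> 'b::{second_countable_topology,banach}"
  assumes M: "M \<in> space (prob_algebra Gamma_borel)" and f: "continuous_on UNIV f" and le: "\<And>P. norm (f P) \<le> C"
  shows "integrable M f"
proof -
  interpret prob_space M by (rule space_prob_algebra_GammaD(1)[OF M])
  show ?thesis
    using le by (intro integrable_const_bound[of _ C] continuous_measurable_Gamma[OF space_prob_algebra_GammaD(2)[OF M] f]) auto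
qed

definition wave :: "int \<Rightarrow> real \<Rightarrow> real \<times> real \<Rightarrow> complex" where
  "wave l \<xi> P = iexp (of_int l * fst P) * iexp (\<xi> * snd P)"

lemma wave_eq_cis: "wave l \<xi> P = cis (of_int l * fst P + \<xi> * snd P)"
  by (simp add: wave_def cis_conv_exp exp_add[symmetric] distrib_left)

lemma norm_wave [simp]: "norm (wave l \<xi> P) = 1"
  by (simp add: wave_eq_cis)

lemma wave_cont: "continuous_on S (wave l \<xi>)"
  unfolding wave_def[abs_def] by (intro continuous_intros)

lemma fourier_u_wave: "fourier_u \<rho> t l \<xi> = (LINT P|\<rho> t. wave l \<xi> P)"
  by (simp add: fourier_u_def wave_def case_prod_unfold)

definition cutoff_fourier :: "real \<Rightarrow> (real \<times> real) measure \<Rightarrow> int \<Rightarrow> real \<Rightarrow> complex" where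
  "cutoff_fourier R M l \<xi> = (LINT P|M. of_real (cutoff R (snd P)) * wave l \<xi> P)"

lemma cutoff_snd_cont: "continuous_on S (\<lambda>P. cutoff R (snd P))"
  by (rule continuous_on_compose2[OF cutoff_cont[of UNIV]]) (auto intro!: continuous_intros)

lemma cutoff_wave_cont: "continuous_on S (\<lambda>P. of_real (cutoff R (snd P)) * wave l \<xi> P :: complex)"
  by (intro continuous_on_mult continuous_on_of_real wave_cont cutoff_snd_cont)

lemma norm_cutoff_wave: "norm (of_real (cutoff R (snd P)) * wave l \<xi> P :: complex) \<le> 1"
  using cutoff_bounds[of R "snd P"] by (simp add: norm_mult)

lemma cutoff_wave_integrable:
  "M \<in> space (prob_algebra Gamma_borel) \<Longrightarrow> integrable M (\<lambda>P. of_real (cutoff R (snd P)) * wave l \<xi> P :: complex)"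
  by (rule bounded_continuous_integrable_Gamma[OF _ cutoff_wave_cont norm_cutoff_wave])

lemma wave_integrable: "M \<in> space (prob_algebra Gamma_borel) \<Longrightarrow> integrable M (wave l \<xi>)"
  by (rule bounded_continuous_integrable_Gamma[OF _ wave_cont, where C = 1]) auto

lemma norm_integral_le_1:
  fixes f :: "real \<times> real \<Rightarrow> complex"
  assumes M: "M \<in> space (prob_algebra Gamma_borel)" and le: "\<And>P. norm (f P) \<le> 1"
  shows "norm (LINT P|M. f P) \<le> 1"
proof (cases "integrable M f")
  case True
  interpret prob_space M by (rule space_prob_algebra_GammaD(1)[OF M])
  have "norm (LINT P|M. f P) \<le> (LINT P|M. norm (f P))" by (rule integral_norm_bound)
  also have "\<dots> \<le> (LINT P|M. 1)" using True le by (intro integral_mono) auto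
  finally show ?thesis by (simp add: prob_space)
qed (simp add: not_integrable_integral_eq)

lemma cutoff_fourier_zero: "cutoff_fourier R M 0 0 = of_real (LINT P|M. cutoff R (snd P))"
  by (simp add: cutoff_fourier_def wave_def)

text \<open>
  The error of the cut-off is bounded by the mass it removes, whatever the frequencies are.
\<close>
lemma cutoff_fourier_error:
  assumes M: "M \<in> space (prob_algebra Gamma_borel)"
  shows "norm ((LINT P|M. wave l \<xi> P) - cutoff_fourier R M l \<xi>) \<le> 1 - Re (cutoff_fourier R M 0 0)"
proof -
  interpret prob_space M by (rule space_prob_algebra_GammaD(1)[OF M])
  have int: "integrable M (\<lambda>P. cutoff R (snd P))"
    by (rule bounded_continuous_integrable_Gamma[OF M cutoff_snd_cont, where C = 1]) (simp add: cutoff_bounds)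
  have "(LINT P|M. wave l \<xi> P) - cutoff_fourier R M l \<xi> = (LINT P|M. of_real (1 - cutoff R (snd P)) * wave l \<xi> P)"
    using Bochner_Integration.integral_diff[OF wave_integrable[OF M] cutoff_wave_integrable[OF M], of l \<xi> R l \<xi>]
    by (simp only: cutoff_fourier_def of_real_diff left_diff_distrib of_real_1 mult_1)
  also have "norm \<dots> \<le> (LINT P|M. norm (of_real (1 - cutoff R (snd P)) * wave l \<xi> P :: complex))" by (rule integral_norm_bound)
  also have "\<dots> = (LINT P|M. 1 - cutoff R (snd P))"
  proof (rule Bochner_Integration.integral_cong[OF refl])
    fix P
    show "norm (of_real (1 - cutoff R (snd P)) * wave l \<xi> P :: complex) = 1 - cutoff R (snd P)"
      using cutoff_bounds[of R "snd P"] unfolding norm_mult norm_wave norm_of_real by simp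
  qed
  also have "\<dots> = 1 - (LINT P|M. cutoff R (snd P))" using int by (simp add: prob_space)
  finally show ?thesis by (simp add: cutoff_fourier_zero)
qed

lemma cutoff_fourier_tendsto:
  assumes M: "M \<in> space (prob_algebra Gamma_borel)"
  shows "(\<lambda>n. cutoff_fourier (real (Suc n)) M l \<xi>) \<longlonglongrightarrow> (LINT P|M. wave l \<xi> P)"
  unfolding cutoff_fourier_def
proof (rule integral_dominated_convergence[where w = "\<lambda>_. 1"])
  interpret prob_space M by (rule space_prob_algebra_GammaD(1)[OF M])
  show "integrable M (\<lambda>_. 1::real)" by simp
  show "wave l \<xi> \<in> borel_measurable M" "(\<lambda>P. of_real (cutoff (real (Suc n)) (snd P)) * wave l \<xi> P) \<in> borel_measurable M" for n
    by (rule borel_measurable_integrable, rule wave_integrable cutoff_wave_integrable, rule M)+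
  show "AE P in M. (\<lambda>n. of_real (cutoff (real (Suc n)) (snd P)) * wave l \<xi> P) \<longlonglongrightarrow> wave l \<xi> P"
  proof (rule AE_I2)
    fix P
    show "(\<lambda>n. of_real (cutoff (real (Suc n)) (snd P)) * wave l \<xi> P) \<longlonglongrightarrow> wave l \<xi> P"
      using tendsto_mult[OF tendsto_of_real[OF cutoff_tendsto_1[of "snd P"]] tendsto_const[of "wave l \<xi> P"]]
      by (simp only: of_real_1 mult_1)
  qed
qed (use norm_cutoff_wave in auto)

lemma norm_wave_diff: "norm (wave l \<xi> P - wave l \<xi>' P) \<le> \<bar>\<xi> - \<xi>'\<bar> * \<bar>snd P\<bar>"
proof -
  have "wave l \<xi> P - wave l \<xi>' P = wave l \<xi>' P * (iexp ((\<xi> - \<xi>') * snd P) - 1)"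
    unfolding wave_eq_cis cis_conv_exp[symmetric]
    by (simp add: algebra_simps cis_mult)
  then have "norm (wave l \<xi> P - wave l \<xi>' P) = norm (iexp ((\<xi> - \<xi>') * snd P) - 1)" by (simp add: norm_mult)
  also have "\<dots> \<le> \<bar>(\<xi> - \<xi>') * snd P\<bar>" using iexp_approx1[of "(\<xi> - \<xi>') * snd P" 0] by simp
  finally show ?thesis by (simp add: abs_mult)
qed

text \<open>
  On the support of the cut-off the velocities are at most \<open>R\<close>, whence a Lipschitz bound in \<open>\<xi>\<close> that does not depend
  on the measure.
\<close>
lemma cutoff_fourier_Lipschitz:
  assumes M: "M \<in> space (prob_algebra Gamma_borel)" and R: "0 < R"
  shows "norm (cutoff_fourier R M l \<xi> - cutoff_fourier R M l \<xi>') \<le> R * \<bar>\<xi> - \<xi>'\<bar>"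
proof -
  interpret prob_space M by (rule space_prob_algebra_GammaD(1)[OF M])
  let ?d = "\<lambda>P. of_real (cutoff R (snd P)) * wave l \<xi> P - of_real (cutoff R (snd P)) * wave l \<xi>' P :: complex"
  have int: "integrable M ?d" by (intro Bochner_Integration.integrable_diff cutoff_wave_integrable M)
  have "cutoff_fourier R M l \<xi> - cutoff_fourier R M l \<xi>' = (LINT P|M. ?d P)"
    unfolding cutoff_fourier_def by (intro Bochner_Integration.integral_diff[symmetric] cutoff_wave_integrable M)
  also have "norm \<dots> \<le> (LINT P|M. norm (?d P))" by (rule integral_norm_bound)
  also have "\<dots> \<le> (LINT P|M. R * \<bar>\<xi> - \<xi>'\<bar>)"
  proof (rule integral_mono)
    fix P
    have "norm (?d P) = cutoff R (snd P) * norm (wave l \<xi> P - wave l \<xi>' P)"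
      using cutoff_bounds[of R "snd P"] by (simp add: right_diff_distrib[symmetric] norm_mult)
    also have "\<dots> \<le> cutoff R (snd P) * (\<bar>\<xi> - \<xi>'\<bar> * \<bar>snd P\<bar>)"
      by (intro mult_left_mono norm_wave_diff cutoff_bounds)
    also have "\<dots> \<le> R * \<bar>\<xi> - \<xi>'\<bar>"
    proof (cases "\<bar>snd P\<bar> \<le> R")
      case True
      have "cutoff R (snd P) * (\<bar>\<xi> - \<xi>'\<bar> * \<bar>snd P\<bar>) \<le> 1 * (\<bar>\<xi> - \<xi>'\<bar> * R)"
        using True cutoff_bounds[of R "snd P"] by (intro mult_mono) auto
      then show ?thesis by (simp add: mult.commute)
    qed (use R cutoff_eq_0[of R "snd P"] in auto)
    finally show "norm (?d P) \<le> R * \<bar>\<xi> - \<xi>'\<bar>" .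
  qed (use int in auto)
  finally show ?thesis by (simp add: prob_space)
qed

section \<open>Fourier modes of a weak solution\<close>

lemma Re_rotated_wave: "Re (cis a * (of_real k * wave l \<xi> P)) = k * cos (of_int l * fst P + \<xi> * snd P + a)"
proof -
  have eq: "cis a * (of_real k * wave l \<xi> P) = of_real k * cis (of_int l * fst P + \<xi> * snd P + a)"
    by (simp add: wave_eq_cis cis_mult add.commute)
  show ?thesis unfolding eq by simp
qed

lemma Im_rotated_wave: "Im (cis a * (of_real k * wave l \<xi> P)) = k * sin (of_int l * fst P + \<xi> * snd P + a)"
proof -
  have eq: "cis a * (of_real k * wave l \<xi> P) = of_real k * cis (of_int l * fst P + \<xi> * snd P + a)"
    by (simp add: wave_eq_cis cis_mult add.commute)
  show ?thesis unfolding eq by simp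
qed

lemma velocity_eq: "velocity K \<rho> t \<theta> \<omega> = \<omega> + K * Im (order_parameter \<rho> t * cis (- \<theta>))"
proof -
  let ?z = "order_parameter \<rho> t * cis (- \<theta>)"
  have iexp_cis: "iexp x = cis x" for x :: real by (simp only: cis_conv_exp)
  have "order_parameter \<rho> t * iexp (- \<theta>) - cnj (order_parameter \<rho> t) * iexp \<theta> = ?z - cnj ?z"
    unfolding iexp_cis by (simp add: cis_cnj)
  also have "\<dots> = 2 * \<i> * of_real (Im ?z)" by (simp add: complex_eq_iff)
  finally show ?thesis by (simp add: velocity_def)
qed

text \<open>
  Multiplication by \<open>cis (\<plusminus> \<theta>)\<close> shifts the mode, so the coupling part \<open>K Im (\<eta> cis (- \<theta>))\<close> of the velocity
  times a \<open>\<theta>\<close>-derivative of a wave is a combination of the two neighbouring waves. The angle \<open>a\<close> is \<open>0\<close> for real parts and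
  \<open>- \<pi> / 2\<close> for imaginary parts, which lets one real test function serve both.
\<close>
lemma Re_rotated_mode_coupling:
  "Re (cis a * (of_real (K * of_int l / 2) *
     (\<eta> * (of_real k * wave (l - 1) \<xi> P) - cnj \<eta> * (of_real k * wave (l + 1) \<xi> P))))
   = - (K * Im (\<eta> * cis (- fst P))) * (k * (of_int l * sin (of_int l * fst P + \<xi> * snd P + a)))"
proof -
  let ?w = "cis a * (of_real k * wave l \<xi> P)" and ?z = "\<eta> * cis (- fst P)"
  have "wave (l - 1) \<xi> P = wave l \<xi> P * cis (- fst P)" "wave (l + 1) \<xi> P = wave l \<xi> P * cis (fst P)"
    by (simp_all add: wave_eq_cis cis_mult algebra_simps)
  then have "cis a * (of_real (K * of_int l / 2) *
     (\<eta> * (of_real k * wave (l - 1) \<xi> P) - cnj \<eta> * (of_real k * wave (l + 1) \<xi> P)))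
     = of_real (K * of_int l / 2) * (?w * (?z - cnj ?z))"
    by (simp add: algebra_simps cis_cnj)
  also have "?z - cnj ?z = 2 * \<i> * of_real (Im ?z)" by (simp add: complex_eq_iff)
  also have "of_real (K * of_int l / 2) * (?w * (2 * \<i> * of_real (Im ?z))) = of_real (K * of_int l * Im ?z) * (\<i> * ?w)"
    by simp
  also have "Re (of_real (K * of_int l * Im ?z) * (\<i> * ?w)) = - (K * of_int l * Im ?z) * Im ?w"
  proof -
    have "Re (of_real r * (\<i> * z)) = - r * Im z" for r :: real and z by simp
    then show ?thesis .
  qed
  also have "\<dots> = - (K * Im ?z) * (k * (of_int l * sin (of_int l * fst P + \<xi> * snd P + a)))"
  proof -
    have "- (K * L * I) * (k * s) = - (K * I) * (k * (L * s))" for L I s :: real by simp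
    then show ?thesis unfolding Im_rotated_wave .
  qed
  finally show ?thesis .
qed

locale kuramoto_flow =
  fixes K :: real and \<rho>in :: "(real \<times> real) measure" and \<rho> :: "real \<Rightarrow> (real \<times> real) measure"
  assumes solution: "kuramoto_solution K \<rho>in \<rho>"
begin

lemma \<rho>in_space: "\<rho>in \<in> space (prob_algebra Gamma_borel)"
  and \<rho>_space: "0 \<le> t \<Longrightarrow> \<rho> t \<in> space (prob_algebra Gamma_borel)"
  and weakly_continuous: "bounded_continuous_Gamma f \<Longrightarrow> continuous_on {0..} (\<lambda>t. LINT P|\<rho> t. f P)"
  and weak_form: "test_function h ht h\<theta> h\<omega> \<Longrightarrow>
        0 = (LINT (\<theta>, \<omega>)|\<rho>in. h 0 \<theta> \<omega>) +
            (LINT t:{0..}|lborel.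
               (LINT (\<theta>, \<omega>)|\<rho> t. velocity K \<rho> t \<theta> \<omega> * h\<theta> t \<theta> \<omega> + ht t \<theta> \<omega>))"
  using solution unfolding kuramoto_solution_def by blast+

lemma complex_weakly_continuous:
  fixes f :: "real \<times> real \<Rightarrow> complex"
  assumes f: "continuous_on UNIV f" and le: "\<And>P. norm (f P) \<le> C"
    and per: "\<And>\<theta> \<omega>. f (\<theta> + 2 * pi, \<omega>) = f (\<theta>, \<omega>)"
  shows "continuous_on {0..} (\<lambda>t. LINT P|\<rho> t. f P)"
proof -
  have "bounded_continuous_Gamma (\<lambda>P. Re (f P))" "bounded_continuous_Gamma (\<lambda>P. Im (f P))"
    unfolding bounded_continuous_Gamma_def
    using f per order.trans[OF abs_Re_le_cmod le] order.trans[OF abs_Im_le_cmod le]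
    by (auto intro!: continuous_intros boundedI[of _ C])
  then have c: "continuous_on {0..} (\<lambda>t. Complex (LINT P|\<rho> t. Re (f P)) (LINT P|\<rho> t. Im (f P)))"
    by (intro continuous_intros weakly_continuous)
  show ?thesis
  proof (rule continuous_on_eq[OF c])
    fix t :: real assume "t \<in> {0..}"
    then have "integrable (\<rho> t) f" using \<rho>_space f le by (intro bounded_continuous_integrable_Gamma) auto
    then show "Complex (LINT P|\<rho> t. Re (f P)) (LINT P|\<rho> t. Im (f P)) = (LINT P|\<rho> t. f P)"
      by (simp add: complex_eq_iff)
  qed
qed

lemma wave_periodic: "wave l \<xi> (\<theta> + 2 * pi, \<omega>) = wave l \<xi> (\<theta>, \<omega>)"
proof -
  have "wave l \<xi> (\<theta> + 2 * pi, \<omega>) = wave l \<xi> (\<theta>, \<omega>) * cis (2 * pi * of_int l)"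
    by (simp add: wave_eq_cis cis_mult algebra_simps)
  then show ?thesis by (simp add: cis_multiple_2pi)
qed

abbreviation cut_u :: "real \<Rightarrow> real \<Rightarrow> int \<Rightarrow> real \<Rightarrow> complex" where
  "cut_u R t l \<xi> \<equiv> cutoff_fourier R (\<rho> t) l \<xi>"

lemma order_parameter_wave: "order_parameter \<rho> t = (LINT P|\<rho> t. wave 1 0 P)"
  by (simp add: order_parameter_def wave_def case_prod_unfold)

lemma order_parameter_cont: "continuous_on {0..} (order_parameter \<rho>)"
  unfolding order_parameter_wave[abs_def]
  by (rule complex_weakly_continuous[OF wave_cont, where C = 1]) (simp_all add: wave_periodic)

text \<open>
  Weak continuity gives continuity in time for fixed \<open>\<xi>\<close>; the Lipschitz bound, uniform in time, makes it joint.
\<close>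
lemma cut_u_cont:
  assumes R: "0 < R"
  shows "continuous_on ({0..} \<times> UNIV) (\<lambda>p. cut_u R (fst p) l (snd p))"
proof -
  have "((\<lambda>p. cut_u R (fst p) l (snd p)) \<longlongrightarrow> cut_u R (fst q) l (snd q)) (at q within {0..} \<times> UNIV)"
    if q: "q \<in> {0..} \<times> UNIV" for q
  proof -
    let ?F = "at q within {0..} \<times> UNIV"
    have "continuous_on {0..} (\<lambda>t. cut_u R t l (snd q))"
      unfolding cutoff_fourier_def
      by (rule complex_weakly_continuous[OF cutoff_wave_cont norm_cutoff_wave]) (simp add: wave_periodic)
    then have "continuous_on ({0..} \<times> UNIV) (\<lambda>p::real \<times> real. cut_u R (fst p) l (snd q))"
      by (rule continuous_on_compose2) (auto intro!: continuous_intros)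
    then have 1: "((\<lambda>p. cut_u R (fst p) l (snd q)) \<longlongrightarrow> cut_u R (fst q) l (snd q)) ?F"
      using q by (auto simp: continuous_on_def)
    have 2: "((\<lambda>p. cut_u R (fst p) l (snd p) - cut_u R (fst p) l (snd q)) \<longlongrightarrow> 0) ?F"
    proof (rule Lim_null_comparison)
      show "\<forall>\<^sub>F p in ?F. norm (cut_u R (fst p) l (snd p) - cut_u R (fst p) l (snd q)) \<le> R * \<bar>snd p - snd q\<bar>"
        unfolding eventually_at_topological
        by (intro exI[of _ UNIV]) (auto intro!: cutoff_fourier_Lipschitz[OF \<rho>_space R])
      have "((\<lambda>p. R * \<bar>snd p - snd q\<bar>) \<longlongrightarrow> R * \<bar>snd q - snd q\<bar>) ?F" by (intro tendsto_intros)
      then show "((\<lambda>p. R * \<bar>snd p - snd q\<bar>) \<longlongrightarrow> 0) ?F" by simp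
    qed
    show ?thesis using tendsto_add[OF 2 1] by simp
  qed
  then show ?thesis by (simp add: continuous_on_def)
qed

lemma cut_u_cont_line:
  assumes "0 < R"
  shows "continuous_on {0..} (\<lambda>t. cut_u R t j (\<zeta> - b * t))"
  by (rule continuous_on_compose2[OF cut_u_cont[OF assms], of _ "\<lambda>t. (t, \<zeta> - b * t)", simplified])
    (auto intro!: continuous_intros)

definition cut_coupling :: "real \<Rightarrow> real \<Rightarrow> int \<Rightarrow> real \<Rightarrow> complex" where
  "cut_coupling R t l \<xi> = of_real (K * of_int l / 2) *
     (order_parameter \<rho> t * cut_u R t (l - 1) \<xi> - cnj (order_parameter \<rho> t) * cut_u R t (l + 1) \<xi>)"

text \<open>
  The test function is \<open>\<sigma>(t)\<close> times the cut-off in \<open>\<omega>\<close> times the wave whose frequency moves along the characteristic,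
  \<open>cos (l \<theta> + (\<zeta> - l t) \<omega> + a)\<close>. The term \<open>\<omega> \<partial>\<^sub>\<theta> h\<close> then cancels against the time derivative of the frequency, and
  only the bounded coupling term remains.
\<close>
lemma cut_mode_weak_equation:
  fixes \<sigma> \<sigma>' :: "real \<Rightarrow> real" and T :: real
  assumes R: "0 < R"
    and \<sigma>: "\<And>s. 0 \<le> s \<Longrightarrow> (\<sigma> has_real_derivative \<sigma>' s) (at s within {0..})"
    and \<sigma>'_cont: "continuous_on {0..} \<sigma>'" and \<sigma>_supp: "\<And>s. T < s \<Longrightarrow> \<sigma> s = 0"
  shows "0 = \<sigma> 0 * Re (cis a * cutoff_fourier R \<rho>in l \<zeta>)
    + (LINT s:{0..}|lborel. \<sigma>' s * Re (cis a * cut_u R s l (\<zeta> - of_int l * s))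
        + \<sigma> s * Re (cis a * cut_coupling R s l (\<zeta> - of_int l * s)))"
proof -
  have \<sigma>_cont: "continuous_on {0..} \<sigma>"
    using \<sigma> by (auto simp: continuous_on_eq_continuous_within intro: DERIV_continuous)
  define ph where "ph t \<theta> \<omega> = of_int l * \<theta> + (\<zeta> - of_int l * t) * \<omega> + a" for t \<theta> \<omega>
  define h where "h t \<theta> \<omega> = \<sigma> t * cutoff R \<omega> * cos (ph t \<theta> \<omega>)" for t \<theta> \<omega>
  define ht where "ht t \<theta> \<omega> = \<sigma>' t * cutoff R \<omega> * cos (ph t \<theta> \<omega>)
    + \<sigma> t * cutoff R \<omega> * (of_int l * \<omega> * sin (ph t \<theta> \<omega>))" for t \<theta> \<omega>
  define h\<theta> where "h\<theta> t \<theta> \<omega> = - (\<sigma> t * cutoff R \<omega> * (of_int l * sin (ph t \<theta> \<omega>)))" for t \<theta> \<omega>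
  define h\<omega> where "h\<omega> t \<theta> \<omega> = \<sigma> t * (cutoff' R \<omega> * cos (ph t \<theta> \<omega>)
    - cutoff R \<omega> * ((\<zeta> - of_int l * t) * sin (ph t \<theta> \<omega>)))" for t \<theta> \<omega>
  have "test_function h ht h\<theta> h\<omega>"
    unfolding test_function_def
  proof (intro conjI allI impI)
    fix t \<theta> \<omega> :: real assume t: "0 \<le> t"
    have "((\<lambda>s. cos (ph s \<theta> \<omega>)) has_real_derivative of_int l * \<omega> * sin (ph t \<theta> \<omega>)) (at t within {0..})"
      unfolding ph_def by (auto intro!: derivative_eq_intros simp: algebra_simps)
    from DERIV_mult[OF DERIV_cmult_right[OF \<sigma>[OF t], of "cutoff R \<omega>"] this]
    show "((\<lambda>s. h s \<theta> \<omega>) has_real_derivative ht t \<theta> \<omega>) (at t within {0..})"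
      unfolding h_def ht_def by (simp add: algebra_simps)
    show "((\<lambda>x. h t x \<omega>) has_real_derivative h\<theta> t \<theta> \<omega>) (at \<theta>)"
      unfolding h_def h\<theta>_def ph_def by (auto intro!: derivative_eq_intros simp: algebra_simps)
    have "((\<lambda>y. cos (ph t \<theta> y)) has_real_derivative - ((\<zeta> - of_int l * t) * sin (ph t \<theta> \<omega>))) (at \<omega>)"
      unfolding ph_def by (auto intro!: derivative_eq_intros simp: algebra_simps)
    from DERIV_cmult[OF DERIV_mult[OF cutoff_deriv[OF R] this], of "\<sigma> t"]
    show "((\<lambda>y. h t \<theta> y) has_real_derivative h\<omega> t \<theta> \<omega>) (at \<omega>)"
      unfolding h_def h\<omega>_def by (simp add: algebra_simps)
    have "ph t (\<theta> + 2 * pi) \<omega> = ph t \<theta> \<omega> + of_int l * (2 * pi)" by (simp add: ph_def algebra_simps)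
    moreover have "cos (of_int l * (2 * pi)) = 1" "sin (of_int l * (2 * pi)) = 0"
      using cos_int_2pin[of l] sin_int_2pin[of l] by (simp_all only: mult.commute)
    ultimately have "cos (ph t (\<theta> + 2 * pi) \<omega>) = cos (ph t \<theta> \<omega>)"
      by (simp only: cos_add)
    then show "h t (\<theta> + 2 * pi) \<omega> = h t \<theta> \<omega>" by (simp add: h_def)
  next
    let ?D = "{0..} \<times> UNIV \<times> UNIV :: (real \<times> real \<times> real) set"
    have \<sigma>c: "continuous_on ?D (\<lambda>p. \<sigma> (fst p))" "continuous_on ?D (\<lambda>p. \<sigma>' (fst p))"
      by (rule continuous_on_compose2[OF \<sigma>_cont] continuous_on_compose2[OF \<sigma>'_cont]; auto intro!: continuous_intros)+
    have kc: "continuous_on ?D (\<lambda>p. cutoff R (snd (snd p)))" "continuous_on ?D (\<lambda>p. cutoff' R (snd (snd p)))"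
      by (rule continuous_on_compose2[OF cutoff_cont[of UNIV]] continuous_on_compose2[OF cutoff'_cont[of UNIV]]; auto intro!: continuous_intros)+
    have pc: "continuous_on ?D (\<lambda>p. ph (fst p) (fst (snd p)) (snd (snd p)))"
      unfolding ph_def by (intro continuous_intros)
    note [continuous_intros] = \<sigma>c kc pc
    have "continuous_on ?D (\<lambda>(t, \<theta>, \<omega>). h t \<theta> \<omega>)" "continuous_on ?D (\<lambda>(t, \<theta>, \<omega>). ht t \<theta> \<omega>)"
      "continuous_on ?D (\<lambda>(t, \<theta>, \<omega>). h\<theta> t \<theta> \<omega>)" "continuous_on ?D (\<lambda>(t, \<theta>, \<omega>). h\<omega> t \<theta> \<omega>)"
      unfolding h_def ht_def h\<theta>_def h\<omega>_def case_prod_unfold by (intro continuous_intros)+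
    then show "\<forall>f\<in>{h, ht, h\<theta>, h\<omega>}. continuous_on ?D (\<lambda>(t, \<theta>, \<omega>). f t \<theta> \<omega>)"
      by simp
    show "\<exists>R'. \<forall>t\<ge>0. \<forall>\<theta> \<omega>. R' < t \<or> R' < \<bar>\<omega>\<bar> \<longrightarrow> h t \<theta> \<omega> = 0"
      by (rule exI[of _ "max T R"]) (auto simp: h_def \<sigma>_supp cutoff_eq_0[OF R])
  qed
  from weak_form[OF this]
  have "0 = (LINT P|\<rho>in. h 0 (fst P) (snd P)) + (LINT t:{0..}|lborel.
     (LINT P|\<rho> t. velocity K \<rho> t (fst P) (snd P) * h\<theta> t (fst P) (snd P) + ht t (fst P) (snd P)))"
    by (simp add: case_prod_unfold)
  also have "(LINT P|\<rho>in. h 0 (fst P) (snd P)) = \<sigma> 0 * Re (cis a * cutoff_fourier R \<rho>in l \<zeta>)"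
  proof -
    have "(LINT P|\<rho>in. h 0 (fst P) (snd P)) = (LINT P|\<rho>in. \<sigma> 0 * Re (cis a * (of_real (cutoff R (snd P)) * wave l \<zeta> P)))"
      unfolding Re_rotated_wave by (simp add: h_def ph_def mult.assoc)
    also have "\<dots> = \<sigma> 0 * Re (LINT P|\<rho>in. cis a * (of_real (cutoff R (snd P)) * wave l \<zeta> P))"
    proof -
      have "integrable \<rho>in (\<lambda>P. cis a * (of_real (cutoff R (snd P)) * wave l \<zeta> P))"
        by (intro integrable_mult_right cutoff_wave_integrable \<rho>in_space)
      from integral_Re[OF this] show ?thesis by (simp only: integral_mult_right_zero)
    qed
    finally show ?thesis by (simp add: cutoff_fourier_def)
  qed
  also have "(LINT t:{0..}|lborel.
     (LINT P|\<rho> t. velocity K \<rho> t (fst P) (snd P) * h\<theta> t (fst P) (snd P) + ht t (fst P) (snd P)))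
     = (LINT s:{0..}|lborel. \<sigma>' s * Re (cis a * cut_u R s l (\<zeta> - of_int l * s))
        + \<sigma> s * Re (cis a * cut_coupling R s l (\<zeta> - of_int l * s)))"
  proof (rule set_lebesgue_integral_cong, simp, intro allI impI)
    fix t :: real assume "t \<in> {0..}"
    then have sp: "\<rho> t \<in> space (prob_algebra Gamma_borel)" by (simp add: \<rho>_space)
    let ?\<xi> = "\<zeta> - of_int l * t" and ?\<eta> = "order_parameter \<rho> t"
    let ?E = "\<lambda>j P. of_real (cutoff R (snd P)) * wave j ?\<xi> P :: complex"
    let ?A = "\<lambda>P. cis a * ?E l P"
    let ?C = "\<lambda>P. cis a * (of_real (K * of_int l / 2) * (?\<eta> * ?E (l - 1) P - cnj ?\<eta> * ?E (l + 1) P))"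
    have pt: "velocity K \<rho> t (fst P) (snd P) * h\<theta> t (fst P) (snd P) + ht t (fst P) (snd P)
       = \<sigma>' t * Re (?A P) + \<sigma> t * Re (?C P)" for P
      unfolding Re_rotated_wave Re_rotated_mode_coupling velocity_eq h\<theta>_def ht_def ph_def
      by (simp add: algebra_simps)
    have iE: "integrable (\<rho> t) (?E j)" for j by (rule cutoff_wave_integrable[OF sp])
    have iA: "integrable (\<rho> t) ?A" by (intro integrable_mult_right iE)
    have iC: "integrable (\<rho> t) ?C"
      by (intro integrable_mult_right Bochner_Integration.integrable_diff iE)
    have "(LINT P|\<rho> t. velocity K \<rho> t (fst P) (snd P) * h\<theta> t (fst P) (snd P) + ht t (fst P) (snd P))
      = \<sigma>' t * (LINT P|\<rho> t. Re (?A P)) + \<sigma> t * (LINT P|\<rho> t. Re (?C P))"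
      unfolding pt Bochner_Integration.integral_add[OF integrable_mult_right[OF integrable_Re[OF iA], of "\<sigma>' t"]
          integrable_mult_right[OF integrable_Re[OF iC], of "\<sigma> t"]] integral_mult_right_zero ..
    also have "\<dots> = \<sigma>' t * Re (LINT P|\<rho> t. ?A P) + \<sigma> t * Re (LINT P|\<rho> t. ?C P)"
      by (simp only: integral_Re[OF iA] integral_Re[OF iC])
    also have "(LINT P|\<rho> t. ?A P) = cis a * cut_u R t l ?\<xi>"
      by (simp add: cutoff_fourier_def)
    also have "(LINT P|\<rho> t. ?C P) = cis a * cut_coupling R t l ?\<xi>"
    proof -
      have "(LINT P|\<rho> t. ?\<eta> * ?E (l - 1) P - cnj ?\<eta> * ?E (l + 1) P)
          = ?\<eta> * (LINT P|\<rho> t. ?E (l - 1) P) - cnj ?\<eta> * (LINT P|\<rho> t. ?E (l + 1) P)"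
        by (subst Bochner_Integration.integral_diff) (auto intro!: integrable_mult_right iE)
      then show ?thesis
        by (simp only: integral_mult_right_zero cut_coupling_def cutoff_fourier_def)
    qed
    finally show "(LINT P|\<rho> t. velocity K \<rho> t (fst P) (snd P) * h\<theta> t (fst P) (snd P) + ht t (fst P) (snd P))
       = \<sigma>' t * Re (cis a * cut_u R t l ?\<xi>) + \<sigma> t * Re (cis a * cut_coupling R t l ?\<xi>)" .
  qed
  finally show ?thesis .
qed

lemma cut_coupling_cont_line:
  assumes "0 < R"
  shows "continuous_on {0..} (\<lambda>t. cut_coupling R t l (\<zeta> - b * t))"
  unfolding cut_coupling_def by (intro continuous_intros order_parameter_cont cut_u_cont_line assms)

lemma cut_mode_equation:
  assumes R: "0 < R" and t: "0 \<le> t"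
  shows "Re (cis a * cut_u R t l (\<zeta> - of_int l * t)) = Re (cis a * cutoff_fourier R \<rho>in l \<zeta>)
    + integral {0..t} (\<lambda>s. Re (cis a * cut_coupling R s l (\<zeta> - of_int l * s)))"
proof (rule du_Bois_Reymond_evolution[OF _ _ _ t])
  show "continuous_on {0..} (\<lambda>s. Re (cis a * cut_u R s l (\<zeta> - of_int l * s)))"
    by (intro continuous_intros cut_u_cont_line R)
  show "continuous_on {0..} (\<lambda>s. Re (cis a * cut_coupling R s l (\<zeta> - of_int l * s)))"
    by (intro continuous_intros cut_coupling_cont_line R)
qed (rule cut_mode_weak_equation[OF R])

text \<open>
  For \<open>l = 0\<close> there is no coupling, even with the cut-off. This controls the mass at large velocities at all times by
  that of the initial measure.
\<close>
lemma cutoff_mass_conserved: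
  assumes "0 < R" "0 \<le> t"
  shows "Re (cut_u R t 0 0) = Re (cutoff_fourier R \<rho>in 0 0)"
  using cut_mode_equation[OF assms, of 0 0 0] by (simp add: cut_coupling_def)

definition tail_mass :: "nat \<Rightarrow> real" where
  "tail_mass n = 1 - Re (cutoff_fourier (real (Suc n)) \<rho>in 0 0)"

lemma tail_mass_tendsto_0: "tail_mass \<longlonglongrightarrow> 0"
proof -
  interpret prob_space \<rho>in by (rule space_prob_algebra_GammaD(1)[OF \<rho>in_space])
  have "(\<lambda>n. Re (cutoff_fourier (real (Suc n)) \<rho>in 0 0)) \<longlonglongrightarrow> Re (LINT P|\<rho>in. wave 0 0 P)"
    by (intro tendsto_Re cutoff_fourier_tendsto \<rho>in_space)
  moreover have "(LINT P|\<rho>in. wave 0 0 P) = 1" by (simp add: wave_def prob_space)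
  ultimately show ?thesis
    unfolding tail_mass_def[abs_def] using tendsto_diff[OF tendsto_const[of 1]] by fastforce
qed

lemma cut_u_error:
  assumes "0 \<le> t"
  shows "norm (fourier_u \<rho> t l \<xi> - cut_u (real (Suc n)) t l \<xi>) \<le> tail_mass n"
  using cutoff_fourier_error[OF \<rho>_space[OF assms], of l \<xi> "real (Suc n)"]
    cutoff_mass_conserved[of "real (Suc n)" t] assms
  by (simp add: fourier_u_wave tail_mass_def del: of_nat_Suc)

lemma norm_fourier_u_le: "0 \<le> t \<Longrightarrow> norm (fourier_u \<rho> t l \<xi>) \<le> 1"
  unfolding fourier_u_wave by (rule norm_integral_le_1[OF \<rho>_space]) auto

lemma fourier_u_cont: "continuous_on ({0..} \<times> UNIV) (\<lambda>p. fourier_u \<rho> (fst p) l (snd p))"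
proof (rule uniform_limit_theorem[where F = sequentially])
  show "\<forall>\<^sub>F n in sequentially. continuous_on ({0..} \<times> UNIV) (\<lambda>p. cut_u (real (Suc n)) (fst p) l (snd p))"
    by (intro always_eventually allI cut_u_cont) simp
  show "uniform_limit ({0..} \<times> UNIV) (\<lambda>n p. cut_u (real (Suc n)) (fst p) l (snd p))
      (\<lambda>p. fourier_u \<rho> (fst p) l (snd p)) sequentially"
  proof (rule uniform_limitI)
    fix e :: real assume "0 < e"
    with tail_mass_tendsto_0 have "\<forall>\<^sub>F n in sequentially. tail_mass n < e" by (rule order_tendstoD)
    then show "\<forall>\<^sub>F n in sequentially. \<forall>p\<in>{0..} \<times> UNIV.
        dist (cut_u (real (Suc n)) (fst p) l (snd p)) (fourier_u \<rho> (fst p) l (snd p)) < e"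
    proof eventually_elim
      case (elim n)
      show ?case
      proof
        fix p :: "real \<times> real" assume p: "p \<in> {0..} \<times> UNIV"
        have "norm (fourier_u \<rho> (fst p) l (snd p) - cut_u (real (Suc n)) (fst p) l (snd p)) \<le> tail_mass n"
          using p by (intro cut_u_error) auto
        then show "dist (cut_u (real (Suc n)) (fst p) l (snd p)) (fourier_u \<rho> (fst p) l (snd p)) < e"
          using elim by (simp add: dist_norm norm_minus_commute)
      qed
    qed
  qed
qed simp

definition coupling :: "real \<Rightarrow> int \<Rightarrow> real \<Rightarrow> complex" where
  "coupling t l \<xi> = of_real (K * of_int l / 2) *
     (order_parameter \<rho> t * fourier_u \<rho> t (l - 1) \<xi> - cnj (order_parameter \<rho> t) * fourier_u \<rho> t (l + 1) \<xi>)"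

lemma order_parameter_eq: "order_parameter \<rho> t = fourier_u \<rho> t 1 0"
  by (simp add: order_parameter_wave fourier_u_wave)

lemma coupling_error:
  assumes t: "0 \<le> t"
  shows "norm (coupling t l \<xi> - cut_coupling (real (Suc n)) t l \<xi>) \<le> \<bar>K * of_int l\<bar> * tail_mass n"
proof -
  let ?\<eta> = "order_parameter \<rho> t"
  let ?d = "\<lambda>j. fourier_u \<rho> t j \<xi> - cut_u (real (Suc n)) t j \<xi>"
  have \<eta>: "norm ?\<eta> \<le> 1" unfolding order_parameter_eq by (rule norm_fourier_u_le[OF t])
  have "norm (?\<eta> * ?d (l - 1) - cnj ?\<eta> * ?d (l + 1)) \<le> norm ?\<eta> * norm (?d (l - 1)) + norm ?\<eta> * norm (?d (l + 1))"
    using norm_triangle_ineq4[of "?\<eta> * ?d (l - 1)" "cnj ?\<eta> * ?d (l + 1)"] by (simp add: norm_mult)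
  also have "\<dots> \<le> 1 * tail_mass n + 1 * tail_mass n"
    by (intro add_mono mult_mono \<eta> cut_u_error t) auto
  finally have b: "norm (?\<eta> * ?d (l - 1) - cnj ?\<eta> * ?d (l + 1)) \<le> 2 * tail_mass n" by simp
  have "coupling t l \<xi> - cut_coupling (real (Suc n)) t l \<xi>
      = of_real (K * of_int l / 2) * (?\<eta> * ?d (l - 1) - cnj ?\<eta> * ?d (l + 1))"
    by (simp add: coupling_def cut_coupling_def algebra_simps)
  also have "norm \<dots> \<le> \<bar>K * of_int l / 2\<bar> * (2 * tail_mass n)"
    unfolding norm_mult norm_of_real by (intro mult_left_mono b) simp
  finally show ?thesis by simp
qed

lemma fourier_u_cont_line: "continuous_on {0..} (\<lambda>t. fourier_u \<rho> t j (\<zeta> - b * t))"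
  by (rule continuous_on_compose2[OF fourier_u_cont, of _ "\<lambda>t. (t, \<zeta> - b * t)", simplified])
    (auto intro!: continuous_intros)

lemma coupling_cont_line: "continuous_on {0..} (\<lambda>t. coupling t l (\<zeta> - b * t))"
  unfolding coupling_def by (intro continuous_intros order_parameter_cont fourier_u_cont_line)

text \<open>
  The cut-off is removed in the integral equation by uniform convergence.
\<close>
lemma mode_integral_equation:
  assumes t: "0 \<le> t"
  shows "Re (cis a * fourier_u \<rho> t l (\<zeta> - of_int l * t)) = Re (cis a * (LINT P|\<rho>in. wave l \<zeta> P))
    + integral {0..t} (\<lambda>s. Re (cis a * coupling s l (\<zeta> - of_int l * s)))"
proof -
  let ?f = "\<lambda>n s. Re (cis a * cut_coupling (real (Suc n)) s l (\<zeta> - of_int l * s))"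
  let ?g = "\<lambda>s. Re (cis a * coupling s l (\<zeta> - of_int l * s))"
  have u: "uniform_limit {0..t} ?f ?g sequentially"
  proof (rule uniform_limitI)
    fix e :: real assume e: "0 < e"
    have "(\<lambda>n. \<bar>K * of_int l\<bar> * tail_mass n) \<longlonglongrightarrow> 0" by (rule tendsto_mult_right_zero[OF tail_mass_tendsto_0])
    then have "\<forall>\<^sub>F n in sequentially. \<bar>K * of_int l\<bar> * tail_mass n < e" using e by (rule order_tendstoD)
    then show "\<forall>\<^sub>F n in sequentially. \<forall>s\<in>{0..t}. dist (?f n s) (?g s) < e"
    proof eventually_elim
      case (elim n)
      show ?case
      proof
        fix s assume s: "s \<in> {0..t}"
        let ?\<xi> = "\<zeta> - of_int l * s"
        have "dist (?f n s) (?g s) = \<bar>Re (cis a * (coupling s l ?\<xi> - cut_coupling (real (Suc n)) s l ?\<xi>))\<bar>"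
          by (simp only: dist_norm real_norm_def right_diff_distrib minus_complex.simps abs_minus_commute)
        also have "\<dots> \<le> norm (cis a * (coupling s l ?\<xi> - cut_coupling (real (Suc n)) s l ?\<xi>))" by (rule abs_Re_le_cmod)
        also have "\<dots> \<le> \<bar>K * of_int l\<bar> * tail_mass n"
          unfolding norm_mult norm_cis using coupling_error[of s l ?\<xi> n] s by simp
        finally show "dist (?f n s) (?g s) < e" using elim by simp
      qed
    qed
  qed
  have fc: "continuous_on {0..t} (?f n)" for n
    by (intro continuous_intros continuous_on_subset[OF cut_coupling_cont_line]) auto
  obtain I J where I: "\<And>n. (?f n has_integral I n) {0..t}" and J: "(?g has_integral J) {0..t}" and IJ: "I \<longlonglongrightarrow> J"
    using uniform_limit_integral[OF u fc sequentially_bot] by blast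
  have lhs: "(\<lambda>n. Re (cis a * cut_u (real (Suc n)) t l (\<zeta> - of_int l * t))) \<longlonglongrightarrow> Re (cis a * fourier_u \<rho> t l (\<zeta> - of_int l * t))"
    unfolding fourier_u_wave by (intro tendsto_Re tendsto_mult tendsto_const cutoff_fourier_tendsto \<rho>_space t)
  have "(\<lambda>n. Re (cis a * cutoff_fourier (real (Suc n)) \<rho>in l \<zeta>) + I n) \<longlonglongrightarrow> Re (cis a * (LINT P|\<rho>in. wave l \<zeta> P)) + J"
    by (intro tendsto_add tendsto_Re tendsto_mult tendsto_const cutoff_fourier_tendsto \<rho>in_space IJ)
  moreover have "Re (cis a * cutoff_fourier (real (Suc n)) \<rho>in l \<zeta>) + I n
      = Re (cis a * cut_u (real (Suc n)) t l (\<zeta> - of_int l * t))" for n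
    using cut_mode_equation[of "real (Suc n)" t a l \<zeta>] t integral_unique[OF I[of n]] by simp
  ultimately have "(\<lambda>n. Re (cis a * cut_u (real (Suc n)) t l (\<zeta> - of_int l * t))) \<longlonglongrightarrow> Re (cis a * (LINT P|\<rho>in. wave l \<zeta> P)) + J"
    by simp
  from LIMSEQ_unique[OF lhs this] show ?thesis using integral_unique[OF J] by simp
qed

text \<open>
  The initial measure enters the weak formulation only through the boundary term; the equation at time \<open>0\<close> identifies
  it with the solution there.
\<close>
lemma fourier_u_0: "fourier_u \<rho> 0 l \<xi> = (LINT P|\<rho>in. wave l \<xi> P)"
  using mode_integral_equation[of 0 0 l \<xi>] mode_integral_equation[of 0 "- (pi / 2)" l \<xi>]
  by (simp add: complex_eq_iff cis.ctr)

lemma zero_mode_conserved: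
  assumes t: "0 \<le> t"
  shows "fourier_u \<rho> t 0 \<xi> = (LINT P|\<rho>in. wave 0 \<xi> P)"
  using mode_integral_equation[OF t, of 0 0 \<xi>] mode_integral_equation[OF t, of "- (pi / 2)" 0 \<xi>]
  by (simp add: complex_eq_iff cis.ctr coupling_def)

lemma mode_equation:
  assumes t: "0 \<le> t"
  shows "((\<lambda>s. fourier_u \<rho> s l (\<zeta> - of_int l * s)) has_vector_derivative coupling t l (\<zeta> - of_int l * t)) (at t within {0..})"
proof -
  have d: "((\<lambda>s. Re (cis a * fourier_u \<rho> s l (\<zeta> - of_int l * s))) has_real_derivative
      Re (cis a * coupling t l (\<zeta> - of_int l * t))) (at t within {0..})" for a
  proof (rule has_field_derivative_transform_within[where d = 1])
    have "continuous_on {0..} (\<lambda>s. Re (cis a * coupling s l (\<zeta> - of_int l * s)))"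
      by (intro continuous_intros coupling_cont_line)
    from integral_from_0_has_derivative[OF this t]
    show "((\<lambda>t. Re (cis a * (LINT P|\<rho>in. wave l \<zeta> P)) + integral {0..t} (\<lambda>s. Re (cis a * coupling s l (\<zeta> - of_int l * s))))
       has_real_derivative Re (cis a * coupling t l (\<zeta> - of_int l * t))) (at t within {0..})"
      by (auto intro!: derivative_eq_intros)
  qed (use t mode_integral_equation in auto)
  show ?thesis
    unfolding has_vector_derivative_complex_iff
    using d[of 0] d[of "- (pi / 2)"] by (simp add: cis.ctr)
qed

end

section \<open>The Fourier transform of a square-integrable density\<close>

text \<open>\<open>L\<close> times the Fejer kernel, as the double sum that expanding the square of an exponential sum produces.\<close>
definition fejer_sum :: "nat \<Rightarrow> real \<Rightarrow> real" where
  "fejer_sum L x = (\<Sum>j<L. \<Sum>k<L. cos ((real j - real k) * x))"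

lemma fejer_sum_eq_norm: "fejer_sum L x = (norm (\<Sum>j<L. cis (real j * x)))\<^sup>2"
proof -
  let ?z = "\<Sum>j<L. cis (real j * x)"
  have "?z * cnj ?z = (\<Sum>j<L. \<Sum>k<L. cis ((real j - real k) * x))"
    by (simp add: sum_product cis_cnj cis_mult left_diff_distrib)
  then have re: "Re (?z * cnj ?z) = fejer_sum L x" by (simp add: fejer_sum_def)
  have "(norm z)\<^sup>2 = Re (z * cnj z)" for z by (simp add: complex_mult_cnj cmod_power2)
  from this[of ?z] show ?thesis by (simp only: re)
qed

lemma fejer_sum_nonneg: "0 \<le> fejer_sum L x"
  by (simp add: fejer_sum_eq_norm)

lemma fejer_sum_even: "fejer_sum L (- x) = fejer_sum L x"
  by (simp add: fejer_sum_def)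

lemma fejer_sum_cont: "continuous_on S (fejer_sum L)"
  unfolding fejer_sum_def[abs_def] by (intro continuous_intros)

lemma fejer_sum_measurable [measurable]: "fejer_sum L \<in> borel_measurable borel"
  by (rule borel_measurable_continuous_onI[OF fejer_sum_cont])

lemma torus_integral_cos:
  "(LINT x:{0..2*pi}|lborel. cos ((real j - real k) * (\<theta> - x))) = (if j = k then 2 * pi else 0)"
proof (cases "j = k")
  case True
  then show ?thesis by (simp add: set_lebesgue_integral_def)
next
  case False
  let ?n = "real j - real k"
  have n: "?n \<noteq> 0" using False by simp
  have "(LINT x:{0..2*pi}|lborel. cos (?n * (\<theta> - x)))
     = - sin (?n * (\<theta> - 2 * pi)) / ?n - (- sin (?n * (\<theta> - 0)) / ?n)"
    unfolding set_lebesgue_integral_def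
  proof (rule integral_FTC_atLeastAtMost)
    fix x
    have "((\<lambda>x. - sin (n * (\<theta> - x)) / n) has_real_derivative cos (n * (\<theta> - x))) (at x within {0..2*pi})"
      if "n \<noteq> 0" for n :: real
      using that by (auto intro!: derivative_eq_intros)
    from this[OF n] show "((\<lambda>x. - sin (?n * (\<theta> - x)) / ?n) has_vector_derivative cos (?n * (\<theta> - x))) (at x within {0..2*pi})"
      by (simp add: has_real_derivative_iff_has_vector_derivative)
  qed (auto intro!: continuous_intros)
  also have "sin (?n * (\<theta> - 2 * pi)) = sin (?n * (\<theta> - 0))"
  proof -
    have "?n * (\<theta> - 2 * pi) = ?n * (\<theta> - 0) - 2 * pi * of_int (int j - int k)" by (simp add: algebra_simps)
    then show ?thesis by (simp only: sin_diff sin_int_2pin cos_int_2pin)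
  qed
  finally show ?thesis using False by simp
qed

lemma torus_integral_fejer:
  "(\<integral>\<^sup>+x\<in>{0..<2*pi}. ennreal (fejer_sum L (\<theta> - x)) \<partial>lborel) = ennreal (2 * pi * real L)"
proof -
  have i: "set_integrable lborel {0..2*pi} (\<lambda>x. cos ((real j - real k) * (\<theta> - x)))" for j k
    unfolding set_integrable_def by (intro borel_integrable_compact continuous_intros) auto
  have fi: "set_integrable lborel {0..2*pi} (\<lambda>x. fejer_sum L (\<theta> - x))"
    unfolding fejer_sum_def by (intro set_integrable_sum i)
  have "(LINT x:{0..2*pi}|lborel. fejer_sum L (\<theta> - x)) = (\<Sum>j<L. \<Sum>k<L. LINT x:{0..2*pi}|lborel. cos ((real j - real k) * (\<theta> - x)))"
    unfolding fejer_sum_def by (simp only: set_integral_sum set_integrable_sum i)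
  also have "\<dots> = 2 * pi * real L"
    unfolding torus_integral_cos by (simp add: sum.delta')
  finally have 1: "(LINT x:{0..2*pi}|lborel. fejer_sum L (\<theta> - x)) = 2 * pi * real L" .
  have "(\<integral>\<^sup>+x\<in>{0..<2*pi}. ennreal (fejer_sum L (\<theta> - x)) \<partial>lborel)
      = (\<integral>\<^sup>+x. ennreal (indicator {0..2*pi} x *\<^sub>R fejer_sum L (\<theta> - x)) \<partial>lborel)"
    using AE_lborel_singleton[of "2 * pi"]
    by (intro nn_integral_cong_AE) (auto simp: indicator_def elim!: eventually_mono)
  also have "\<dots> = ennreal (LINT x:{0..2*pi}|lborel. fejer_sum L (\<theta> - x))"
    unfolding set_lebesgue_integral_def using fi unfolding set_integrable_def
    by (intro nn_integral_eq_integral) (auto simp: fejer_sum_nonneg)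
  finally show ?thesis unfolding 1 .
qed

lemma line_integral_gaussian:
  assumes \<sigma>: "0 < \<sigma>"
  shows "(\<integral>\<^sup>+y. ennreal (exp (- (\<sigma> * (\<omega> - y))\<^sup>2 / 2)) \<partial>lborel) = ennreal (sqrt (2 * pi) / \<sigma>)"
proof -
  have eq: "exp (- (\<sigma> * (\<omega> - y))\<^sup>2 / 2) = sqrt (2 * pi) / \<sigma> * normal_density \<omega> (1 / \<sigma>) y" for y
  proof -
    have "sqrt (2 * pi * (1 / \<sigma>)\<^sup>2) = sqrt (2 * pi) / \<sigma>"
      using \<sigma> by (simp add: real_sqrt_mult real_sqrt_divide power_divide)
    moreover have "- (y - \<omega>)\<^sup>2 / (2 * (1 / \<sigma>)\<^sup>2) = - (\<sigma> * (\<omega> - y))\<^sup>2 / 2"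
      using \<sigma> by (simp add: power2_eq_square field_simps)
    ultimately show ?thesis using \<sigma> by (simp add: normal_density_def)
  qed
  have mass: "(\<integral>\<^sup>+y. ennreal (b * normal_density \<omega> (1 / \<sigma>) y) \<partial>lborel) = ennreal b" if "0 \<le> b" for b
    using \<sigma> that by (subst nn_integral_eq_integral) auto
  show ?thesis unfolding eq by (rule mass) (use \<sigma> in simp)
qed

text \<open>
  Schur's test for a symmetric nonnegative kernel: bound \<open>F x * F y\<close> by the mean of the squares and use the symmetry.
\<close>
lemma (in sigma_finite_measure) schur_test_symmetric:
  fixes k :: "'a \<Rightarrow> 'a \<Rightarrow> ennreal" and F :: "'a \<Rightarrow> ennreal"
  assumes k [measurable]: "case_prod k \<in> borel_measurable (M \<Otimes>\<^sub>M M)" and F [measurable]: "F \<in> borel_measurable M"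
    and sym: "\<And>x y. k x y = k y x" and A: "\<And>x. (\<integral>\<^sup>+y. k x y \<partial>M) \<le> A"
  shows "(\<integral>\<^sup>+x. \<integral>\<^sup>+y. F x * F y * k x y \<partial>M \<partial>M) \<le> A * (\<integral>\<^sup>+x. (F x)\<^sup>2 \<partial>M)"
proof -
  interpret pair_sigma_finite M M ..
  have am_gm: "2 * (a * b) \<le> a\<^sup>2 + b\<^sup>2" for a b :: ennreal
  proof (cases "a = top \<or> b = top")
    case False
    then obtain x y where x: "0 \<le> x" "a = ennreal x" and y: "0 \<le> y" "b = ennreal y"
      by (metis ennreal_cases)
    have "ennreal (2 * (x * y)) \<le> ennreal (x\<^sup>2 + y\<^sup>2)"
      using sum_squares_bound[of x y] by (intro ennreal_leI) simp
    then show ?thesis using x y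
      by (simp add: ennreal_mult ennreal_plus ennreal_power)
  qed (auto simp: power2_eq_square)
  have "2 * (\<integral>\<^sup>+x. \<integral>\<^sup>+y. F x * F y * k x y \<partial>M \<partial>M) = (\<integral>\<^sup>+x. \<integral>\<^sup>+y. 2 * (F x * F y) * k x y \<partial>M \<partial>M)"
    by (subst nn_integral_cmult[symmetric], measurable)
      (intro nn_integral_cong, subst nn_integral_cmult[symmetric], measurable, simp add: mult.assoc)
  also have "\<dots> \<le> (\<integral>\<^sup>+x. \<integral>\<^sup>+y. ((F x)\<^sup>2 + (F y)\<^sup>2) * k x y \<partial>M \<partial>M)"
    by (intro nn_integral_mono mult_right_mono am_gm) auto
  also have "\<dots> = (\<integral>\<^sup>+x. \<integral>\<^sup>+y. (F x)\<^sup>2 * k x y \<partial>M \<partial>M) + (\<integral>\<^sup>+x. \<integral>\<^sup>+y. (F y)\<^sup>2 * k x y \<partial>M \<partial>M)"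
    by (subst nn_integral_add[symmetric], measurable)
      (intro nn_integral_cong, subst nn_integral_add[symmetric], measurable, simp add: distrib_right)
  also have "(\<integral>\<^sup>+x. \<integral>\<^sup>+y. (F y)\<^sup>2 * k x y \<partial>M \<partial>M) = (\<integral>\<^sup>+y. \<integral>\<^sup>+x. (F y)\<^sup>2 * k x y \<partial>M \<partial>M)"
    by (rule Fubini') measurable
  also have "\<dots> = (\<integral>\<^sup>+x. \<integral>\<^sup>+y. (F x)\<^sup>2 * k x y \<partial>M \<partial>M)"
    by (simp only: sym)
  also have "(\<integral>\<^sup>+x. \<integral>\<^sup>+y. (F x)\<^sup>2 * k x y \<partial>M \<partial>M) \<le> A * (\<integral>\<^sup>+x. (F x)\<^sup>2 \<partial>M)"
  proof -
    have "(\<integral>\<^sup>+x. \<integral>\<^sup>+y. (F x)\<^sup>2 * k x y \<partial>M \<partial>M) = (\<integral>\<^sup>+x. (F x)\<^sup>2 * (\<integral>\<^sup>+y. k x y \<partial>M) \<partial>M)"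
      by (intro nn_integral_cong nn_integral_cmult) measurable
    also have "\<dots> \<le> (\<integral>\<^sup>+x. (F x)\<^sup>2 * A \<partial>M)" by (intro nn_integral_mono mult_left_mono A) auto
    also have "\<dots> = A * (\<integral>\<^sup>+x. (F x)\<^sup>2 \<partial>M)"
      unfolding mult.commute[of _ A] by (rule nn_integral_cmult) measurable
    finally show ?thesis .
  qed
  finally have "2 * (\<integral>\<^sup>+x. \<integral>\<^sup>+y. F x * F y * k x y \<partial>M \<partial>M) \<le> 2 * (A * (\<integral>\<^sup>+x. (F x)\<^sup>2 \<partial>M))"
    by (simp add: mult_2 add_mono)
  then show ?thesis by (subst (asm) ennreal_mult_le_mult_iff) auto
qed

text \<open>
  The kernel produced by the frequency average: Fejer in the phase, and in the velocity the Fourier transform of a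
  Gaussian of standard deviation \<open>\<sigma>\<close>.
\<close>
definition gauss_fejer :: "real \<Rightarrow> nat \<Rightarrow> real \<times> real \<Rightarrow> real \<times> real \<Rightarrow> real" where
  "gauss_fejer \<sigma> L P Q = fejer_sum L (fst P - fst Q) * exp (- (\<sigma> * (snd P - snd Q))\<^sup>2 / 2)"

lemma gauss_fejer_nonneg: "0 \<le> gauss_fejer \<sigma> L P Q"
  by (simp add: gauss_fejer_def fejer_sum_nonneg)

lemma gauss_fejer_sym: "gauss_fejer \<sigma> L P Q = gauss_fejer \<sigma> L Q P"
  using fejer_sum_even[of L "fst P - fst Q"] power2_commute[of "\<sigma> * snd P" "\<sigma> * snd Q"]
  by (simp add: gauss_fejer_def right_diff_distrib)

lemma gauss_fejer_measurable:
  assumes [measurable]: "fst \<in> borel_measurable M" "snd \<in> borel_measurable M"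
  shows "case_prod (gauss_fejer \<sigma> L) \<in> borel_measurable (M \<Otimes>\<^sub>M M)"
  unfolding gauss_fejer_def by measurable

lemma gauss_fejer_row_measurable: "gauss_fejer \<sigma> L P \<in> borel_measurable borel"
  unfolding gauss_fejer_def[abs_def] divide_inverse
  by (intro borel_measurable_continuous_onI continuous_intros continuous_on_compose2[OF fejer_sum_cont[of UNIV]]) auto

lemma Gamma_coord_measurable:
  assumes "sets M = sets Gamma_borel"
  shows "fst \<in> borel_measurable M" "snd \<in> borel_measurable M"
  by (rule continuous_measurable_Gamma[OF assms], intro continuous_intros)+

text \<open>
  \<open>|u|\<^sup>2\<close> is an integral over the product of the measure with itself, so the average over \<open>\<xi> = \<sigma> x\<close> can be taken inside,
  where it is the characteristic function of the normal distribution.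
\<close>
lemma gaussian_average_norm_sq:
  assumes M: "M \<in> space (prob_algebra Gamma_borel)"
  shows "(LINT x|std_normal_distribution. (norm (LINT P|M. wave l (\<sigma> * x) P))\<^sup>2)
    = (LINT PQ|(M \<Otimes>\<^sub>M M). cos (of_int l * (fst (fst PQ) - fst (snd PQ))) * exp (- (\<sigma> * (snd (fst PQ) - snd (snd PQ)))\<^sup>2 / 2))"
proof -
  interpret M: prob_space M by (rule space_prob_algebra_GammaD(1)[OF M])
  interpret N: real_distribution std_normal_distribution by (rule real_dist_normal_dist)
  interpret MM: pair_prob_space M M ..
  interpret NMM: pair_prob_space std_normal_distribution "M \<Otimes>\<^sub>M M" ..
  note [measurable] = Gamma_coord_measurable[OF space_prob_algebra_GammaD(2)[OF M]]
  let ?\<theta> = "\<lambda>PQ. fst (fst PQ) - fst (snd PQ)" and ?\<omega> = "\<lambda>PQ. snd (fst PQ) - snd (snd PQ)"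
  let ?g = "\<lambda>x PQ. cos (of_int l * ?\<theta> PQ + \<sigma> * x * ?\<omega> PQ)"
  have sq: "(norm (LINT P|M. wave l \<xi> P))\<^sup>2 = (LINT PQ|(M \<Otimes>\<^sub>M M). cos (of_int l * ?\<theta> PQ + \<xi> * ?\<omega> PQ))" for \<xi>
  proof -
    have wm [measurable]: "wave l \<xi> \<in> borel_measurable M" by (rule borel_measurable_integrable[OF wave_integrable[OF M]])
    have [measurable]: "cnj \<in> borel_measurable borel"
      by (intro borel_measurable_continuous_onI continuous_intros)
    let ?w = "\<lambda>PQ. wave l \<xi> (fst PQ) * cnj (wave l \<xi> (snd PQ))"
    have int: "integrable (M \<Otimes>\<^sub>M M) ?w"
      by (rule MM.integrable_const_bound[where B = 1]) (auto simp: norm_mult)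
    let ?c = "LINT P|M. wave l \<xi> P"
    have "(LINT PQ|(M \<Otimes>\<^sub>M M). ?w PQ) = (LINT P|M. LINT Q|M. ?w (P, Q))"
      by (rule MM.integral_fst'[OF int, symmetric])
    also have "\<dots> = (LINT P|M. wave l \<xi> P * cnj ?c)"
      by (simp del: complex_cnj_mult)
    also have "\<dots> = ?c * cnj ?c" by simp
    finally have "?c * cnj ?c = (LINT PQ|(M \<Otimes>\<^sub>M M). ?w PQ)" ..
    moreover have "(norm ?c)\<^sup>2 = Re (?c * cnj ?c)" by (simp add: complex_mult_cnj cmod_power2)
    ultimately have sq: "(norm ?c)\<^sup>2 = (LINT PQ|(M \<Otimes>\<^sub>M M). Re (?w PQ))" by (simp only: integral_Re[OF int])
    have re: "Re (?w PQ) = cos (of_int l * ?\<theta> PQ + \<xi> * ?\<omega> PQ)" for PQ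
    proof -
      have "?w PQ = cis (of_int l * ?\<theta> PQ + \<xi> * ?\<omega> PQ)"
        by (simp add: wave_eq_cis cis_cnj cis_mult algebra_simps)
      then show ?thesis by simp
    qed
    show ?thesis using sq unfolding re .
  qed
  have gi: "integrable (std_normal_distribution \<Otimes>\<^sub>M (M \<Otimes>\<^sub>M M)) (case_prod ?g)"
    by (rule NMM.integrable_const_bound[where B = 1]) auto
  have "(LINT x|std_normal_distribution. (norm (LINT P|M. wave l (\<sigma> * x) P))\<^sup>2)
      = (LINT x|std_normal_distribution. LINT PQ|(M \<Otimes>\<^sub>M M). ?g x PQ)"
    unfolding sq ..
  also have "\<dots> = (LINT PQ|(M \<Otimes>\<^sub>M M). LINT x|std_normal_distribution. ?g x PQ)"
    by (rule NMM.Fubini_integral[OF gi, symmetric])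
  also have "\<dots> = (LINT PQ|(M \<Otimes>\<^sub>M M). cos (of_int l * ?\<theta> PQ) * exp (- (\<sigma> * ?\<omega> PQ)\<^sup>2 / 2))"
  proof (rule Bochner_Integration.integral_cong[OF refl])
    fix PQ
    let ?a = "of_int l * ?\<theta> PQ :: real" and ?b = "\<sigma> * ?\<omega> PQ :: real"
    have ie: "integrable std_normal_distribution (\<lambda>x. iexp (?b * x))" by (rule N.integrable_iexp) (auto simp del: of_real_mult)
    have ci: "integrable std_normal_distribution (\<lambda>x. cis ?a * iexp (?b * x))" by (intro integrable_mult_right ie)
    have "?g x PQ = Re (cis ?a * iexp (?b * x))" for x
    proof -
      have "cis ?a * iexp (?b * x) = cis (?a + \<sigma> * x * ?\<omega> PQ)"
        by (simp only: cis_conv_exp[symmetric] cis_mult) (simp add: mult_ac)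
      then show ?thesis by simp
    qed
    then have "(LINT x|std_normal_distribution. ?g x PQ) = Re (LINT x|std_normal_distribution. cis ?a * iexp (?b * x))"
      by (simp only: integral_Re[OF ci])
    also have "(LINT x|std_normal_distribution. cis ?a * iexp (?b * x)) = cis ?a * char std_normal_distribution ?b"
      by (simp only: integral_mult_right_zero char_def)
    finally show "(LINT x|std_normal_distribution. ?g x PQ) = cos ?a * exp (- ?b\<^sup>2 / 2)"
      by (simp add: char_std_normal_distribution)
  qed
  finally show ?thesis .
qed

lemma gaussian_average_double_sum:
  assumes M: "M \<in> space (prob_algebra Gamma_borel)"
  shows "(\<Sum>j<L. \<Sum>k<L. LINT x|std_normal_distribution. (norm (LINT P|M. wave (int j - int k) (\<sigma> * x) P))\<^sup>2)
    = (LINT PQ|(M \<Otimes>\<^sub>M M). case_prod (gauss_fejer \<sigma> L) PQ)"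
proof -
  let ?e = "\<lambda>r PQ. cos (r * (fst (fst PQ) - fst (snd PQ))) * exp (- (\<sigma> * (snd (fst PQ) - snd (snd PQ)))\<^sup>2 / 2)"
  interpret M: prob_space M by (rule space_prob_algebra_GammaD(1)[OF M])
  interpret MM: pair_prob_space M M ..
  note [measurable] = Gamma_coord_measurable[OF space_prob_algebra_GammaD(2)[OF M]]
  have i: "integrable (M \<Otimes>\<^sub>M M) (\<lambda>PQ. ?e r PQ)" for r :: real
  proof (rule MM.integrable_const_bound[where B = 1])
    show "AE PQ in (M \<Otimes>\<^sub>M M). norm (?e r PQ) \<le> 1"
      by (intro AE_I2) (auto simp: abs_mult intro!: mult_le_one abs_cos_le_one)
  qed measurable
  have "(LINT PQ|(M \<Otimes>\<^sub>M M). case_prod (gauss_fejer \<sigma> L) PQ)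
     = (LINT PQ|(M \<Otimes>\<^sub>M M). (\<Sum>j<L. (\<Sum>k<L. ?e (real j - real k) PQ)))"
    by (simp only: gauss_fejer_def fejer_sum_def case_prod_beta sum_distrib_right)
  also have "\<dots> = (\<Sum>j<L. (LINT PQ|(M \<Otimes>\<^sub>M M). (\<Sum>k<L. ?e (real j - real k) PQ)))"
    by (intro Bochner_Integration.integral_sum Bochner_Integration.integrable_sum i)
  also have "\<dots> = (\<Sum>j<L. \<Sum>k<L. (LINT PQ|(M \<Otimes>\<^sub>M M). ?e (real j - real k) PQ))"
    by (intro sum.cong refl Bochner_Integration.integral_sum i)
  finally show ?thesis
    unfolding gaussian_average_norm_sq[OF M] of_int_diff of_int_of_nat_eq ..
qed

lemma nn_integral_Gamma_measure:
  assumes h: "h \<in> borel_measurable (restrict_space lborel Gamma)"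
  shows "(\<integral>\<^sup>+P. h P \<partial>Gamma_measure) = ennreal (1 / (2*pi)\<^sup>2) * (\<integral>\<^sup>+P. h P * indicator Gamma P \<partial>lborel)"
proof -
  have "Gamma \<inter> space lborel \<in> sets lborel" by (simp add: Gamma_def borel_Times)
  then show ?thesis
    unfolding Gamma_measure_def nn_integral_scale_measure[OF h] by (simp add: nn_integral_restrict_space)
qed

lemma gauss_fejer_row:
  assumes \<sigma>: "0 < \<sigma>"
  shows "(\<integral>\<^sup>+Q. ennreal (gauss_fejer \<sigma> L P Q) * indicator Gamma Q \<partial>lborel) = ennreal (2 * pi * real L * (sqrt (2 * pi) / \<sigma>))"
proof -
  note [measurable] = gauss_fejer_row_measurable
  have [measurable]: "Gamma \<in> sets borel" by (simp add: Gamma_def borel_Times)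
  have "(\<lambda>Q. ennreal (gauss_fejer \<sigma> L P Q) * indicator Gamma Q) \<in> borel_measurable (lborel \<Otimes>\<^sub>M lborel)"
    unfolding lborel_prod by measurable
  from lborel.nn_integral_fst[OF this]
  have "(\<integral>\<^sup>+Q. ennreal (gauss_fejer \<sigma> L P Q) * indicator Gamma Q \<partial>lborel)
      = (\<integral>\<^sup>+x. \<integral>\<^sup>+y. ennreal (gauss_fejer \<sigma> L P (x, y)) * indicator Gamma (x, y) \<partial>lborel \<partial>lborel)"
    unfolding lborel_prod by simp
  also have "\<dots> = (\<integral>\<^sup>+x. \<integral>\<^sup>+y. (ennreal (fejer_sum L (fst P - x)) * indicator {0..<2*pi} x) * ennreal (exp (- (\<sigma> * (snd P - y))\<^sup>2 / 2)) \<partial>lborel \<partial>lborel)"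
    by (intro nn_integral_cong) (auto simp: gauss_fejer_def Gamma_def indicator_def ennreal_mult' fejer_sum_nonneg)
  also have "\<dots> = (\<integral>\<^sup>+x. (ennreal (fejer_sum L (fst P - x)) * indicator {0..<2*pi} x) * ennreal (sqrt (2 * pi) / \<sigma>) \<partial>lborel)"
    by (intro nn_integral_cong) (subst nn_integral_cmult, measurable, simp only: line_integral_gaussian[OF \<sigma>])
  also have "\<dots> = ennreal (2 * pi * real L) * ennreal (sqrt (2 * pi) / \<sigma>)"
    by (subst nn_integral_multc) (measurable, simp only: torus_integral_fejer)
  finally show ?thesis using \<sigma> by (subst ennreal_mult) auto
qed

text \<open>
  Schur's test for a measure with density \<open>f\<close>. The row integral of the kernel over \<open>Gamma\<close> is
  \<open>2 \<pi> L sqrt (2 \<pi>) / \<sigma>\<close> for Lebesgue measure. Two copies of the reference measure bring in \<open>1 / (2 \<pi>)\<^sup>2\<close> twice;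
  one of these factors is part of the integral of \<open>f\<^sup>2\<close>, the other one of the constant.
\<close>
lemma kernel_bound:
  assumes M: "M \<in> space (prob_algebra Gamma_borel)" and \<sigma>: "0 < \<sigma>"
    and f [measurable]: "f \<in> borel_measurable Gamma_measure" and dens: "M = density Gamma_measure (\<lambda>P. ennreal (f P))"
  shows "ennreal (LINT PQ|(M \<Otimes>\<^sub>M M). case_prod (gauss_fejer \<sigma> L) PQ)
    \<le> ennreal (real L / (sqrt (2 * pi) * \<sigma>)) * (\<integral>\<^sup>+P. (ennreal (f P))\<^sup>2 \<partial>Gamma_measure)"
proof -
  interpret M: prob_space M by (rule space_prob_algebra_GammaD(1)[OF M])
  interpret MM: pair_prob_space M M ..
  note [measurable] = Gamma_coord_measurable[OF space_prob_algebra_GammaD(2)[OF M]]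
  have sG: "sets Gamma_measure = sets (restrict_space lborel Gamma)" by (simp add: Gamma_measure_def)
  have \<Gamma>[measurable]: "Gamma \<in> sets borel" by (simp add: Gamma_def borel_Times)
  then have \<Gamma>': "Gamma \<inter> space lborel \<in> sets lborel" by simp
  have fr: "(\<lambda>P. ennreal (f P)) \<in> borel_measurable (restrict_space lborel Gamma)"
    using f unfolding measurable_cong_sets[OF sG refl] by measurable
  define F where "F P = ennreal (f P) * indicator Gamma P" for P
  have F [measurable]: "F \<in> borel_measurable lborel"
    using fr unfolding borel_measurable_restrict_space_iff_ennreal[OF \<Gamma>'] F_def[abs_def] .
  have k [measurable]: "case_prod (gauss_fejer \<sigma> L) \<in> borel_measurable (borel \<Otimes>\<^sub>M borel)"
    by (rule gauss_fejer_measurable) (auto intro!: borel_measurable_continuous_onI continuous_intros)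
  note [measurable] = gauss_fejer_row_measurable
  let ?C = "ennreal (1 / (2*pi)\<^sup>2)"
  let ?row = "\<lambda>P. \<integral>\<^sup>+Q. F Q * ennreal (gauss_fejer \<sigma> L P Q) \<partial>lborel"
  have dens_int: "(\<integral>\<^sup>+P. h P \<partial>M) = ?C * (\<integral>\<^sup>+P. F P * h P \<partial>lborel)" if [measurable]: "h \<in> borel_measurable borel" for h
  proof -
    have hr [measurable]: "h \<in> borel_measurable (restrict_space lborel Gamma)" "h \<in> borel_measurable Gamma_measure"
      unfolding measurable_cong_sets[OF sG refl] by (auto intro: measurable_restrict_space1)
    have "(\<integral>\<^sup>+P. h P \<partial>M) = (\<integral>\<^sup>+P. ennreal (f P) * h P \<partial>Gamma_measure)"
      unfolding dens by (rule nn_integral_density) measurable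
    also have "\<dots> = ?C * (\<integral>\<^sup>+P. ennreal (f P) * h P * indicator Gamma P \<partial>lborel)"
      by (rule nn_integral_Gamma_measure) (intro borel_measurable_times_ennreal fr hr)
    finally show ?thesis by (simp add: F_def mult_ac)
  qed
  define k' where "k' P Q = ennreal (gauss_fejer \<sigma> L P Q) * (indicator Gamma P * indicator Gamma Q)" for P Q
  let ?row' = "\<lambda>P. \<integral>\<^sup>+Q. F P * F Q * k' P Q \<partial>lborel"
  have k' [measurable]: "case_prod k' \<in> borel_measurable (lborel \<Otimes>\<^sub>M lborel)"
    unfolding k'_def by measurable
  have "(\<integral>\<^sup>+PQ. ennreal (case_prod (gauss_fejer \<sigma> L) PQ) \<partial>(M \<Otimes>\<^sub>M M)) = (\<integral>\<^sup>+P. \<integral>\<^sup>+Q. ennreal (gauss_fejer \<sigma> L P Q) \<partial>M \<partial>M)"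
    by (subst M.nn_integral_fst[symmetric]) (auto intro!: measurable_compose[OF gauss_fejer_measurable])
  also have "\<dots> = (\<integral>\<^sup>+P. ?C * ?row P \<partial>M)"
    by (intro nn_integral_cong dens_int) measurable
  also have "\<dots> = ?C * (\<integral>\<^sup>+P. F P * (?C * ?row P) \<partial>lborel)"
    by (rule dens_int) measurable
  also have "\<dots> = ?C * (?C * (\<integral>\<^sup>+P. \<integral>\<^sup>+Q. F P * F Q * k' P Q \<partial>lborel \<partial>lborel))"
  proof -
    have "(\<integral>\<^sup>+P. F P * (?C * ?row P) \<partial>lborel)
        = (\<integral>\<^sup>+P. ?C * ?row' P \<partial>lborel)"
    proof (rule nn_integral_cong)
      fix P :: "real \<times> real"
      have "F P * ?row P = (\<integral>\<^sup>+Q. F P * (F Q * ennreal (gauss_fejer \<sigma> L P Q)) \<partial>lborel)"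
        by (rule nn_integral_cmult[symmetric]) measurable
      also have "\<dots> = ?row' P"
        by (intro nn_integral_cong) (auto simp: F_def k'_def indicator_def mult_ac)
      finally have X: "F P * ?row P = ?row' P" .
      show "F P * (?C * ?row P) = ?C * ?row' P"
        unfolding X[symmetric] by (rule mult.left_commute)
    qed
    also have "\<dots> = ?C * (\<integral>\<^sup>+P. \<integral>\<^sup>+Q. F P * F Q * k' P Q \<partial>lborel \<partial>lborel)"
      by (rule nn_integral_cmult) measurable
    finally show ?thesis by simp
  qed
  also have "\<dots> \<le> ?C * (?C * (ennreal (2 * pi * real L * (sqrt (2 * pi) / \<sigma>)) * (\<integral>\<^sup>+P. (F P)\<^sup>2 \<partial>lborel)))"
  proof (intro mult_left_mono lborel.schur_test_symmetric[OF k' F])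
    show "k' P Q = k' Q P" for P Q by (simp add: k'_def gauss_fejer_sym[of \<sigma> L P Q] mult.commute)
    fix P
    have "(\<integral>\<^sup>+Q. k' P Q \<partial>lborel) \<le> (\<integral>\<^sup>+Q. ennreal (gauss_fejer \<sigma> L P Q) * indicator Gamma Q \<partial>lborel)"
      by (intro nn_integral_mono) (auto simp: k'_def indicator_def)
    then show "(\<integral>\<^sup>+Q. k' P Q \<partial>lborel) \<le> ennreal (2 * pi * real L * (sqrt (2 * pi) / \<sigma>))"
      unfolding gauss_fejer_row[OF \<sigma>] .
  qed auto
  also have "?C * (?C * (ennreal (2 * pi * real L * (sqrt (2 * pi) / \<sigma>)) * (\<integral>\<^sup>+P. (F P)\<^sup>2 \<partial>lborel)))
     = ennreal (1 / (2*pi)\<^sup>2 * (2 * pi * real L * (sqrt (2 * pi) / \<sigma>))) * (?C * (\<integral>\<^sup>+P. (F P)\<^sup>2 \<partial>lborel))"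
    using \<sigma> by (subst ennreal_mult') (auto simp: mult_ac)
  also have "1 / (2*pi)\<^sup>2 * (2 * pi * real L * (sqrt (2 * pi) / \<sigma>)) = real L / (sqrt (2 * pi) * \<sigma>)"
  proof -
    have "1 / (2*pi)\<^sup>2 * (2 * pi * real L * (s / \<sigma>)) = real L / (s * \<sigma>)" if "s * s = 2 * pi" "0 < s" for s
      using that \<sigma> pi_gt_zero by (simp add: field_simps power2_eq_square)
    from this[of "sqrt (2 * pi)"] show ?thesis by simp
  qed
  also have "?C * (\<integral>\<^sup>+P. (F P)\<^sup>2 \<partial>lborel) = (\<integral>\<^sup>+P. (ennreal (f P))\<^sup>2 \<partial>Gamma_measure)"
  proof -
    have "(F P)\<^sup>2 = (ennreal (f P))\<^sup>2 * indicator Gamma P" for P by (simp add: F_def indicator_def)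
    then show ?thesis
      by (subst nn_integral_Gamma_measure) (auto intro!: borel_measurable_power_ennreal fr)
  qed
  finally have "(\<integral>\<^sup>+PQ. ennreal (case_prod (gauss_fejer \<sigma> L) PQ) \<partial>(M \<Otimes>\<^sub>M M))
     \<le> ennreal (real L / (sqrt (2 * pi) * \<sigma>)) * (\<integral>\<^sup>+P. (ennreal (f P))\<^sup>2 \<partial>Gamma_measure)" .
  moreover have "ennreal (LINT PQ|(M \<Otimes>\<^sub>M M). case_prod (gauss_fejer \<sigma> L) PQ) = (\<integral>\<^sup>+PQ. ennreal (case_prod (gauss_fejer \<sigma> L) PQ) \<partial>(M \<Otimes>\<^sub>M M))"
  proof (rule nn_integral_eq_integral[symmetric])
    show "integrable (M \<Otimes>\<^sub>M M) (case_prod (gauss_fejer \<sigma> L))"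
    proof (rule MM.integrable_const_bound[where B = "real L * real L * 1"])
      have "\<bar>fejer_sum L x\<bar> \<le> real L * real L" for x
      proof -
        have "fejer_sum L x \<le> (\<Sum>j<L. \<Sum>k<L. 1)" unfolding fejer_sum_def by (intro sum_mono cos_le_one)
        then show ?thesis using fejer_sum_nonneg[of L x] by simp
      qed
      then show "AE PQ in (M \<Otimes>\<^sub>M M). norm (case_prod (gauss_fejer \<sigma> L) PQ) \<le> real L * real L * 1"
        unfolding gauss_fejer_def case_prod_beta real_norm_def abs_mult by (intro AE_I2 mult_mono) auto
    qed (rule gauss_fejer_measurable, measurable)
  qed (auto simp: gauss_fejer_nonneg)
  ultimately show ?thesis by simp
qed

definition gauss_mode :: "(real \<times> real) measure \<Rightarrow> real \<Rightarrow> int \<Rightarrow> ennreal" where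
  "gauss_mode M \<sigma> l = (\<integral>\<^sup>+\<xi>. ennreal (exp (- (\<xi> / \<sigma>)\<^sup>2 / 2) * (norm (LINT P|M. wave l \<xi> P))\<^sup>2) \<partial>lborel)"

lemma fourier_measurable:
  assumes M: "M \<in> space (prob_algebra Gamma_borel)"
  shows "(\<lambda>\<xi>. LINT P|M. wave l \<xi> P) \<in> borel_measurable borel"
proof -
  interpret M: prob_space M by (rule space_prob_algebra_GammaD(1)[OF M])
  note [measurable] = Gamma_coord_measurable[OF space_prob_algebra_GammaD(2)[OF M]]
  have "case_prod (wave l) \<in> borel_measurable (borel \<Otimes>\<^sub>M M)"
    unfolding wave_def by measurable
  then show ?thesis by (rule M.borel_measurable_lebesgue_integral)
qed

lemma gauss_mode_eq_average:
  assumes M: "M \<in> space (prob_algebra Gamma_borel)" and \<sigma>: "0 < \<sigma>"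
  shows "ennreal (LINT x|std_normal_distribution. (norm (LINT P|M. wave l (\<sigma> * x) P))\<^sup>2)
    = ennreal (1 / (sqrt (2 * pi) * \<sigma>)) * gauss_mode M \<sigma> l"
proof -
  interpret N: real_distribution std_normal_distribution by (rule real_dist_normal_dist)
  let ?c = "\<lambda>\<xi>. LINT P|M. wave l \<xi> P"
  note [measurable] = fourier_measurable[OF M]
  have c_le: "(norm (?c \<xi>))\<^sup>2 \<le> 1" for \<xi>
    using norm_integral_le_1[OF M, of "wave l \<xi>"] by (simp add: power_le_one)
  let ?g = "\<lambda>\<xi>. ennreal (std_normal_density (\<xi> / \<sigma>) * (norm (?c \<xi>))\<^sup>2)"
  have "ennreal (LINT x|std_normal_distribution. (norm (?c (\<sigma> * x)))\<^sup>2) = (\<integral>\<^sup>+x. ennreal ((norm (?c (\<sigma> * x)))\<^sup>2) \<partial>std_normal_distribution)"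
    by (rule nn_integral_eq_integral[symmetric], rule N.integrable_const_bound[where B = 1]) (auto simp: c_le)
  also have "\<dots> = (\<integral>\<^sup>+x. ?g (0 + \<sigma> * x) \<partial>lborel)"
    using \<sigma> by (subst nn_integral_density) (auto simp: ennreal_mult')
  also have "\<dots> = ennreal (1 / \<sigma>) * (\<integral>\<^sup>+\<xi>. ?g \<xi> \<partial>lborel)"
  proof -
    have "(\<integral>\<^sup>+\<xi>. ?g \<xi> \<partial>lborel) = ennreal \<bar>\<sigma>\<bar> * (\<integral>\<^sup>+x. ?g (0 + \<sigma> * x) \<partial>lborel)"
      using \<sigma> by (intro nn_integral_real_affine) auto
    then have "ennreal (1 / \<sigma>) * (\<integral>\<^sup>+\<xi>. ?g \<xi> \<partial>lborel) = (ennreal (1 / \<sigma>) * ennreal \<bar>\<sigma>\<bar>) * (\<integral>\<^sup>+x. ?g (0 + \<sigma> * x) \<partial>lborel)"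
      by (simp only: mult.assoc)
    also have "ennreal (1 / \<sigma>) * ennreal \<bar>\<sigma>\<bar> = 1" using \<sigma> by (simp add: ennreal_mult[symmetric])
    finally show ?thesis by simp
  qed
  also have "(\<integral>\<^sup>+\<xi>. ?g \<xi> \<partial>lborel) = ennreal (1 / sqrt (2 * pi)) * gauss_mode M \<sigma> l"
  proof -
    have "?g \<xi> = ennreal (1 / sqrt (2 * pi)) * ennreal (exp (- (\<xi> / \<sigma>)\<^sup>2 / 2) * (norm (?c \<xi>))\<^sup>2)" for \<xi>
      by (subst ennreal_mult[symmetric]) (auto simp: std_normal_density_def)
    then show ?thesis unfolding gauss_mode_def by (simp only:) (rule nn_integral_cmult, measurable)
  qed
  also have "ennreal (1 / \<sigma>) * (ennreal (1 / sqrt (2 * pi)) * gauss_mode M \<sigma> l) = ennreal (1 / (sqrt (2 * pi) * \<sigma>)) * gauss_mode M \<sigma> l"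
  proof -
    have "ennreal (1 / \<sigma>) * ennreal (1 / sqrt (2 * pi)) = ennreal (1 / (sqrt (2 * pi) * \<sigma>))"
      using \<sigma> by (subst ennreal_mult[symmetric]) (auto simp: mult.commute)
    then show ?thesis by (simp only: mult.assoc[symmetric])
  qed
  finally show ?thesis .
qed

lemma gauss_mode_double_sum_bound:
  assumes M: "M \<in> space (prob_algebra Gamma_borel)" and \<sigma>: "0 < \<sigma>"
    and f: "f \<in> borel_measurable Gamma_measure" and dens: "M = density Gamma_measure (\<lambda>P. ennreal (f P))"
  shows "(\<Sum>j<L. \<Sum>k<L. gauss_mode M \<sigma> (int j - int k)) \<le> of_nat L * (\<integral>\<^sup>+P. (ennreal (f P))\<^sup>2 \<partial>Gamma_measure)"
proof -
  let ?C = "ennreal (1 / (sqrt (2 * pi) * \<sigma>))" and ?F = "\<integral>\<^sup>+P. (ennreal (f P))\<^sup>2 \<partial>Gamma_measure"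
  have double_sum: "(\<Sum>j<L. \<Sum>k<L. ennreal (a j k)) = ennreal (\<Sum>j<L. \<Sum>k<L. a j k)"
    if "\<And>j k. 0 \<le> a j k" for a
    using that by (simp add: sum_ennreal sum_nonneg)
  have "?C * (\<Sum>j<L. \<Sum>k<L. gauss_mode M \<sigma> (int j - int k))
     = ennreal (\<Sum>j<L. \<Sum>k<L. LINT x|std_normal_distribution. (norm (LINT P|M. wave (int j - int k) (\<sigma> * x) P))\<^sup>2)"
    unfolding sum_distrib_left gauss_mode_eq_average[OF M \<sigma>, symmetric] 
    by (rule double_sum) (simp add: Bochner_Integration.integral_nonneg)
  also have "\<dots> \<le> ennreal (real L / (sqrt (2 * pi) * \<sigma>)) * ?F"
    unfolding gaussian_average_double_sum[OF M] by (rule kernel_bound[OF M \<sigma> f dens])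
  also have "ennreal (real L / (sqrt (2 * pi) * \<sigma>)) = ?C * of_nat L"
    using \<sigma> unfolding ennreal_of_nat_eq_real_of_nat by (subst ennreal_mult[symmetric]) auto
  finally have "?C * (\<Sum>j<L. \<Sum>k<L. gauss_mode M \<sigma> (int j - int k)) \<le> ?C * (of_nat L * ?F)" by (simp only: mult.assoc)
  then show ?thesis using \<sigma> by (subst (asm) ennreal_mult_le_mult_iff) auto
qed

text \<open>
  Every positive difference \<open>l \<le> N\<close> occurs at least \<open>n\<close> times among the pairs below \<open>N + n\<close>, which turns the Fejer
  weights into the weight \<open>1\<close> as \<open>n \<rightarrow> \<infinity>\<close>.
\<close>
lemma toeplitz_sum_lower_bound:
  fixes T :: "int \<Rightarrow> ennreal"
  shows "of_nat n * (\<Sum>l<N. T (int (Suc l))) \<le> (\<Sum>j<N + n. \<Sum>k<N + n. T (int j - int k))"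
proof -
  have row: "(\<Sum>l<N. T (int (Suc l))) \<le> (\<Sum>j<N + n. T (int j - int k))" if k: "k < n" for k
  proof -
    have "(\<Sum>l<N. T (int (Suc l))) = (\<Sum>j\<in>(\<lambda>l. k + Suc l) ` {..<N}. T (int j - int k))"
      by (subst sum.reindex) (auto simp: inj_on_def)
    also have "\<dots> \<le> (\<Sum>j<N + n. T (int j - int k))" using k by (intro sum_mono2) auto
    finally show ?thesis .
  qed
  have "of_nat n * (\<Sum>l<N. T (int (Suc l))) = (\<Sum>k<n. \<Sum>l<N. T (int (Suc l)))" by simp
  also have "\<dots> \<le> (\<Sum>k<n. \<Sum>j<N + n. T (int j - int k))" by (intro sum_mono row) auto
  also have "\<dots> \<le> (\<Sum>k<N + n. \<Sum>j<N + n. T (int j - int k))" by (intro sum_mono2) auto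
  also have "\<dots> = (\<Sum>j<N + n. \<Sum>k<N + n. T (int j - int k))" by (rule sum.swap)
  finally show ?thesis .
qed

lemma gauss_mode_sum_bound:
  assumes M: "M \<in> space (prob_algebra Gamma_borel)" and \<sigma>: "0 < \<sigma>"
    and f: "f \<in> borel_measurable Gamma_measure" and dens: "M = density Gamma_measure (\<lambda>P. ennreal (f P))"
    and fin: "(\<integral>\<^sup>+P. (ennreal (f P))\<^sup>2 \<partial>Gamma_measure) < \<infinity>"
  shows "(\<Sum>l<N. gauss_mode M \<sigma> (int (Suc l))) \<le> (\<integral>\<^sup>+P. (ennreal (f P))\<^sup>2 \<partial>Gamma_measure)"
proof -
  let ?F = "\<integral>\<^sup>+P. (ennreal (f P))\<^sup>2 \<partial>Gamma_measure" and ?X = "\<Sum>l<N. gauss_mode M \<sigma> (int (Suc l))"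
  have "?X \<le> ?F * ennreal (1 + real N * inverse (real (Suc n)))" for n
  proof -
    have "of_nat (Suc n) * ?X \<le> of_nat (N + Suc n) * ?F"
      using order.trans[OF toeplitz_sum_lower_bound[where n = "Suc n" and N = N] gauss_mode_double_sum_bound[OF M \<sigma> f dens]] .
    then have "ennreal (inverse (real (Suc n))) * (of_nat (Suc n) * ?X) \<le> ennreal (inverse (real (Suc n))) * (of_nat (N + Suc n) * ?F)"
      by (rule mult_left_mono) simp
    then have scaled: "(ennreal (inverse (real (Suc n))) * of_nat (Suc n)) * ?X \<le> (ennreal (inverse (real (Suc n))) * of_nat (N + Suc n)) * ?F"
      by (simp only: mult.assoc)
    have "ennreal (inverse (real (Suc n))) * of_nat (Suc n) = 1"
      unfolding ennreal_of_nat_eq_real_of_nat by (subst ennreal_mult[symmetric]) auto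
    moreover have "ennreal (inverse (real (Suc n))) * of_nat (N + Suc n) = ennreal (1 + real N * inverse (real (Suc n)))"
      unfolding ennreal_of_nat_eq_real_of_nat by (subst ennreal_mult[symmetric]) (auto simp: field_simps)
    ultimately have "1 * ?X \<le> ennreal (1 + real N * inverse (real (Suc n))) * ?F"
      using scaled by (simp only:)
    then show ?thesis by (simp only: mult_1 mult.commute[of _ ?F])
  qed
  moreover have "(\<lambda>n. ?F * ennreal (1 + real N * inverse (real (Suc n)))) \<longlonglongrightarrow> ?F * ennreal (1 + real N * 0)"
    using fin by (intro ennreal_tendsto_cmult tendsto_ennrealI tendsto_intros LIMSEQ_inverse_real_of_nat) auto
  ultimately have "?X \<le> ?F * ennreal (1 + real N * 0)" by (intro LIMSEQ_le_const) auto
  then show ?thesis by simp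
qed

text \<open>
  Bessel's inequality: the Fejer weights are removed by \<open>gauss_mode_sum_bound\<close>, the Gaussian weights by monotone
  convergence as \<open>\<sigma> \<rightarrow> \<infinity>\<close>.
\<close>
theorem fourier_L2_bound:
  assumes M: "M \<in> space (prob_algebra Gamma_borel)"
    and f: "f \<in> borel_measurable Gamma_measure" and dens: "M = density Gamma_measure (\<lambda>P. ennreal (f P))"
    and f_nonneg: "AE P in Gamma_measure. 0 \<le> f P" and f_sq: "integrable Gamma_measure (\<lambda>P. (f P)\<^sup>2)"
  shows "(\<integral>\<^sup>+\<xi>\<in>{0..}. (\<Sum>k. ennreal ((norm (LINT P|M. wave (int (Suc k)) \<xi> P))\<^sup>2)) \<partial>lborel)
    \<le> ennreal (LINT P|Gamma_measure. (f P)\<^sup>2)"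
proof -
  let ?c = "\<lambda>k \<xi>. LINT P|M. wave (int (Suc k)) \<xi> P"
  note [measurable] = fourier_measurable[OF M]
  have F: "(\<integral>\<^sup>+P. (ennreal (f P))\<^sup>2 \<partial>Gamma_measure) = ennreal (LINT P|Gamma_measure. (f P)\<^sup>2)"
  proof -
    have "(\<integral>\<^sup>+P. (ennreal (f P))\<^sup>2 \<partial>Gamma_measure) = (\<integral>\<^sup>+P. ennreal ((f P)\<^sup>2) \<partial>Gamma_measure)"
      using f_nonneg by (intro nn_integral_cong_AE) (auto elim!: eventually_mono simp: ennreal_power)
    then show ?thesis by (simp add: nn_integral_eq_integral[OF f_sq])
  qed
  have lim: "(\<lambda>n. gauss_mode M (real (Suc n)) (int (Suc k))) \<longlonglongrightarrow> (\<integral>\<^sup>+\<xi>. ennreal ((norm (?c k \<xi>))\<^sup>2) \<partial>lborel)" for k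
    unfolding gauss_mode_def
  proof (rule nn_integral_LIMSEQ)
    show "incseq (\<lambda>n \<xi>. ennreal (exp (- (\<xi> / real (Suc n))\<^sup>2 / 2) * (norm (?c k \<xi>))\<^sup>2))"
    proof (intro monoI le_funI ennreal_leI mult_right_mono)
      fix m n :: nat and \<xi> :: real assume mn: "m \<le> n"
      have "(\<bar>\<xi>\<bar> / real (Suc n))\<^sup>2 \<le> (\<bar>\<xi>\<bar> / real (Suc m))\<^sup>2"
        using mn by (intro power_mono divide_left_mono) auto
      then have "(\<xi> / real (Suc n))\<^sup>2 \<le> (\<xi> / real (Suc m))\<^sup>2" by (simp only: power_divide power2_abs)
      then show "exp (- (\<xi> / real (Suc m))\<^sup>2 / 2) \<le> exp (- (\<xi> / real (Suc n))\<^sup>2 / 2)" by simp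
    qed simp
    show "(\<lambda>\<xi>. ennreal (exp (- (\<xi> / real (Suc n))\<^sup>2 / 2) * (norm (?c k \<xi>))\<^sup>2)) \<in> borel_measurable lborel" for n
      by measurable
    fix \<xi> :: real
    have "(\<lambda>n. \<xi> * inverse (real (Suc n))) \<longlonglongrightarrow> 0"
      by (rule tendsto_mult_right_zero[OF LIMSEQ_inverse_real_of_nat])
    then have "(\<lambda>n. \<xi> / real (Suc n)) \<longlonglongrightarrow> 0" by (simp only: divide_inverse)
    then have "(\<lambda>n. ennreal (exp (- (\<xi> / real (Suc n))\<^sup>2 / 2) * (norm (?c k \<xi>))\<^sup>2)) \<longlonglongrightarrow> ennreal (exp (- 0\<^sup>2 / 2) * (norm (?c k \<xi>))\<^sup>2)"
      by (intro tendsto_ennrealI tendsto_mult tendsto_exp tendsto_divide tendsto_minus tendsto_power tendsto_const) auto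
    then show "(\<lambda>n. ennreal (exp (- (\<xi> / real (Suc n))\<^sup>2 / 2) * (norm (?c k \<xi>))\<^sup>2)) \<longlonglongrightarrow> ennreal ((norm (?c k \<xi>))\<^sup>2)"
      by simp
  qed
  have fin: "(\<integral>\<^sup>+P. (ennreal (f P))\<^sup>2 \<partial>Gamma_measure) < \<infinity>" unfolding F by simp
  have gauss_le: "(\<Sum>k<N. gauss_mode M (real (Suc n)) (int (Suc k))) \<le> ennreal (LINT P|Gamma_measure. (f P)\<^sup>2)" for N n
    by (rule gauss_mode_sum_bound[OF M of_nat_0_less_iff[THEN iffD2, OF zero_less_Suc] f dens fin, THEN order.trans])
      (rule eq_refl[OF F])
  have partial: "(\<Sum>k<N. \<integral>\<^sup>+\<xi>. ennreal ((norm (?c k \<xi>))\<^sup>2) \<partial>lborel) \<le> ennreal (LINT P|Gamma_measure. (f P)\<^sup>2)" for N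
  proof (rule LIMSEQ_le_const2)
    show "(\<lambda>n. \<Sum>k<N. gauss_mode M (real (Suc n)) (int (Suc k))) \<longlonglongrightarrow> (\<Sum>k<N. \<integral>\<^sup>+\<xi>. ennreal ((norm (?c k \<xi>))\<^sup>2) \<partial>lborel)"
      by (rule tendsto_sum) (rule lim)
    show "\<exists>n0. \<forall>n\<ge>n0. (\<Sum>k<N. gauss_mode M (real (Suc n)) (int (Suc k))) \<le> ennreal (LINT P|Gamma_measure. (f P)\<^sup>2)"
      by (rule exI[of _ 0]) (intro allI impI gauss_le)
  qed
  have half: "(\<integral>\<^sup>+\<xi>\<in>{0..}. (\<Sum>k. ennreal ((norm (?c k \<xi>))\<^sup>2)) \<partial>lborel) \<le> (\<integral>\<^sup>+\<xi>. (\<Sum>k. ennreal ((norm (?c k \<xi>))\<^sup>2)) \<partial>lborel)"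
  proof (rule nn_integral_mono)
    fix \<xi> :: real
    show "(\<Sum>k. ennreal ((norm (?c k \<xi>))\<^sup>2)) * indicator {0..} \<xi> \<le> (\<Sum>k. ennreal ((norm (?c k \<xi>))\<^sup>2))"
      by (cases "0 \<le> \<xi>") simp_all
  qed
  have meas: "(\<lambda>\<xi>. ennreal ((norm (?c k \<xi>))\<^sup>2)) \<in> borel_measurable lborel" for k
    using fourier_measurable[OF M, of "int (Suc k)"] by simp
  note half
  also note nn_integral_suminf[OF meas]
  also have "(\<Sum>k. \<integral>\<^sup>+\<xi>. ennreal ((norm (?c k \<xi>))\<^sup>2) \<partial>lborel) \<le> ennreal (LINT P|Gamma_measure. (f P)\<^sup>2)"
    unfolding suminf_eq_SUP by (rule SUP_least) (rule partial)
  finally show ?thesis .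
qed

section \<open>The energy inequality for weak solutions\<close>

text \<open>
  A characteristic function equals \<open>1\<close> at \<open>0\<close> and is continuous.
\<close>
lemma integral_norm_char_pos:
  assumes g: "real_distribution g" and g_hat: "set_integrable lborel {0..} (\<lambda>\<xi>. norm (char g \<xi>))"
  shows "0 < (LINT \<xi>:{0..}|lborel. norm (char g \<xi>))"
proof -
  interpret g: real_distribution g by (rule g)
  have "isCont (\<lambda>\<xi>. norm (char g \<xi>)) 0" by (intro continuous_intros g.isCont_char)
  then have "((\<lambda>\<xi>. norm (char g \<xi>)) \<longlongrightarrow> 1) (at 0)" by (simp add: isCont_def g.char_zero)
  from order_tendstoD(1)[OF this, of "1/2"]
  obtain d where d: "0 < d" "\<And>\<xi>. \<xi> \<noteq> 0 \<Longrightarrow> \<bar>\<xi>\<bar> < d \<Longrightarrow> 1/2 < norm (char g \<xi>)"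
    by (auto simp: eventually_at dist_real_def)
  have half: "1/2 \<le> norm (char g \<xi>)" if "\<xi> \<in> {0..d/2}" for \<xi>
    using d(2)[of \<xi>] that d(1) by (cases "\<xi> = 0") (auto simp: g.char_zero)
  have i: "integrable lborel (\<lambda>\<xi>. indicator {0..d/2} \<xi> * (1/2) :: real)"
    using d(1) by (intro integrable_mult_left integrable_real_indicator) auto
  have "0 < d / 4" using d(1) by simp
  also have "d / 4 = (LINT \<xi>|lborel. indicator {0..d/2} \<xi> * (1/2))"
    using d(1) by (simp only: integral_mult_left_zero) simp
  also have "\<dots> \<le> (LINT \<xi>:{0..}|lborel. norm (char g \<xi>))"
    using i g_hat half d(1) unfolding set_lebesgue_integral_def set_integrable_def
    by (intro integral_mono) (auto simp: indicator_def)
  finally show ?thesis .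
qed

lemma velocity_marginal_char:
  assumes g: "g \<in> space (prob_algebra borel)" and \<rho>in: "\<rho>in \<in> space (prob_algebra Gamma_borel)"
    and marg: "has_velocity_marginal \<rho>in g"
  shows "(LINT P|\<rho>in. wave 0 \<xi> P) = char g \<xi>"
proof -
  interpret g: prob_space g using g by (simp add: space_prob_algebra)
  interpret \<rho>: prob_space \<rho>in by (rule space_prob_algebra_GammaD(1)[OF \<rho>in])
  note [measurable] = Gamma_coord_measurable[OF space_prob_algebra_GammaD(2)[OF \<rho>in]]
  have sg: "sets g = sets borel" using g by (simp add: space_prob_algebra)
  have "g = distr \<rho>in borel snd"
  proof (rule measure_eqI)
    fix A assume "A \<in> sets g"
    then have A: "A \<in> sets borel" by (simp add: sg)
    have "emeasure (distr \<rho>in borel snd) A = emeasure \<rho>in (snd -` A \<inter> space \<rho>in)"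
      using A by (intro emeasure_distr) auto
    also have "snd -` A \<inter> space \<rho>in = {0..<2*pi} \<times> A"
      unfolding space_prob_algebra_GammaD(3)[OF \<rho>in] Gamma_def by auto
    finally show "emeasure g A = emeasure (distr \<rho>in borel snd) A"
      using marg A unfolding has_velocity_marginal_def by (simp add: g.emeasure_eq_measure \<rho>.emeasure_eq_measure)
  qed (simp add: sg)
  then have "char g \<xi> = (LINT P|\<rho>in. iexp (\<xi> * snd P))"
    by (simp only: char_def) (rule integral_distr, measurable)
  then show ?thesis by (simp add: wave_def)
qed

text \<open>
  Starting at an arbitrary time \<open>s0\<close> gives monotonicity of the energy and not only a comparison with time \<open>0\<close>. The
  shift of time by \<open>s0\<close> is a shift of \<open>\<zeta>\<close> by \<open>l s0\<close> on characteristics.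
\<close>
lemma (in kuramoto_flow) shifted_modes:
  assumes K: "0 \<le> K" and s0: "0 \<le> s0"
  shows "kuramoto_modes K (\<lambda>t l \<xi>. fourier_u \<rho> (s0 + max 0 t) (int l) \<xi>)"
proof
  show "0 \<le> K" by (rule K)
  show "norm (fourier_u \<rho> (s0 + max 0 t) (int l) \<xi>) \<le> 1" for t l \<xi>
    using s0 by (intro norm_fourier_u_le) simp
  show "continuous_on UNIV (\<lambda>p. fourier_u \<rho> (s0 + max 0 (fst p)) (int l) (snd p))" for l
    by (rule continuous_on_compose2[OF fourier_u_cont, of _ "\<lambda>p. (s0 + max 0 (fst p), snd p)", simplified])
      (use s0 in \<open>auto intro!: continuous_intros\<close>)
  fix t \<zeta> :: real and l :: nat assume t: "0 \<le> t"
  let ?L = "int (Suc l)"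
  let ?z = "\<lambda>s. (\<zeta> + of_int ?L * s0) - of_int ?L * s"
  let ?rhs = "of_real (K * real (Suc l) / 2) *
      (fourier_u \<rho> (s0 + max 0 t) (int 1) 0 * fourier_u \<rho> (s0 + max 0 t) (int l) (\<zeta> - real (Suc l) * t)
        - cnj (fourier_u \<rho> (s0 + max 0 t) (int 1) 0) * fourier_u \<rho> (s0 + max 0 t) (int (Suc (Suc l))) (\<zeta> - real (Suc l) * t))"
  have "((\<lambda>s. fourier_u \<rho> s ?L (?z s)) has_vector_derivative
     coupling (s0 + t) ?L (?z (s0 + t))) (at (s0 + t) within {0..})"
    using s0 t by (intro mode_equation) simp
  then have outer: "((\<lambda>s. fourier_u \<rho> s ?L (?z s)) has_vector_derivative
     coupling (s0 + t) ?L (?z (s0 + t))) (at (s0 + t) within (\<lambda>s. s0 + s) ` {0..})"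
    by (rule has_vector_derivative_within_subset) (use s0 in auto)
  have inner: "((\<lambda>s. s0 + s) has_vector_derivative 1) (at t within {0..})"
    by (auto intro!: derivative_eq_intros)
  have chain: "((\<lambda>s. fourier_u \<rho> (s0 + s) ?L (?z (s0 + s))) has_vector_derivative
     coupling (s0 + t) ?L (?z (s0 + t))) (at t within {0..})"
    using vector_diff_chain_within[OF inner outer] by (simp add: o_def)
  have arg: "?z (s0 + s) = \<zeta> - real (Suc l) * s" for s
    by (simp add: algebra_simps)
  show "((\<lambda>s. fourier_u \<rho> (s0 + max 0 s) ?L (\<zeta> - real (Suc l) * s)) has_vector_derivative
      ?rhs)
    (at t within {0..})"
  proof (rule has_vector_derivative_transform[of t "{0..}"])
    have eq: "coupling (s0 + t) ?L (\<zeta> - real (Suc l) * t) = ?rhs"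
      using t by (simp add: coupling_def order_parameter_eq add.commute)
    show "((\<lambda>s. fourier_u \<rho> (s0 + s) ?L (\<zeta> - real (Suc l) * s)) has_vector_derivative
      ?rhs)
    (at t within {0..})"
      using chain unfolding arg eq .
  qed (use t in auto)
qed

lemma energy_le_L2:
  assumes flow: "kuramoto_flow K \<rho>in \<rho>"
    and \<phi>_nonneg: "\<And>\<xi>. 0 \<le> \<xi> \<Longrightarrow> 0 \<le> \<phi> \<xi>" and \<phi>_le: "\<And>\<xi>. 0 \<le> \<xi> \<Longrightarrow> \<phi> \<xi> \<le> S" and S: "0 \<le> S"
    and f: "f \<in> borel_measurable Gamma_measure" "AE P in Gamma_measure. 0 \<le> f P"
      "integrable Gamma_measure (\<lambda>P. (f P)\<^sup>2)" "\<rho>in = density Gamma_measure (\<lambda>P. ennreal (f P))"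
  shows "energy \<phi> \<rho> 0 \<le> ennreal (S * (LINT P|Gamma_measure. (f P)\<^sup>2))"
proof -
  interpret kuramoto_flow K \<rho>in \<rho> by (rule flow)
  let ?c = "\<lambda>k \<xi>. LINT P|\<rho>in. wave (int (Suc k)) \<xi> P"
  note [measurable] = fourier_measurable[OF \<rho>in_space]
  have "energy \<phi> \<rho> 0 = (\<integral>\<^sup>+\<xi>\<in>{0..}. (\<Sum>k. ennreal (1 / real (Suc k) * (norm (?c k \<xi>))\<^sup>2 * \<phi> \<xi>)) \<partial>lborel)"
    unfolding energy_def fourier_u_0 ..
  also have "\<dots> \<le> (\<integral>\<^sup>+\<xi>. ennreal S * ((\<Sum>k. ennreal ((norm (?c k \<xi>))\<^sup>2)) * indicator {0..} \<xi>) \<partial>lborel)"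
  proof (rule nn_integral_mono)
    fix \<xi> :: real
    show "(\<Sum>k. ennreal (1 / real (Suc k) * (norm (?c k \<xi>))\<^sup>2 * \<phi> \<xi>)) * indicator {0..} \<xi>
       \<le> ennreal S * ((\<Sum>k. ennreal ((norm (?c k \<xi>))\<^sup>2)) * indicator {0..} \<xi>)"
    proof (cases "0 \<le> \<xi>")
      case True
      have "ennreal (1 / real (Suc k) * (norm (?c k \<xi>))\<^sup>2 * \<phi> \<xi>) \<le> ennreal S * ennreal ((norm (?c k \<xi>))\<^sup>2)" for k
      proof -
        have "1 / real (Suc k) * (norm (?c k \<xi>))\<^sup>2 * \<phi> \<xi> \<le> 1 * (norm (?c k \<xi>))\<^sup>2 * S"
          using True S by (intro mult_mono \<phi>_le \<phi>_nonneg) auto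
        then have "ennreal (1 / real (Suc k) * (norm (?c k \<xi>))\<^sup>2 * \<phi> \<xi>) \<le> ennreal (S * (norm (?c k \<xi>))\<^sup>2)"
          by (intro ennreal_leI) (simp only: mult_1 mult.commute[of S])
        then show ?thesis using S by (simp only: ennreal_mult zero_le_power2)
      qed
      then have "(\<Sum>k. ennreal (1 / real (Suc k) * (norm (?c k \<xi>))\<^sup>2 * \<phi> \<xi>)) \<le> (\<Sum>k. ennreal S * ennreal ((norm (?c k \<xi>))\<^sup>2))"
        by (intro suminf_le) auto
      then show ?thesis using True by simp
    qed simp
  qed
  also have "\<dots> = ennreal S * (\<integral>\<^sup>+\<xi>\<in>{0..}. (\<Sum>k. ennreal ((norm (?c k \<xi>))\<^sup>2)) \<partial>lborel)"
    by (rule nn_integral_cmult) measurable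
  also have "\<dots> \<le> ennreal S * ennreal (LINT P|Gamma_measure. (f P)\<^sup>2)"
    by (intro mult_left_mono fourier_L2_bound[OF \<rho>in_space f(1,4,2,3)]) simp
  finally show ?thesis using S by (simp add: ennreal_mult')
qed

theorem theorem1:
  fixes g :: "real measure" and K :: real
  assumes g: "g \<in> space (prob_algebra borel)"
    and g_hat: "set_integrable lborel {0..} (\<lambda>\<xi>. norm (char g \<xi>))"
    and K_nonneg: "0 \<le> K"
    and K_less: "K < K_ec g"
  shows "\<exists>(c::real) (\<phi>::real \<Rightarrow> real).
    c > 0 \<and> C1_weight \<phi> \<and> strict_mono_on {0..} \<phi> \<and> bounded (\<phi> ` {0..}) \<and> \<phi> 0 = 1 \<and>
    (\<forall>\<rho>in \<rho>. kuramoto_solution K \<rho>in \<rho> \<and> has_velocity_marginal \<rho>in g \<longrightarrow>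
       (\<forall>t\<ge>0. energy \<phi> \<rho> t
               + ennreal c * (\<integral>\<^sup>+s\<in>{0..t}. ennreal ((norm (order_parameter \<rho> s))\<^sup>2) \<partial>lborel)
             \<le> energy \<phi> \<rho> 0) \<and>
       (\<forall>s t. 0 \<le> s \<and> s \<le> t \<longrightarrow> energy \<phi> \<rho> t \<le> energy \<phi> \<rho> s) \<and>
       (\<integral>\<^sup>+s\<in>{0..}. ennreal ((norm (order_parameter \<rho> s))\<^sup>2) \<partial>lborel) \<le> energy \<phi> \<rho> 0 / ennreal c \<and>
       (energy \<phi> \<rho> 0 < \<infinity> \<longrightarrow> energy \<phi> \<rho> 0 / ennreal c < \<infinity>) \<and>
       (\<forall>f. f \<in> borel_measurable Gamma_measure \<and> (AE P in Gamma_measure. 0 \<le> f P) \<and>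
            integrable Gamma_measure (\<lambda>P. (f P)\<^sup>2) \<and>
            \<rho>in = density Gamma_measure (\<lambda>P. ennreal (f P)) \<longrightarrow>
          energy \<phi> \<rho> 0
            \<le> ennreal ((SUP \<xi>\<in>{0..}. \<bar>\<phi> \<xi>\<bar>) * (LINT P|Gamma_measure. (f P)\<^sup>2))))"
  (is "\<exists>c \<phi>. _ \<and> _ \<and> _ \<and> _ \<and> _ \<and> (\<forall>\<rho>in \<rho>. _ \<longrightarrow> ?claim c \<phi> \<rho>in \<rho>)")
proof -
  have "prob_space g" "sets g = sets borel" using g by (auto simp: space_prob_algebra)
  then have dist: "real_distribution g"
    by (intro real_distribution.intro real_distribution_axioms.intro)
  interpret g: real_distribution g by (rule dist)
  have char_cont: "continuous_on {0..} (\<lambda>\<xi>. norm (char g \<xi>))"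
    by (intro continuous_at_imp_continuous_on ballI continuous_intros g.isCont_char)
  note weight = exists_energy_weight[OF char_cont norm_ge_zero g_hat integral_norm_char_pos[OF dist g_hat]
      K_nonneg K_less[unfolded K_ec_def]]
  obtain c B \<phi> \<phi>' h where c: "0 < c"
    and \<phi>_deriv: "\<And>\<xi>. 0 \<le> \<xi> \<Longrightarrow> (\<phi> has_real_derivative \<phi>' \<xi>) (at \<xi> within {0..})"
    and \<phi>'_cont: "continuous_on {0..} \<phi>'" and \<phi>'_int: "set_integrable lborel {0..} \<phi>'"
    and \<phi>'_pos: "\<And>\<xi>. 0 \<le> \<xi> \<Longrightarrow> 0 < \<phi>' \<xi>" and \<phi>_0: "\<phi> 0 = 1"
    and \<phi>_ge: "\<And>\<xi>. 0 \<le> \<xi> \<Longrightarrow> 1 \<le> \<phi> \<xi>" and \<phi>_le: "\<And>\<xi>. 0 \<le> \<xi> \<Longrightarrow> \<phi> \<xi> \<le> B"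
    and h_nonneg: "\<And>\<xi>. 0 \<le> \<xi> \<Longrightarrow> 0 \<le> h \<xi>" and h_int: "set_integrable lborel {0..} h"
    and h_le: "(LINT \<xi>:{0..}|lborel. h \<xi>) \<le> 1 - c"
    and absorb: "\<And>\<xi> x y. 0 \<le> \<xi> \<Longrightarrow> K * \<phi> \<xi> * (x * (norm (char g \<xi>) * y)) \<le> \<phi>' \<xi> * y\<^sup>2 + x\<^sup>2 * h \<xi>"
    by (rule weight) (rule that; assumption)
  have "C1_weight \<phi>" unfolding C1_weight_def using \<phi>_deriv \<phi>'_cont by blast
  moreover have "strict_mono_on {0..} \<phi>"
  proof (rule strict_mono_onI)
    fix a b :: real assume ab: "a \<in> {0..}" "a < b"
    show "\<phi> a < \<phi> b"
    proof (rule DERIV_pos_imp_increasing_open[OF ab(2)])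
      fix x assume x: "a < x" "x < b"
      then have "0 < x" using ab by simp
      then have "(\<phi> has_real_derivative \<phi>' x) (at x)"
        using \<phi>_deriv[of x] at_within_interior[of x "{0..}"] by (simp add: interior_Ici[of "-1"])
      then show "\<exists>y. (\<phi> has_real_derivative y) (at x) \<and> 0 < y" using \<phi>'_pos[of x] \<open>0 < x\<close> by auto
    next
      have "continuous_on {0..} \<phi>"
        using \<phi>_deriv by (auto simp: continuous_on_eq_continuous_within intro: DERIV_continuous)
      then show "continuous_on {a..b} \<phi>" by (rule continuous_on_subset) (use ab in auto)
    qed
  qed
  moreover have abs_\<phi>: "\<bar>\<phi> \<xi>\<bar> \<le> B" if "\<xi> \<in> {0..}" for \<xi>
    using \<phi>_ge[of \<xi>] \<phi>_le[of \<xi>] that by auto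
  then have "bounded (\<phi> ` {0..})" by (intro boundedI[of _ B]) auto
  moreover have "?claim c \<phi> \<rho>in \<rho>"
    if sol: "kuramoto_solution K \<rho>in \<rho>" and marg: "has_velocity_marginal \<rho>in g" for \<rho>in \<rho>
  proof -
    have flow: "kuramoto_flow K \<rho>in \<rho>" by (rule kuramoto_flow.intro[OF sol])
    interpret kuramoto_flow K \<rho>in \<rho> by (rule flow)
    have decay: "energy \<phi> \<rho> (s0 + t) + ennreal c * (\<integral>\<^sup>+s\<in>{0..t}. ennreal ((norm (order_parameter \<rho> (s0 + s)))\<^sup>2) \<partial>lborel)
        \<le> energy \<phi> \<rho> s0" if s0: "0 \<le> s0" and t: "0 \<le> t" for s0 t
    proof -
      interpret modes: kuramoto_modes K "\<lambda>t l \<xi>. fourier_u \<rho> (s0 + max 0 t) (int l) \<xi>"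
        by (rule shifted_modes[OF K_nonneg s0])
      have zero: "fourier_u \<rho> (s0 + max 0 r) (int 0) \<xi> = char g \<xi>" for r \<xi>
        using zero_mode_conserved[of "s0 + max 0 r" \<xi>] velocity_marginal_char[OF g \<rho>in_space marg, of \<xi>] s0 by simp
      interpret w: weighted_modes K "\<lambda>t l \<xi>. fourier_u \<rho> (s0 + max 0 t) (int l) \<xi>" \<phi> \<phi>' h B c
      proof
        show "K * \<phi> \<xi> * (norm (fourier_u \<rho> (s0 + max 0 r) (int 1) 0) * (norm (fourier_u \<rho> (s0 + max 0 r) (int 0) \<xi>) * y))
          \<le> \<phi>' \<xi> * y\<^sup>2 + (norm (fourier_u \<rho> (s0 + max 0 r) (int 1) 0))\<^sup>2 * h \<xi>" if "0 \<le> \<xi>" for r \<xi> y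
          unfolding zero by (rule absorb[OF that])
      qed (use \<phi>_deriv \<phi>'_cont \<phi>'_int less_imp_le[OF \<phi>'_pos] \<phi>_0 order.trans[OF zero_le_one \<phi>_ge] \<phi>_le c h_nonneg h_int h_le in auto)
      have en: "w.modal_energy r = energy \<phi> \<rho> (s0 + r)" if "0 \<le> r" for r
        using that by (simp add: w.modal_energy_def energy_def modes.mode_sq_def del: of_nat_Suc)
      have ord: "(\<integral>\<^sup>+s\<in>{0..t}. ennreal ((norm (fourier_u \<rho> (s0 + max 0 s) (int 1) 0))\<^sup>2) \<partial>lborel)
          = (\<integral>\<^sup>+s\<in>{0..t}. ennreal ((norm (order_parameter \<rho> (s0 + s)))\<^sup>2) \<partial>lborel)"
        by (intro nn_integral_cong) (auto simp: indicator_def order_parameter_eq)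
      show ?thesis using w.modal_energy_decay[OF t] en[OF t] en[of 0] unfolding ord by simp
    qed
    have first: "energy \<phi> \<rho> t + ennreal c * (\<integral>\<^sup>+s\<in>{0..t}. ennreal ((norm (order_parameter \<rho> s))\<^sup>2) \<partial>lborel) \<le> energy \<phi> \<rho> 0"
      if "0 \<le> t" for t using decay[of 0 t] that by simp
    have mono: "energy \<phi> \<rho> t \<le> energy \<phi> \<rho> s" if "0 \<le> s" "s \<le> t" for s t
    proof -
      have "energy \<phi> \<rho> t \<le> energy \<phi> \<rho> t + ennreal c * (\<integral>\<^sup>+r\<in>{0..t - s}. ennreal ((norm (order_parameter \<rho> (s + r)))\<^sup>2) \<partial>lborel)"
        by simp
      also have "\<dots> \<le> energy \<phi> \<rho> s" using decay[of s "t - s"] that by simp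
      finally show ?thesis .
    qed
    have total: "(\<integral>\<^sup>+s\<in>{0..}. ennreal ((norm (order_parameter \<rho> s))\<^sup>2) \<partial>lborel) \<le> energy \<phi> \<rho> 0 / ennreal c"
    proof -
      let ?f = "\<lambda>n s. ennreal ((norm (order_parameter \<rho> s))\<^sup>2) * indicator {0..real n} s"
      have fin_n: "(\<integral>\<^sup>+s. ?f n s \<partial>lborel) \<le> energy \<phi> \<rho> 0 / ennreal c" for n
      proof -
        have "ennreal c * (\<integral>\<^sup>+s. ?f n s \<partial>lborel) \<le> energy \<phi> \<rho> (real n) + ennreal c * (\<integral>\<^sup>+s. ?f n s \<partial>lborel)" by simp
        also have "\<dots> \<le> energy \<phi> \<rho> 0" by (rule first) simp
        finally have "(\<integral>\<^sup>+s. ?f n s \<partial>lborel) * ennreal c / ennreal c \<le> energy \<phi> \<rho> 0 / ennreal c"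
          by (intro divide_right_mono_ennreal) (simp only: mult.commute)
        then show ?thesis using c by (simp add: mult_divide_eq_ennreal)
      qed
      have "(\<lambda>n. \<integral>\<^sup>+s. ?f n s \<partial>lborel) \<longlonglongrightarrow> (\<integral>\<^sup>+s\<in>{0..}. ennreal ((norm (order_parameter \<rho> s))\<^sup>2) \<partial>lborel)"
      proof (rule nn_integral_LIMSEQ)
        show "incseq ?f" by (intro monoI le_funI mult_left_mono) (auto simp: indicator_def)
        have eq: "?f n s = ennreal (indicator {0..real n} s *\<^sub>R (norm (order_parameter \<rho> s))\<^sup>2)" for n s
          by (simp add: indicator_def)
        show "?f n \<in> borel_measurable lborel" for n
        proof -
          have "continuous_on {0..real n} (\<lambda>s. (norm (order_parameter \<rho> s))\<^sup>2)"
            by (intro continuous_intros continuous_on_subset[OF order_parameter_cont]) auto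
          from borel_measurable_continuous_on_indicator[OF _ this]
          have "(\<lambda>s. indicator {0..real n} s *\<^sub>R (norm (order_parameter \<rho> s))\<^sup>2) \<in> borel_measurable lborel"
            by simp
          then show ?thesis unfolding eq by (rule measurable_compose[OF _ measurable_ennreal])
        qed
        fix s :: real
        obtain n0 :: nat where n0: "s \<le> real n0" using real_arch_simple by blast
        have "\<forall>\<^sub>F n in sequentially. ennreal ((norm (order_parameter \<rho> s))\<^sup>2) * indicator {0..} s = ?f n s"
          using eventually_ge_at_top[of n0] by eventually_elim (use n0 in \<open>auto simp: indicator_def\<close>)
        then show "(\<lambda>n. ?f n s) \<longlonglongrightarrow> ennreal ((norm (order_parameter \<rho> s))\<^sup>2) * indicator {0..} s"
          by (rule Lim_transform_eventually[OF tendsto_const])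
      qed
      then show ?thesis by (rule LIMSEQ_le_const2) (use fin_n in blast)
    qed
    have finite: "energy \<phi> \<rho> 0 < \<infinity> \<longrightarrow> energy \<phi> \<rho> 0 / ennreal c < \<infinity>"
      using c by (cases "energy \<phi> \<rho> 0" rule: ennreal_cases) (auto simp: divide_ennreal)
    have L2: "energy \<phi> \<rho> 0 \<le> ennreal ((SUP \<xi>\<in>{0..}. \<bar>\<phi> \<xi>\<bar>) * (LINT P|Gamma_measure. (f P)\<^sup>2))"
      if "f \<in> borel_measurable Gamma_measure" "AE P in Gamma_measure. 0 \<le> f P"
        "integrable Gamma_measure (\<lambda>P. (f P)\<^sup>2)" "\<rho>in = density Gamma_measure (\<lambda>P. ennreal (f P))" for f
    proof (rule energy_le_L2[OF flow _ _ _ that])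
      have bdd: "bdd_above ((\<lambda>\<xi>. \<bar>\<phi> \<xi>\<bar>) ` {0..})" by (rule bdd_aboveI2[OF abs_\<phi>])
      show le: "\<phi> \<xi> \<le> (SUP \<xi>\<in>{0..}. \<bar>\<phi> \<xi>\<bar>)" if "0 \<le> \<xi>" for \<xi>
        using cSUP_upper[OF _ bdd, of \<xi>] that by simp
      show "0 \<le> (SUP \<xi>\<in>{0..}. \<bar>\<phi> \<xi>\<bar>)" using le[of 0] \<phi>_0 by simp
      show "0 \<le> \<phi> \<xi>" if "0 \<le> \<xi>" for \<xi> using \<phi>_ge[OF that] by simp
    qed
    show ?thesis using first mono total finite L2 by blast
  qed
  ultimately show ?thesis using c \<phi>_0 by blast
qed

end
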